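(* Let $\mu>0$, $Fr>0$ and $r=\frac{1}{\mu Fr^{2}}$. For any $T>0$ there exist functions $h_0,h_1\in H^2(0,1)$ with $h_0\ge c>0$ and $h_1\ge c_1>0$ on $(0,1)$ for some constants $c,c_1$, with corresponding initial velocity $u_0=-\mu\,\partial_x\ln h_0\in H^1(0,1)$ and target function $u_1=-\mu\,\partial_x\ln h_1\in H^1(0,1)$, and a constant $C>0$ depending on $T$, $h_0$ and $h_1$, such that for all $v_1\in H^{3/4}(0,T)$ and $v_2\in H^{3/4}(0,T)$ satisfying the compatibility conditions $v_1(0)=u_0(0)$ and $v_2(0)=u_0(1)$, the associated solution $(h,u)\in X_T$ of $$\begin{cases}\partial_t h+\partial_x(hu)=0, & (t,x)\in(0,T)\times(0,1),\\ \partial_t(hu)+\partial_x(h|u|^2)-\partial_x(\mu h\,\partial_x u)+\dfrac{\partial_x h}{Fr^2}+r\,h\,u=0, & (t,x)\in(0,T)\times(0,1),\\ u(t,0)=v_1(t),\quad u(t,1)=v_2(t), & t\in(0,T),\\ h(0,x)=h_0(x),\quad u(0,x)=u_0(x), & x\in(0,1),\end{cases}$$ satisfies $$\|u(T,\cdot)-u_1(\cdot)\|_{H^1(0,1)}\ge C>0.$$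
   Context: The system is the one-dimensional viscous shallow water (compressible Navier-Stokes) system with friction; $h$ is the height, $u$ the velocity, $\mu>0$ the viscosity coefficient, $Fr>0$ the Froude number, and the friction coefficient is $r=\frac{1}{\mu Fr^2}$. The functions $v_1,v_2$ are boundary controls acting at the two endpoints of $(0,1)$. The solution space is $$X_T=L^\infty(0,T;H^2(0,1))\times\big(L^2(0,T;H^2(0,1))\cap H^1(0,T;L^2(0,1))\big),$$ where $h$ belongs to the first factor and $u$ to the second. The initial data are assumed to satisfy $(h_0,u_0)\in H^2(0,1)\times H^1(0,1)$ with $h_0\ge c>0$.
   Formalization: The system gives no boundary value for h where fluid enters (v1>0 at x=0, v2<0 at x=1), so the associated solution is not determined; it is taken to be one with hu+μ∂ₓh=0 at those inflow points, with no restriction on v1, v2. *)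

theory Defs
  imports "HOL-Analysis.Analysis"
begin

text \<open>Elements of Lebesgue and Sobolev spaces are represented by Borel functions. Functions of
  \<open>(t, x)\<close> are curried, time first. Every notion below depends only on almost-everywhere classes.\<close>

definition L2_on :: "'a::euclidean_space set \<Rightarrow> ('a \<Rightarrow> real) \<Rightarrow> bool" where
  "L2_on A f \<longleftrightarrow> set_borel_measurable lborel A f \<and> set_integrable lborel A (\<lambda>x. (f x)\<^sup>2)"

definition L2_norm_on :: "'a::euclidean_space set \<Rightarrow> ('a \<Rightarrow> real) \<Rightarrow> real" where
  "L2_norm_on A f = sqrt (LINT x:A|lborel. (f x)\<^sup>2)"

subsection \<open>Sobolev spaces on a bounded interval\<close>

definition test_fun :: "real \<Rightarrow> real \<Rightarrow> (real \<Rightarrow> real) \<Rightarrow> bool" where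
  "test_fun a b \<phi> \<longleftrightarrow> (\<forall>n x. (deriv ^^ n) \<phi> differentiable (at x)) \<and>
     (\<exists>c d. a < c \<and> d < b \<and> (\<forall>x. x \<notin> {c..d} \<longrightarrow> \<phi> x = 0))"

definition loc_integrable :: "real \<Rightarrow> real \<Rightarrow> (real \<Rightarrow> real) \<Rightarrow> bool" where
  "loc_integrable a b f \<longleftrightarrow> (\<forall>c d. a < c \<and> d < b \<longrightarrow> set_integrable lborel {c..d} f)"

definition weak_deriv :: "real \<Rightarrow> real \<Rightarrow> (real \<Rightarrow> real) \<Rightarrow> (real \<Rightarrow> real) \<Rightarrow> bool" where
  "weak_deriv a b f g \<longleftrightarrow> loc_integrable a b f \<and> loc_integrable a b g \<and>
     (\<forall>\<phi>. test_fun a b \<phi> \<longrightarrow>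
        (LINT x:{a<..<b}|lborel. f x * deriv \<phi> x) = - (LINT x:{a<..<b}|lborel. g x * \<phi> x))"

text \<open>A representative of the (almost everywhere unique) weak derivative, if there is one.\<close>

definition weak_der :: "real \<Rightarrow> real \<Rightarrow> (real \<Rightarrow> real) \<Rightarrow> real \<Rightarrow> real" where
  "weak_der a b f = (SOME g. weak_deriv a b f g)"

definition in_H1 :: "real \<Rightarrow> real \<Rightarrow> (real \<Rightarrow> real) \<Rightarrow> bool" where
  "in_H1 a b f \<longleftrightarrow> L2_on {a<..<b} f \<and> (\<exists>g. weak_deriv a b f g \<and> L2_on {a<..<b} g)"

definition in_H2 :: "real \<Rightarrow> real \<Rightarrow> (real \<Rightarrow> real) \<Rightarrow> bool" where
  "in_H2 a b f \<longleftrightarrow> L2_on {a<..<b} f \<and> (\<exists>g. weak_deriv a b f g \<and> in_H1 a b g)"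

text \<open>Sobolev--Slobodeckij space of order \<open>0 < s < 1\<close>.\<close>

definition in_Hs :: "real \<Rightarrow> real \<Rightarrow> real \<Rightarrow> (real \<Rightarrow> real) \<Rightarrow> bool" where
  "in_Hs s a b f \<longleftrightarrow> L2_on {a<..<b} f \<and>
     set_integrable lborel ({a<..<b} \<times> {a<..<b})
       (\<lambda>(x, y). (f x - f y)\<^sup>2 / \<bar>x - y\<bar> powr (1 + 2 * s))"

text \<open>The norm is \<open>\<infinity>\<close> outside \<open>H\<^sup>1\<close>.\<close>

definition H1_norm :: "real \<Rightarrow> real \<Rightarrow> (real \<Rightarrow> real) \<Rightarrow> ennreal" where
  "H1_norm a b f =
     (if in_H1 a b f
      then ennreal (sqrt ((L2_norm_on {a<..<b} f)\<^sup>2 + (L2_norm_on {a<..<b} (weak_der a b f))\<^sup>2))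
      else \<infinity>)"

text \<open>\<open>y\<close> is the value at \<open>p \<in> [a, b]\<close> of the continuous representative of \<open>f\<close> on \<open>[a, b]\<close>.\<close>

definition point_value :: "real \<Rightarrow> real \<Rightarrow> (real \<Rightarrow> real) \<Rightarrow> real \<Rightarrow> real \<Rightarrow> bool" where
  "point_value a b f p y \<longleftrightarrow> (\<exists>F. continuous_on {a..b} F \<and>
     (AE x in lborel. x \<in> {a<..<b} \<longrightarrow> F x = f x) \<and> F p = y)"

subsection \<open>Spaces of functions of time and space\<close>

abbreviation cylinder :: "real \<Rightarrow> (real \<times> real) set" where
  "cylinder T \<equiv> {0<..<T} \<times> {0<..<1}"

definition cyl_borel :: "real \<Rightarrow> (real \<Rightarrow> real \<Rightarrow> real) \<Rightarrow> bool" where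
  "cyl_borel T w \<longleftrightarrow> set_borel_measurable lborel (cylinder T) (\<lambda>(t, x). w t x)"

definition space_deriv :: "real \<Rightarrow> (real \<Rightarrow> real \<Rightarrow> real) \<Rightarrow> (real \<Rightarrow> real \<Rightarrow> real) \<Rightarrow> bool" where
  "space_deriv T w wx \<longleftrightarrow> cyl_borel T wx \<and>
     (AE t in lborel. t \<in> {0<..<T} \<longrightarrow> weak_deriv 0 1 (w t) (wx t))"

definition in_Linf_H2 :: "real \<Rightarrow> (real \<Rightarrow> real \<Rightarrow> real) \<Rightarrow> bool" where
  "in_Linf_H2 T w \<longleftrightarrow> cyl_borel T w \<and>
     (\<exists>wx wxx M. space_deriv T w wx \<and> space_deriv T wx wxx \<and>
        (AE t in lborel. t \<in> {0<..<T} \<longrightarrow>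
           (\<forall>f \<in> {w t, wx t, wxx t}. L2_on {0<..<1} f \<and> L2_norm_on {0<..<1} f \<le> M)))"

text \<open>By Tonelli, \<open>L\<^sup>2(0,T; L\<^sup>2(0,1))\<close> is \<open>L\<^sup>2\<close> of the cylinder.\<close>

definition in_L2_L2 :: "real \<Rightarrow> (real \<Rightarrow> real \<Rightarrow> real) \<Rightarrow> bool" where
  "in_L2_L2 T w \<longleftrightarrow> L2_on (cylinder T) (\<lambda>(t, x). w t x)"

definition in_L2_H2 :: "real \<Rightarrow> (real \<Rightarrow> real \<Rightarrow> real) \<Rightarrow> bool" where
  "in_L2_H2 T w \<longleftrightarrow> in_L2_L2 T w \<and>
     (\<exists>wx wxx. space_deriv T w wx \<and> space_deriv T wx wxx \<and> in_L2_L2 T wx \<and> in_L2_L2 T wxx)"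

text \<open>The weak time derivative is that of a function with values in \<open>L\<^sup>2(0,1)\<close>: for each scalar
  test function an identity between elements of \<open>L\<^sup>2(0,1)\<close>, that is, almost everywhere in \<open>x\<close>.\<close>

definition in_H1_L2 :: "real \<Rightarrow> (real \<Rightarrow> real \<Rightarrow> real) \<Rightarrow> bool" where
  "in_H1_L2 T w \<longleftrightarrow> in_L2_L2 T w \<and>
     (\<exists>wt. in_L2_L2 T wt \<and>
        (\<forall>\<psi>. test_fun 0 T \<psi> \<longrightarrow>
           (AE x in lborel. x \<in> {0<..<1} \<longrightarrow>
              (LINT t:{0<..<T}|lborel. w t x * deriv \<psi> t)
                = - (LINT t:{0<..<T}|lborel. wt t x * \<psi> t))))"

definition in_X :: "real \<Rightarrow> (real \<Rightarrow> real \<Rightarrow> real) \<Rightarrow> (real \<Rightarrow> real \<Rightarrow> real) \<Rightarrow> bool" where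
  "in_X T h u \<longleftrightarrow> in_Linf_H2 T h \<and> in_L2_H2 T u \<and> in_H1_L2 T u"

text \<open>\<open>g\<close> is the value at time \<open>s \<in> [0, T]\<close> of the representative of \<open>w\<close> in \<open>C([0,T]; L\<^sup>2(0,1))\<close>.\<close>

definition time_value ::
  "real \<Rightarrow> (real \<Rightarrow> real \<Rightarrow> real) \<Rightarrow> real \<Rightarrow> (real \<Rightarrow> real) \<Rightarrow> bool" where
  "time_value T w s g \<longleftrightarrow> (\<exists>W.
     (\<forall>t\<in>{0..T}. L2_on {0<..<1} (W t) \<and>
        ((\<lambda>\<tau>. L2_norm_on {0<..<1} (\<lambda>x. W \<tau> x - W t x)) \<longlongrightarrow> 0) (at t within {0..T})) \<and>
     (AE t in lborel. t \<in> {0<..<T} \<longrightarrow>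
        (AE x in lborel. x \<in> {0<..<1} \<longrightarrow> W t x = w t x)) \<and>
     W s = g)"

subsection \<open>The viscous shallow water system\<close>

primrec C_k :: "nat \<Rightarrow> (real \<Rightarrow> real \<Rightarrow> real) \<Rightarrow> bool" where
  "C_k 0 \<phi> \<longleftrightarrow> continuous_on UNIV (\<lambda>(t, x). \<phi> t x)"
| "C_k (Suc k) \<phi> \<longleftrightarrow> (\<exists>\<phi>t \<phi>x. C_k k \<phi>t \<and> C_k k \<phi>x \<and>
     (\<forall>t x. ((\<lambda>s. \<phi> s x) has_real_derivative \<phi>t t x) (at t) \<and>
            ((\<lambda>y. \<phi> t y) has_real_derivative \<phi>x t x) (at x)))"

definition cyl_test_fun :: "real \<Rightarrow> (real \<Rightarrow> real \<Rightarrow> real) \<Rightarrow> bool" where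
  "cyl_test_fun T \<phi> \<longleftrightarrow> (\<forall>k. C_k k \<phi>) \<and>
     (\<exists>K. compact K \<and> K \<subseteq> cylinder T \<and> (\<forall>t x. (t, x) \<notin> K \<longrightarrow> \<phi> t x = 0))"

abbreviation d_t :: "(real \<Rightarrow> real \<Rightarrow> real) \<Rightarrow> real \<Rightarrow> real \<Rightarrow> real" where
  "d_t \<phi> t x \<equiv> deriv (\<lambda>s. \<phi> s x) t"

abbreviation d_x :: "(real \<Rightarrow> real \<Rightarrow> real) \<Rightarrow> real \<Rightarrow> real \<Rightarrow> real" where
  "d_x \<phi> t x \<equiv> deriv (\<phi> t) x"

text \<open>\<open>\<partial>\<^sub>t q + \<partial>\<^sub>x F + S = 0\<close> in the sense of distributions on the cylinder.\<close>

definition balance_law ::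
  "real \<Rightarrow> (real \<Rightarrow> real \<Rightarrow> real) \<Rightarrow> (real \<Rightarrow> real \<Rightarrow> real) \<Rightarrow> (real \<Rightarrow> real \<Rightarrow> real) \<Rightarrow> bool" where
  "balance_law T q F S \<longleftrightarrow> (\<forall>\<phi>. cyl_test_fun T \<phi> \<longrightarrow>
     (LINT z:cylinder T|lborel.
        (case z of (t, x) \<Rightarrow> q t x * d_t \<phi> t x + F t x * d_x \<phi> t x - S t x * \<phi> t x)) = 0)"

definition sw_solution ::
  "real \<Rightarrow> real \<Rightarrow> real \<Rightarrow> real \<Rightarrow> (real \<Rightarrow> real) \<Rightarrow> (real \<Rightarrow> real) \<Rightarrow> (real \<Rightarrow> real) \<Rightarrow> (real \<Rightarrow> real)
    \<Rightarrow> (real \<Rightarrow> real \<Rightarrow> real) \<Rightarrow> (real \<Rightarrow> real \<Rightarrow> real) \<Rightarrow> bool" where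
  "sw_solution \<mu> Fr r T h0 u0 v1 v2 h u \<longleftrightarrow>
     balance_law T h (\<lambda>t x. h t x * u t x) (\<lambda>t x. 0) \<and>
     (\<exists>ux. space_deriv T u ux \<and>
        balance_law T (\<lambda>t x. h t x * u t x)
          (\<lambda>t x. h t x * (u t x)\<^sup>2 - \<mu> * h t x * ux t x + h t x / Fr\<^sup>2)
          (\<lambda>t x. r * h t x * u t x)) \<and>
     (AE t in lborel. t \<in> {0<..<T} \<longrightarrow>
        point_value 0 1 (u t) 0 (v1 t) \<and> point_value 0 1 (u t) 1 (v2 t)) \<and>
     time_value T h 0 h0 \<and> time_value T u 0 u0"

text \<open>The system prescribes \<open>h\<close> nowhere on the boundary, whereas the mass equation needs one datum
  for \<open>h\<close> wherever the flow enters, that is, at \<open>x = 0\<close> when \<open>v1 t > 0\<close> and at \<open>x = 1\<close> when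
  \<open>v2 t < 0\<close>. Without it the initial and boundary data do not determine a solution. For
  \<open>r = 1 / (\<mu> Fr\<^sup>2)\<close> the effective momentum \<open>m = h (u + \<mu> \<partial>\<^sub>x ln h) = h u + \<mu> \<partial>\<^sub>x h\<close> satisfies
  \<open>\<partial>\<^sub>t m + \<partial>\<^sub>x (u m) + r m = 0\<close>. The solution associated with the data is taken to be the one into
  which no effective momentum is carried through the boundary. There is no condition at a time at
  which no fluid enters.\<close>

definition no_effective_inflow ::
  "real \<Rightarrow> real \<Rightarrow> (real \<Rightarrow> real) \<Rightarrow> (real \<Rightarrow> real)
    \<Rightarrow> (real \<Rightarrow> real \<Rightarrow> real) \<Rightarrow> (real \<Rightarrow> real \<Rightarrow> real) \<Rightarrow> bool" where
  "no_effective_inflow \<mu> T v1 v2 h u \<longleftrightarrow>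
     (AE t in lborel. t \<in> {0<..<T} \<longrightarrow>
        (let m = (\<lambda>x. h t x * u t x + \<mu> * weak_der 0 1 (h t) x) in
           (v1 t > 0 \<longrightarrow> point_value 0 1 m 0 0) \<and> (v2 t < 0 \<longrightarrow> point_value 0 1 m 1 0)))"

definition associated_solution ::
  "real \<Rightarrow> real \<Rightarrow> real \<Rightarrow> real \<Rightarrow> (real \<Rightarrow> real) \<Rightarrow> (real \<Rightarrow> real) \<Rightarrow> (real \<Rightarrow> real) \<Rightarrow> (real \<Rightarrow> real)
    \<Rightarrow> (real \<Rightarrow> real \<Rightarrow> real) \<Rightarrow> (real \<Rightarrow> real \<Rightarrow> real) \<Rightarrow> bool" where
  "associated_solution \<mu> Fr r T h0 u0 v1 v2 h u \<longleftrightarrow>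
     in_X T h u \<and> sw_solution \<mu> Fr r T h0 u0 v1 v2 h u \<and> no_effective_inflow \<mu> T v1 v2 h u"

end

theory Submission
  imports Defs
begin

text \<open>With \<open>h0 = 1\<close> and \<open>u0 = 0\<close> the effective momentum \<open>m = h u + \<mu> \<partial>\<^sub>x h\<close> vanishes initially. It
  solves \<open>\<partial>\<^sub>t m + \<partial>\<^sub>x (u m) + r m = 0\<close> and none of it flows in, so an energy estimate and Gronwall's
  inequality give \<open>m = 0\<close>. Hence \<open>u = - \<mu> \<partial>\<^sub>x ln h\<close> at all times, \<open>h\<close> solves the heat equation
  \<open>\<partial>\<^sub>t h = \<mu> \<partial>\<^sub>x\<^sub>x h\<close>, and at each time \<open>h\<close> has one sign. For \<open>k = 1, 3\<close> the moment
  \<open>E\<^sub>k = \<integral> h sin (k \<pi> x) dx\<close> satisfies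
  \<open>E\<^sub>k' = - \<mu> (k \<pi>)\<^sup>2 E\<^sub>k + \<mu> k \<pi> (h(t, 0) + h(t, 1))\<close>. The sign of the last term is that of \<open>E\<^sub>1\<close>, so
  \<open>E\<^sub>1\<close>, and with it \<open>h\<close> and \<open>E\<^sub>3\<close>, stay positive whatever the controls are. Since \<open>u\<close> determines \<open>h\<close> up to
  a factor, velocities that are close in \<open>L\<^sup>2\<close> to the one of \<open>h1 = 3/2 - sin (3 \<pi> x)\<close>, whose third
  moment is negative, cannot be reached.\<close>

text \<open>The choice of modes is a matter of signs. For odd \<open>k\<close> both endpoint values
  of \<open>h\<close> enter the moment equation with the same sign; for even \<open>k\<close> they
  would enter with opposite signs, which the controls could exploit. Mode 1 is positive on the
  interval and so ties the sign of \<open>h\<close> to its moment; mode 3 changes sign there, so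
  that a positive profile can have a negative third moment. Positivity of \<open>h\<close> at later
  times is a conclusion, not an assumption on the solution.

  The technical obstacle is low regularity: \<open>m\<close> solves its equation only as a
  distribution, and \<open>u\<close> has an x-derivative whose supremum is controlled by a weight
  that is integrable in time. The equation is therefore turned into an integral equation in time,
  valid for almost every \<open>t\<close> and \<open>x\<close>. Its square can be integrated because
  \<open>m\<close> is bounded in L2 uniformly in time and has a square integrable x-derivative.

  Since a sign is preserved for all times, the resulting lower bound for the distance depends on
  \<mu> alone.\<close>

lemmas LINT_cong = Bochner_Integration.integral_cong
lemmas integrable_dominated = Bochner_Integration.integrable_bound

section \<open>Lebesgue measure on bounded open intervals and on rectangles\<close>

definition D :: "real \<Rightarrow> real \<Rightarrow> real measure" where
  "D a b = restrict_space lborel {a<..<b}"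

abbreviation rect where "rect a b c d \<equiv> D a b \<Otimes>\<^sub>M D c d"
abbreviation cyl where "cyl T \<equiv> rect 0 T 0 1"
abbreviation sqn where "sqn f \<equiv> LINT x|D 0 1. (f x)\<^sup>2"
abbreviation nrm where "nrm f \<equiv> sqrt (sqn f)"

lemma space_D [simp]: "space (D a b) = {a<..<b}"
  by (simp add: D_def space_restrict_space)

lemma borel_measurable_D [measurable]: "(\<lambda>x. x) \<in> borel_measurable (D a b)"
  unfolding D_def by (rule measurable_restrict_space1) simp

lemma borel_measurable_D_compose: "f \<in> borel_measurable borel \<Longrightarrow> f \<in> borel_measurable (D a b)"
  unfolding D_def by (rule measurable_restrict_space1) simp

lemma borel_measurable_D_fst [measurable]: "(\<lambda>z. fst z) \<in> borel_measurable (D a b \<Otimes>\<^sub>M M)"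
  by (rule measurable_compose[OF measurable_fst borel_measurable_D])

lemma finite_measure_D: "finite_measure (D a b)"
  unfolding D_def
  by (rule finite_measureI)
    (cases "a \<le> b", auto simp: space_restrict_space emeasure_restrict_space emeasure_lborel_Ioo)

interpretation D: finite_measure "D a b" for a b by (rule finite_measure_D)
interpretation DD: pair_sigma_finite "D a b" "D c d" for a b c d ..

lemma AE_D_iff: "(AE x in D a b. P x) \<longleftrightarrow> (AE x in lborel. x \<in> {a<..<b} \<longrightarrow> P x)"
  unfolding D_def by (subst AE_restrict_space_iff) auto

lemma AE_D_I: "(\<And>x. x \<in> {a<..<b} \<Longrightarrow> P x) \<Longrightarrow> AE x in D a b. P x"
  by (rule AE_I2) simp

lemma measurable_D_iff:
  "f \<in> borel_measurable (D a b) \<longleftrightarrow> set_borel_measurable lborel {a<..<b} f" for f :: "real \<Rightarrow> real"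
  unfolding D_def set_borel_measurable_def by (subst borel_measurable_restrict_space_iff) (auto simp: mult.commute)

lemma integrable_D_iff: "integrable (D a b) f \<longleftrightarrow> set_integrable lborel {a<..<b} f" for f :: "real \<Rightarrow> real"
  unfolding D_def by (subst set_integrable_eq) auto

lemma integral_D: "integral\<^sup>L (D a b) f = (LINT x:{a<..<b}|lborel. f x)" for f :: "real \<Rightarrow> real"
  unfolding D_def by (subst integral_restrict_space) (auto simp: set_lebesgue_integral_def)

lemma sets_D_pair: "sets (rect a b c d) = sets (restrict_space lborel ({a<..<b} \<times> {c<..<d}))"
proof
  show "sets (rect a b c d) \<subseteq> sets (restrict_space lborel ({a<..<b} \<times> {c<..<d}))"
    unfolding sets_pair_measure
  proof (rule sets.sigma_sets_subset', safe)
    fix A B assume "A \<in> sets (D a b)" "B \<in> sets (D c d)"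
    then have "A \<subseteq> {a<..<b}" "B \<subseteq> {c<..<d}" "A \<in> sets lborel" "B \<in> sets lborel"
      by (auto simp: D_def sets_restrict_space_iff)
    moreover from this have "A \<times> B \<in> sets (lborel \<Otimes>\<^sub>M lborel)" by simp
    ultimately show "A \<times> B \<in> sets (restrict_space lborel ({a<..<b} \<times> {c<..<d}))"
      unfolding lborel_prod by (subst sets_restrict_space_iff) (auto simp: borel_prod[symmetric])
  next
    show "space (D a b) \<times> space (D c d) \<in> sets (restrict_space lborel ({a<..<b} \<times> {c<..<d}))"
      by (subst sets_restrict_space_iff) (auto simp: borel_prod[symmetric])
  qed
  have "(\<lambda>z. z) \<in> measurable (rect a b c d) (borel \<Otimes>\<^sub>M borel)"
    by (rule measurable_pair) (auto simp: comp_def)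
  then have "(\<lambda>z. z) \<in> measurable (rect a b c d) (restrict_space lborel ({a<..<b} \<times> {c<..<d}))"
    by (intro measurable_restrict_space2) (auto simp: space_pair_measure borel_prod)
  from measurable_sets[OF this] show "sets (restrict_space lborel ({a<..<b} \<times> {c<..<d})) \<subseteq> sets (rect a b c d)"
  proof (intro subsetI)
    fix X assume X: "X \<in> sets (restrict_space lborel ({a<..<b} \<times> {c<..<d}))"
      and *: "\<And>A. A \<in> sets (restrict_space lborel ({a<..<b} \<times> {c<..<d})) \<Longrightarrow>
        (\<lambda>z. z) -` A \<inter> space (rect a b c d) \<in> sets (rect a b c d)"
    have "X \<subseteq> space (rect a b c d)"
      using sets.sets_into_space[OF X] by (auto simp: space_pair_measure space_restrict_space)
    with *[OF X] show "X \<in> sets (rect a b c d)" by (simp add: Int_absorb2)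
  qed
qed

text \<open>Two sigma-finite product candidates agree once they agree on boxes, where both give the
  product of the lengths. The identification lets Fubini for \<open>D\<close> act on the set
  integrals over the cylinder in which the problem is stated.\<close>

lemma D_pair: "rect a b c d = restrict_space lborel ({a<..<b} \<times> {c<..<d})"
proof (rule pair_measure_eqI)
  fix A B assume A: "A \<in> sets (D a b)" and B: "B \<in> sets (D c d)"
  then have *: "A \<subseteq> {a<..<b}" "B \<subseteq> {c<..<d}" "A \<in> sets lborel" "B \<in> sets lborel"
    by (auto simp: D_def sets_restrict_space_iff)
  then have "A \<times> B \<in> sets (lborel \<Otimes>\<^sub>M lborel)" by simp
  then have "emeasure (restrict_space lborel ({a<..<b} \<times> {c<..<d})) (A \<times> B) = emeasure lborel (A \<times> B)"
    using * by (subst emeasure_restrict_space) (auto simp: borel_prod[symmetric])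
  also have "\<dots> = emeasure lborel A * emeasure lborel B"
    using * by (subst lborel_prod[symmetric], subst lborel.emeasure_pair_measure_Times) auto
  also have "\<dots> = emeasure (D a b) A * emeasure (D c d) B"
    using * by (auto simp: D_def emeasure_restrict_space)
  finally show "emeasure (D a b) A * emeasure (D c d) B = emeasure (restrict_space lborel ({a<..<b} \<times> {c<..<d})) (A \<times> B)" ..
qed (auto simp: sets_D_pair finite_measure.axioms(1) D.sigma_finite_measure_axioms)

lemma times_Ioo_borel [measurable]: "{a<..<b} \<times> {c<..<d} \<in> sets borel" for a b c d :: real
  by (simp add: borel_prod[symmetric])

lemma measurable_D_pair_iff:
  "f \<in> borel_measurable (rect a b c d) \<longleftrightarrow> set_borel_measurable lborel ({a<..<b} \<times> {c<..<d}) f"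
  for f :: "real \<times> real \<Rightarrow> real"
  unfolding D_pair set_borel_measurable_def
  by (subst borel_measurable_restrict_space_iff) (auto simp: mult.commute)

lemma integrable_D_pair_iff:
  "integrable (rect a b c d) f \<longleftrightarrow> set_integrable lborel ({a<..<b} \<times> {c<..<d}) f"
  for f :: "real \<times> real \<Rightarrow> real"
  unfolding D_pair by (subst set_integrable_eq) auto

lemma integral_D_pair:
  "integral\<^sup>L (rect a b c d) f = (LINT z:{a<..<b} \<times> {c<..<d}|lborel. f z)"
  for f :: "real \<times> real \<Rightarrow> real"
  unfolding D_pair by (subst integral_restrict_space) (auto simp: set_lebesgue_integral_def)

subsection \<open>Square integrable functions\<close>

text \<open>Taken over an arbitrary measure because the same closure rules serve on intervals and on
  the cylinder.\<close>

definition sqi :: "'a measure \<Rightarrow> ('a \<Rightarrow> real) \<Rightarrow> bool" where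
  "sqi M f \<longleftrightarrow> f \<in> borel_measurable M \<and> integrable M (\<lambda>x. (f x)\<^sup>2)"

lemma L2_on_iff: "L2_on {a<..<b} f \<longleftrightarrow> sqi (D a b) f"
  by (simp add: L2_on_def sqi_def measurable_D_iff integrable_D_iff)

lemma L2_on_pair_iff: "L2_on ({a<..<b} \<times> {c<..<d}) f \<longleftrightarrow> sqi (rect a b c d) f"
  by (simp add: L2_on_def sqi_def measurable_D_pair_iff integrable_D_pair_iff)

lemma L2_norm_on_eq: "L2_norm_on {a<..<b} f = sqrt (LINT x|D a b. (f x)\<^sup>2)"
  by (simp add: L2_norm_on_def integral_D)

lemma sqi_measurable: "sqi M f \<Longrightarrow> f \<in> borel_measurable M" by (simp add: sqi_def)

lemma sqi_mult: assumes "sqi M f" "sqi M g" shows "integrable M (\<lambda>x. f x * g x)"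
proof (rule integrable_dominated)
  show "integrable M (\<lambda>x. (f x)\<^sup>2 + (g x)\<^sup>2)" using assms by (auto simp: sqi_def)
  show "AE x in M. norm (f x * g x) \<le> norm ((f x)\<^sup>2 + (g x)\<^sup>2)"
  proof (rule AE_I2)
    fix x
    have "0 \<le> (\<bar>f x\<bar> - \<bar>g x\<bar>)\<^sup>2" by simp
    then have "2 * (\<bar>f x\<bar> * \<bar>g x\<bar>) \<le> (f x)\<^sup>2 + (g x)\<^sup>2" by (simp add: power2_diff)
    moreover have "0 \<le> \<bar>f x\<bar> * \<bar>g x\<bar>" by simp
    ultimately have "\<bar>f x\<bar> * \<bar>g x\<bar> \<le> (f x)\<^sup>2 + (g x)\<^sup>2" by linarith
    then show "norm (f x * g x) \<le> norm ((f x)\<^sup>2 + (g x)\<^sup>2)"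
      by (simp add: abs_mult)
  qed
  show "(\<lambda>x. f x * g x) \<in> borel_measurable M" using assms by (auto simp: sqi_def)
qed

lemma sqi_add: assumes "sqi M f" "sqi M g" shows "sqi M (\<lambda>x. f x + g x)"
proof -
  have "integrable M (\<lambda>x. (f x)\<^sup>2 + (g x)\<^sup>2 + 2 * (f x * g x))"
    using assms sqi_mult[OF assms] by (auto simp: sqi_def)
  moreover have "(\<lambda>x. (f x)\<^sup>2 + (g x)\<^sup>2 + 2 * (f x * g x)) = (\<lambda>x. (f x + g x)\<^sup>2)"
    by (auto simp: power2_sum)
  moreover have "(\<lambda>x. f x + g x) \<in> borel_measurable M"
    using assms by (auto simp: sqi_def intro: borel_measurable_add)
  ultimately show ?thesis by (simp add: sqi_def)
qed

lemma sqi_cmult: "sqi M f \<Longrightarrow> sqi M (\<lambda>x. c * f x)"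
  by (auto simp: sqi_def power_mult_distrib)

lemma sqi_diff: "sqi M f \<Longrightarrow> sqi M g \<Longrightarrow> sqi M (\<lambda>x. f x - g x)"
  using sqi_add[of M f "\<lambda>x. -1 * g x"] sqi_cmult[of M g "-1"] by simp

lemma sqi_bounded:
  assumes "sqi M f" "g \<in> borel_measurable M" "AE x in M. \<bar>g x\<bar> \<le> c" shows "sqi M (\<lambda>x. f x * g x)"
  unfolding sqi_def
proof
  show [measurable]: "(\<lambda>x. f x * g x) \<in> borel_measurable M" using assms by (auto simp: sqi_def)
  show "integrable M (\<lambda>x. (f x * g x)\<^sup>2)"
  proof (rule integrable_dominated)
    show "integrable M (\<lambda>x. c\<^sup>2 * (f x)\<^sup>2)" using assms by (auto simp: sqi_def)
    show "AE x in M. norm ((f x * g x)\<^sup>2) \<le> norm (c\<^sup>2 * (f x)\<^sup>2)"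
      using assms(3)
    proof eventually_elim
      case (elim x)
      then have "(g x)\<^sup>2 \<le> c\<^sup>2" by (meson abs_ge_zero order_trans power2_le_iff_abs_le)
      then show ?case by (simp add: power_mult_distrib mult.commute[of "c\<^sup>2"] mult_left_mono)
    qed
  qed simp
qed

lemma (in finite_measure) sqi_const: "sqi M (\<lambda>x. c)" by (simp add: sqi_def)

lemma (in finite_measure) sqi_integrable: "sqi M f \<Longrightarrow> integrable M f"
  using sqi_mult[OF _ sqi_const[of 1]] by simp

lemma (in finite_measure) sqi_of_bounded:
  assumes "g \<in> borel_measurable M" "AE x in M. \<bar>g x\<bar> \<le> c" shows "sqi M g"
  using sqi_bounded[OF sqi_const[of 1] assms] by simp

lemma sqi_Cauchy_Schwarz:
  assumes "sqi M f" "sqi M g"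
  shows "\<bar>\<integral>x. f x * g x \<partial>M\<bar> \<le> sqrt (LINT x|M. (f x)\<^sup>2) * sqrt (LINT x|M. (g x)\<^sup>2)"
proof -
  let ?a = "\<integral>x. (f x)\<^sup>2 \<partial>M" and ?b = "\<integral>x. f x * g x \<partial>M" and ?c = "\<integral>x. (g x)\<^sup>2 \<partial>M"
  have I: "integrable M (\<lambda>x. (f x)\<^sup>2)" "integrable M (\<lambda>x. (g x)\<^sup>2)" "integrable M (\<lambda>x. f x * g x)"
    using assms sqi_mult[OF assms] by (auto simp: sqi_def)
  \<comment> \<open>The integral of the square of \<open>s f + t g\<close>, read as a nonnegative
    quadratic form in \<open>s\<close> and \<open>t\<close>; suitable values give the discriminant
    bound.\<close>
  have q: "0 \<le> s\<^sup>2 * ?a + 2 * s * t * ?b + t\<^sup>2 * ?c" for s t :: real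
  proof -
    have "0 \<le> (LINT x|M. (s * f x + t * g x)\<^sup>2)" by simp
    also have "\<dots> = (LINT x|M. s\<^sup>2 * (f x)\<^sup>2 + 2 * s * t * (f x * g x) + t\<^sup>2 * (g x)\<^sup>2)"
      by (intro LINT_cong) (auto simp: power2_sum power_mult_distrib)
    also have "\<dots> = s\<^sup>2 * ?a + 2 * s * t * ?b + t\<^sup>2 * ?c" using I by simp
    finally show ?thesis .
  qed
  have a0: "?a \<ge> 0" "?c \<ge> 0" by simp_all
  have "?b\<^sup>2 \<le> ?a * ?c"
  proof (cases "?c = 0")
    case True
    have "?b = 0"
    proof (rule ccontr)
      assume b: "?b \<noteq> 0"
      \<comment> \<open>With \<open>?c = 0\<close> the form is affine in \<open>t\<close>, and this
        value of \<open>t\<close> makes it equal to -1.\<close>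
      from q[of 1 "- (?a + 1) / (2 * ?b)"] True b show False by (simp add: field_simps)
    qed
    with True show ?thesis by simp
  next
    case False
    with a0 have "?c > 0" by linarith
    have "0 \<le> ?c * (?a * ?c - ?b\<^sup>2)"
      using q[of ?c "- ?b"] by (simp add: power2_eq_square algebra_simps)
    with \<open>?c > 0\<close> show ?thesis by (simp add: zero_le_mult_iff)
  qed
  then have "sqrt (?b\<^sup>2) \<le> sqrt (?a * ?c)" by (rule real_sqrt_le_mono)
  then show ?thesis by (simp add: real_sqrt_mult)
qed

lemma sqi_triangle:
  assumes "sqi M f" "sqi M g"
  shows "sqrt (LINT x|M. (f x + g x)\<^sup>2) \<le> sqrt (LINT x|M. (f x)\<^sup>2) + sqrt (LINT x|M. (g x)\<^sup>2)"
proof (rule real_le_lsqrt)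
  have I: "integrable M (\<lambda>x. (f x)\<^sup>2)" "integrable M (\<lambda>x. (g x)\<^sup>2)" "integrable M (\<lambda>x. f x * g x)"
    using assms sqi_mult[OF assms] by (auto simp: sqi_def)
  have "(LINT x|M. (f x + g x)\<^sup>2) = (LINT x|M. (f x)\<^sup>2 + (g x)\<^sup>2 + 2 * (f x * g x))"
    by (intro LINT_cong) (auto simp: power2_sum)
  also have "\<dots> = (LINT x|M. (f x)\<^sup>2) + (LINT x|M. (g x)\<^sup>2) + 2 * (LINT x|M. f x * g x)" using I by simp
  also have "\<dots> \<le> (sqrt (LINT x|M. (f x)\<^sup>2) + sqrt (LINT x|M. (g x)\<^sup>2))\<^sup>2"
    using sqi_Cauchy_Schwarz[OF assms] by (auto simp: power2_sum)
  finally show "(LINT x|M. (f x + g x)\<^sup>2) \<le> (sqrt (LINT x|M. (f x)\<^sup>2) + sqrt (LINT x|M. (g x)\<^sup>2))\<^sup>2" .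
qed auto

subsection \<open>Smooth bumps\<close>

text \<open>Smoothness with existential derivatives in place of \<open>deriv\<close>, so that
  closure under sums, products and affine substitution follows by induction on \<open>k\<close>.
  \<open>diff_times_imp_higher\<close> and \<open>higher_imp_diff_times\<close> translate to and
  from the iterated \<open>deriv\<close> of \<open>test_fun\<close>.\<close>

primrec diff_times :: "nat \<Rightarrow> (real \<Rightarrow> real) \<Rightarrow> bool" where
  "diff_times 0 f \<longleftrightarrow> True"
| "diff_times (Suc k) f \<longleftrightarrow> (\<exists>f'. diff_times k f' \<and> (\<forall>x. (f has_real_derivative f' x) (at x)))"

lemma diff_times_Suc_imp: "diff_times (Suc k) f \<Longrightarrow> diff_times k f"
  by (induction k arbitrary: f) (simp, metis diff_times.simps(2))

lemma diff_times_add: "diff_times k f \<Longrightarrow> diff_times k g \<Longrightarrow> diff_times k (\<lambda>x. f x + g x)"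
proof (induction k arbitrary: f g)
  case (Suc k)
  then obtain f' g' where "diff_times k f'" "\<forall>x. (f has_real_derivative f' x) (at x)"
    "diff_times k g'" "\<forall>x. (g has_real_derivative g' x) (at x)" by auto
  with Suc.IH[of f' g'] show ?case
    by (auto intro!: exI[of _ "\<lambda>x. f' x + g' x"] derivative_eq_intros)
qed simp

lemma diff_times_mult: "diff_times k f \<Longrightarrow> diff_times k g \<Longrightarrow> diff_times k (\<lambda>x. f x * g x)"
proof (induction k arbitrary: f g)
  case (Suc k)
  then obtain f' g' where *: "diff_times k f'" "\<forall>x. (f has_real_derivative f' x) (at x)"
    "diff_times k g'" "\<forall>x. (g has_real_derivative g' x) (at x)" by auto
  have "diff_times k (\<lambda>x. f' x * g x + f x * g' x)"
    using Suc.IH * Suc.prems[THEN diff_times_Suc_imp] by (intro diff_times_add) auto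
  with * show ?case
    by (auto intro!: exI[of _ "\<lambda>x. f' x * g x + f x * g' x"] derivative_eq_intros)
qed simp

lemma diff_times_const: "diff_times k (\<lambda>x. c)"
  by (induction k arbitrary: c) (auto intro!: exI[of _ "\<lambda>x. 0"])

lemma diff_times_affine: "diff_times k f \<Longrightarrow> diff_times k (\<lambda>x. f (p * x + q))"
proof (induction k arbitrary: f)
  case (Suc k)
  then obtain f' where *: "diff_times k f'" "\<forall>x. (f has_real_derivative f' x) (at x)" by auto
  have "diff_times k (\<lambda>x. f' (p * x + q) * p)"
    using Suc.IH * by (intro diff_times_mult diff_times_const) auto
  moreover have "((\<lambda>x. f (p * x + q)) has_real_derivative f' (p * x + q) * p) (at x)" for x
    by (rule DERIV_chain'[where f = "\<lambda>x. p * x + q" and g = f]) (use * in \<open>auto intro!: derivative_eq_intros\<close>)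
  ultimately show ?case
    by (auto intro!: exI[of _ "\<lambda>x. f' (p * x + q) * p"])
qed simp

lemma diff_times_deriv: assumes "\<And>k. diff_times k f" shows "diff_times k (deriv f)"
proof -
  obtain f' where f': "diff_times k f'" "\<forall>x. (f has_real_derivative f' x) (at x)"
    using assms[of "Suc k"] by auto
  then have "deriv f = f'" by (auto intro: DERIV_imp_deriv)
  with f' show ?thesis by simp
qed

lemma diff_times_imp_higher: "(\<And>k. diff_times k f) \<Longrightarrow> (deriv ^^ n) f differentiable (at x)"
proof (induction n arbitrary: f)
  case 0
  from 0[of 1] show ?case using real_differentiable_def by auto
next
  case (Suc n)
  then show ?case using diff_times_deriv[of f] by (simp add: funpow_swap1)
qed

lemma higher_imp_diff_times:
  assumes "\<And>n x. (deriv ^^ n) f differentiable (at x)" shows "diff_times k ((deriv ^^ n) f)"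
proof (induction k arbitrary: n)
  case (Suc k)
  have "((deriv ^^ n) f has_real_derivative (deriv ^^ Suc n) f x) (at x)" for x
    using assms[of n x] by (simp add: DERIV_deriv_iff_real_differentiable)
  with Suc show ?case unfolding diff_times.simps by blast
qed simp

text \<open>The case \<open>j = 0\<close> is the standard smooth function that is flat at 0. The
  negative powers are included because the linear span of the family is closed under
  differentiation, which is what makes the smoothness induction go through.\<close>

definition flat_monomial :: "nat \<Rightarrow> real \<Rightarrow> real" where
  "flat_monomial j x = (if x > 0 then (1 / x) ^ j * exp (- (1 / x)) else 0)"

lemma flat_monomial_tendsto: "(flat_monomial j \<longlongrightarrow> 0) (at_right 0)"
proof -
  have "((\<lambda>x. (inverse x) ^ j / exp (inverse x)) \<longlongrightarrow> (0::real)) (at_right 0)"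
    by (rule filterlim_compose[OF tendsto_power_div_exp_0 filterlim_inverse_at_top_right])
  then show ?thesis
    by (rule Lim_transform_eventually)
      (auto simp: eventually_at_filter flat_monomial_def exp_minus field_simps)
qed

lemma flat_monomial_has_derivative:
  "(flat_monomial j has_real_derivative flat_monomial (j + 2) x - real j * flat_monomial (j + 1) x) (at x)"
proof -
  consider "x > 0" | "x < 0" | "x = 0" by linarith
  then show ?thesis
  proof cases
    case 1
    have d1: "((\<lambda>x. 1 / x) has_real_derivative - (1 / x ^ 2)) (at x)"
      using 1 by (auto intro!: derivative_eq_intros simp: power2_eq_square)
    have d2: "((\<lambda>x. exp (- (1 / x))) has_real_derivative exp (- (1 / x)) * (1 / x ^ 2)) (at x)"
      using DERIV_chain'[OF DERIV_minus[OF d1] DERIV_exp] by simp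
    have "((\<lambda>x. (1 / x) ^ j * exp (- (1 / x))) has_real_derivative
       flat_monomial (j + 2) x - real j * flat_monomial (j + 1) x) (at x)"
      by (rule DERIV_cong[OF DERIV_mult[OF DERIV_power[OF d1] d2]])
        (use 1 in \<open>cases j; simp add: flat_monomial_def field_simps power2_eq_square\<close>)
    then show ?thesis
      by (rule has_field_derivative_transform_within_open[of _ _ _ "{0<..}"])
        (use 1 in \<open>auto simp: flat_monomial_def\<close>)
  next
    case 2
    have "((\<lambda>x. 0) has_real_derivative 0) (at x)" by simp
    then have "(flat_monomial j has_real_derivative 0) (at x)"
      by (rule has_field_derivative_transform_within_open[of _ _ _ "{..<0}"])
        (use 2 in \<open>auto simp: flat_monomial_def\<close>)
    with 2 show ?thesis by (simp add: flat_monomial_def)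
  next
    case 3
    have "((\<lambda>h. (flat_monomial j (0 + h) - flat_monomial j 0) / h) \<longlongrightarrow> 0) (at 0)"
      unfolding filterlim_at_split
    proof
      show "((\<lambda>h. (flat_monomial j (0 + h) - flat_monomial j 0) / h) \<longlongrightarrow> 0) (at_left 0)"
        by (rule Lim_transform_eventually[of "\<lambda>_. 0"])
          (auto simp: eventually_at_filter flat_monomial_def)
      \<comment> \<open>Dividing by \<open>h\<close> raises the exponent by one, so the difference
        quotient at 0 is again a member of the family.\<close>
      show "((\<lambda>h. (flat_monomial j (0 + h) - flat_monomial j 0) / h) \<longlongrightarrow> 0) (at_right 0)"
        by (rule Lim_transform_eventually[OF flat_monomial_tendsto[of "Suc j"]])
          (auto simp: eventually_at_filter flat_monomial_def field_simps)
    qed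
    with 3 show ?thesis by (simp add: DERIV_def flat_monomial_def)
  qed
qed

lemma diff_times_flat_monomial: "diff_times k (flat_monomial j)"
proof (induction k arbitrary: j)
  case (Suc k)
  have "diff_times k (\<lambda>x. flat_monomial (j + 2) x + (- real j) * flat_monomial (j + 1) x)"
    by (intro diff_times_add diff_times_mult diff_times_const Suc)
  then show ?case
    using flat_monomial_has_derivative[of j]
    by (auto intro!: exI[of _ "\<lambda>x. flat_monomial (j + 2) x + (- real j) * flat_monomial (j + 1) x"])
qed simp

text \<open>The factor \<open>Suc n\<close> stretches the flat function on either side while the
  support stays in \<open>{c..d}\<close>, so that the values tend to 1 strictly inside. The bumps
  thus approximate the indicator of an open interval boundedly, and with rational \<open>c\<close>
  and \<open>d\<close> they form a countable family.\<close>

definition bump :: "real \<Rightarrow> real \<Rightarrow> nat \<Rightarrow> real \<Rightarrow> real" where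
  "bump c d n x = flat_monomial 0 (real (Suc n) * x + - real (Suc n) * c) *
     flat_monomial 0 (- real (Suc n) * x + real (Suc n) * d)"

lemma bump_eq: "bump c d n x = (if c < x \<and> x < d
   then exp (- (1 / (real (Suc n) * (x - c)))) * exp (- (1 / (real (Suc n) * (d - x)))) else 0)"
proof -
  have "real (Suc n) * x + - real (Suc n) * c = real (Suc n) * (x - c)"
       "- real (Suc n) * x + real (Suc n) * d = real (Suc n) * (d - x)" by (simp_all add: algebra_simps)
  then show ?thesis
    unfolding bump_def flat_monomial_def by (simp add: zero_less_mult_iff del: of_nat_Suc)
qed

lemma bump_test_fun: assumes "a < c" "d < b" shows "test_fun a b (bump c d n)"
proof -
  have "diff_times k (bump c d n)" for k
    unfolding bump_def[abs_def] by (intro diff_times_mult diff_times_affine diff_times_flat_monomial)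
  then have "(deriv ^^ m) (bump c d n) differentiable (at x)" for m x
    by (rule diff_times_imp_higher)
  moreover have "\<forall>x. x \<notin> {c..d} \<longrightarrow> bump c d n x = 0" by (auto simp: bump_eq)
  ultimately show ?thesis unfolding test_fun_def using assms by blast
qed

lemma bump_bounds: "0 \<le> bump c d n x" "bump c d n x \<le> 1"
  by (auto simp: bump_eq mult_le_one simp del: of_nat_Suc)

lemma bump_measurable [measurable]: "bump c d n \<in> borel_measurable borel"
  unfolding bump_eq[abs_def] by measurable

lemma bump_limit: "(\<lambda>n. bump c d n x) \<longlonglongrightarrow> (if c < x \<and> x < d then 1 else 0)"
proof (cases "c < x \<and> x < d")
  case True
  have "(\<lambda>n. - (1 / (real (Suc n) * y))) \<longlonglongrightarrow> 0" if "y > 0" for y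
  proof -
    have "(\<lambda>n. inverse (real (Suc n)) * (- (1 / y))) \<longlonglongrightarrow> 0 * (- (1 / y))"
      by (intro tendsto_mult LIMSEQ_inverse_real_of_nat tendsto_const)
    then show ?thesis by (simp add: field_simps del: of_nat_Suc)
  qed
  from tendsto_mult[OF tendsto_exp[OF this] tendsto_exp[OF this], of "x - c" "d - x"] True
  show ?thesis by (simp add: bump_eq del: of_nat_Suc)
next
  case False
  then have "bump c d n x = 0" for n by (auto simp: bump_eq)
  with False show ?thesis by auto
qed

subsection \<open>Test functions\<close>

lemma test_fun_diff_times: "test_fun a b \<phi> \<Longrightarrow> diff_times k \<phi>"
  using higher_imp_diff_times[of \<phi> k 0] unfolding test_fun_def by simp

lemma test_fun_has_derivative: "test_fun a b \<phi> \<Longrightarrow> (\<phi> has_real_derivative deriv \<phi> x) (at x)"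
  unfolding test_fun_def
  by (metis DERIV_deriv_iff_real_differentiable funpow_0)

lemma test_fun_continuous: "test_fun a b \<phi> \<Longrightarrow> continuous_on A \<phi>"
  by (meson DERIV_isCont continuous_at_imp_continuous_on test_fun_has_derivative)

lemma test_fun_deriv: assumes "test_fun a b \<phi>" shows "test_fun a b (deriv \<phi>)"
proof -
  obtain c d where cd: "a < c" "d < b" "\<forall>x. x \<notin> {c..d} \<longrightarrow> \<phi> x = 0"
    using assms by (auto simp: test_fun_def)
  have "deriv \<phi> x = 0" if "x \<notin> {c..d}" for x
  proof (rule DERIV_imp_deriv)
    have "((\<lambda>x. 0) has_real_derivative 0) (at x)" by simp
    then show "(\<phi> has_real_derivative 0) (at x)"
      by (rule has_field_derivative_transform_within_open[of _ _ _ "- {c..d}"])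
        (use cd that in auto)
  qed
  moreover have "(deriv ^^ m) (deriv \<phi>) differentiable (at x)" for m x
    by (intro diff_times_imp_higher diff_times_deriv test_fun_diff_times[OF assms])
  ultimately show ?thesis
    unfolding test_fun_def using cd by blast
qed

lemma test_fun_add_cmult: assumes "test_fun a b \<phi>" "test_fun a b \<psi>"
  shows "test_fun a b (\<lambda>x. \<phi> x + c * \<psi> x)"
proof -
  have "diff_times k (\<lambda>x. \<phi> x + c * \<psi> x)" for k
    using assms by (intro diff_times_add diff_times_mult diff_times_const test_fun_diff_times)
  moreover obtain p q p' q' where "a < p" "q < b" "\<forall>x. x \<notin> {p..q} \<longrightarrow> \<phi> x = 0"
     "a < p'" "q' < b" "\<forall>x. x \<notin> {p'..q'} \<longrightarrow> \<psi> x = 0"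
    using assms unfolding test_fun_def by blast
  then have "a < min p p' \<and> max q q' < b \<and> (\<forall>x. x \<notin> {min p p'..max q q'} \<longrightarrow> \<phi> x + c * \<psi> x = 0)"
    by (auto simp: min_le_iff_disj le_max_iff_disj)
  ultimately show ?thesis unfolding test_fun_def by (blast intro: diff_times_imp_higher)
qed

lemma test_fun_bounded: assumes "test_fun a b \<phi>" obtains K where "\<And>x. \<bar>\<phi> x\<bar> \<le> K" "K \<ge> 0"
proof -
  obtain c d where cd: "\<forall>x. x \<notin> {c..d} \<longrightarrow> \<phi> x = 0" using assms by (auto simp: test_fun_def)
  have "compact (\<phi> ` {c..d})"
    by (intro compact_continuous_image test_fun_continuous[OF assms] compact_Icc)
  then obtain K where K: "\<forall>y\<in>\<phi> ` {c..d}. norm y \<le> K"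
    using compact_imp_bounded bounded_iff by metis
  have "\<bar>\<phi> x\<bar> \<le> max 0 K" for x using cd K by (cases "x \<in> {c..d}") (auto simp: le_max_iff_disj)
  with that show ?thesis by (metis max.cobounded1)
qed

lemma test_fun_measurable: "test_fun a b \<phi> \<Longrightarrow> \<phi> \<in> borel_measurable borel"
  by (rule borel_measurable_continuous_onI[OF test_fun_continuous])

lemma test_fun_endpoints: "test_fun a b \<phi> \<Longrightarrow> \<phi> a = 0 \<and> \<phi> b = 0"
  unfolding test_fun_def by (meson atLeastAtMost_iff less_le_not_le)

text \<open>The primitive started at \<open>a\<close> vanishes to the left of the support of \<phi>;
  vanishing of the mean is exactly what makes it vanish to the right as well, hence have compact
  support itself.\<close>

lemma test_fun_primitive:
  assumes \<phi>: "test_fun a b \<phi>" and ab: "a < b" and zero: "integral\<^sup>L (D a b) \<phi> = 0"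
  obtains \<Phi> where "test_fun a b \<Phi>" "deriv \<Phi> = \<phi>"
proof -
  obtain c d where cd: "a < c" "d < b" "\<forall>x. x \<notin> {c..d} \<longrightarrow> \<phi> x = 0"
    using \<phi> by (auto simp: test_fun_def)
  define \<Phi> where "\<Phi> x = (LBINT y=a..x. \<phi> y)" for x
  have der: "(\<Phi> has_real_derivative \<phi> x) (at x)" for x
  proof -
    \<comment> \<open>The margin 1 on both sides puts \<open>x\<close> in the interior, so that the
      derivative within the interval is a full derivative.\<close>
    define l u where "l = min a x - 1" and "u = max a x + 1"
    have "((\<lambda>x. LBINT y=a..x. \<phi> y) has_vector_derivative \<phi> x) (at x within {l..u})"
      by (rule interval_integral_FTC2[OF _ _ test_fun_continuous[OF \<phi>]]) (simp_all add: l_def u_def)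
    moreover have "at x within {l..u} = at x"
      by (rule at_within_interior) (simp add: l_def u_def min_def max_def)
    moreover have "\<Phi> = (\<lambda>x. LBINT y=a..x. \<phi> y)" by (rule ext) (rule \<Phi>_def)
    ultimately show ?thesis
      by (simp only: has_real_derivative_iff_has_vector_derivative)
  qed
  have "\<Phi> a = 0" by (simp add: \<Phi>_def)
  have "\<Phi> b = 0"
    using ab zero by (simp add: \<Phi>_def interval_lebesgue_integral_le_eq integral_D)
  have der0: "(\<Phi> has_real_derivative 0) (at y)" if "y \<notin> {c..d}" for y
    using der[of y] cd(3)[rule_format, OF that] by simp
  have "\<Phi> x = 0" if "x \<notin> {c..d}" for x
  proof (cases "x < c")
    case True
    have "\<Phi> x = \<Phi> a"
    proof (rule DERIV_isconst3[of "min a x - 1" c x a \<Phi>])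
      show "(\<Phi> has_real_derivative 0) (at y)" if "y \<in> {min a x - 1<..<c}" for y
        by (rule der0) (use that in simp)
    qed (use True cd(1) in \<open>simp_all add: min_def\<close>)
    with \<open>\<Phi> a = 0\<close> show ?thesis by simp
  next
    case False
    with that have "x > d" by simp
    have "\<Phi> x = \<Phi> b"
    proof (rule DERIV_isconst3[of d "max b x + 1" x b \<Phi>])
      show "(\<Phi> has_real_derivative 0) (at y)" if "y \<in> {d<..<max b x + 1}" for y
        by (rule der0) (use that in simp)
    qed (use \<open>x > d\<close> cd(2) in \<open>simp_all add: max_def\<close>)
    with \<open>\<Phi> b = 0\<close> show ?thesis by simp
  qed
  moreover have "diff_times k \<Phi>" for k
    using der test_fun_diff_times[OF \<phi>] by (cases k) auto
  ultimately have "test_fun a b \<Phi>"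
    using cd unfolding test_fun_def by (blast intro: diff_times_imp_higher)
  moreover have "deriv \<Phi> = \<phi>" using der by (auto intro: DERIV_imp_deriv)
  ultimately show thesis by (rule that)
qed

subsection \<open>Indefinite integrals\<close>

text \<open>The cut-off is placed in the integrand and not in the domain: the measure stays fixed,
  which suits Fubini and dominated convergence, and the function is defined for every
  \<open>x\<close>, being 0 left of \<open>a\<close> and the full integral right of
  \<open>b\<close>.\<close>

definition indef :: "real \<Rightarrow> real \<Rightarrow> (real \<Rightarrow> real) \<Rightarrow> real \<Rightarrow> real" where
  "indef a b g x = (LINT y|D a b. (if y < x then g y else 0))"

lemma integrable_cut: "integrable (D a b) g \<Longrightarrow> integrable (D a b) (\<lambda>y. if y < x then g y else 0)"
  for g :: "real \<Rightarrow> real"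
  by (rule integrable_dominated[where f = g]) auto

lemma AE_D_neq: "AE y in D a b. y \<noteq> x"
  unfolding AE_D_iff using AE_lborel_singleton[of x] by eventually_elim auto

lemma indef_start: "x \<le> a \<Longrightarrow> indef a b g x = 0"
  unfolding indef_def by (subst LINT_cong[where g = "\<lambda>_. 0", OF refl]) auto

lemma indef_end: "b \<le> x \<Longrightarrow> indef a b g x = integral\<^sup>L (D a b) g"
  unfolding indef_def by (rule LINT_cong) auto

lemma indef_cong_AE:
  assumes "AE y in D a b. g y = h y" "g \<in> borel_measurable (D a b)" "h \<in> borel_measurable (D a b)"
  shows "indef a b g x = indef a b h x"
  unfolding indef_def
  by (rule integral_cong_AE) (use assms in \<open>auto elim: eventually_mono\<close>)

lemma indef_add: "integrable (D a b) g \<Longrightarrow> integrable (D a b) h \<Longrightarrow>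
  indef a b (\<lambda>y. g y + h y) x = indef a b g x + indef a b h x"
  unfolding indef_def
  by (subst Bochner_Integration.integral_add[symmetric])
     (auto intro!: integrable_cut LINT_cong)

lemma indef_cmult: "indef a b (\<lambda>y. c * g y) x = c * indef a b g x"
  unfolding indef_def
  by (subst integral_mult_right_zero[symmetric]) (rule LINT_cong, auto)

text \<open>Dominated convergence: the cut-off integrands converge away from the single point
  \<open>x\<close> and are dominated by the absolute value of \<open>g\<close>.\<close>

lemma indef_continuous: assumes "integrable (D a b) g" shows "continuous_on A (indef a b g)"
proof (rule continuous_at_imp_continuous_on, rule ballI)
  fix x
  show "isCont (indef a b g) x"
    unfolding continuous_at_sequentially comp_def indef_def
  proof (intro allI impI)
    fix u :: "nat \<Rightarrow> real" assume u: "u \<longlonglongrightarrow> x"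
    show "(\<lambda>n. \<integral>y. (if y < u n then g y else 0) \<partial>D a b) \<longlonglongrightarrow> (LINT y|D a b. (if y < x then g y else 0))"
    proof (rule integral_dominated_convergence[where w = "\<lambda>y. norm (g y)"])
      show "AE y in D a b. (\<lambda>n. if y < u n then g y else 0) \<longlonglongrightarrow> (if y < x then g y else 0)"
        using AE_D_neq[of x]
      proof eventually_elim
        case (elim y)
        then have "eventually (\<lambda>n. (y < u n) = (y < x)) sequentially"
          using order_tendstoD[OF u, of y]
          by (cases "y < x") (auto elim: eventually_mono)
        then have "eventually (\<lambda>n. (if y < x then g y else 0) = (if y < u n then g y else 0)) sequentially"
          by eventually_elim simp
        then show ?case by (rule Lim_transform_eventually[OF tendsto_const])
      qed
    qed (use assms in \<open>auto simp: integrable_cut\<close>)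
  qed
qed

lemma indef_abs_le: assumes "integrable (D a b) g" shows "\<bar>indef a b g x\<bar> \<le> (LINT y|D a b. \<bar>g y\<bar>)"
proof -
  have "\<bar>indef a b g x\<bar> \<le> (LINT y|D a b. \<bar>if y < x then g y else 0\<bar>)"
    unfolding indef_def by (rule integral_abs_bound)
  also have "\<dots> \<le> (LINT y|D a b. \<bar>g y\<bar>)"
    using assms by (intro integral_mono) (auto intro!: integrable_abs integrable_cut)
  finally show ?thesis .
qed

text \<open>Fubini on the square, split along its diagonal.\<close>

lemma indef_mult:
  assumes g: "integrable (D a b) g" and h: "integrable (D a b) h"
  shows "indef a b g x * indef a b h x =
    indef a b (\<lambda>y. indef a b g y * h y) x + indef a b (\<lambda>y. g y * indef a b h y) x"
proof -
  define G where "G y = (if y < x then g y else 0)" for y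
  define H where "H y = (if y < x then h y else 0)" for y
  have GH: "integrable (D a b) G" "integrable (D a b) H"
    unfolding G_def H_def by (intro integrable_cut g h)+
  have [measurable]: "G \<in> borel_measurable (D a b)" "H \<in> borel_measurable (D a b)" using GH by auto
  have prod: "integrable (D a b \<Otimes>\<^sub>M D a b) (\<lambda>(s, t). G s * H t)"
    by (rule DD.Fubini_integrable) (use GH in \<open>auto simp: abs_mult\<close>)
  have [measurable]: "Measurable.pred (D a b \<Otimes>\<^sub>M D a b) (\<lambda>z. fst z < snd z)"
    by measurable
  have p1: "integrable (D a b \<Otimes>\<^sub>M D a b) (\<lambda>(s, t). if s < t then G s * H t else 0)"
    by (rule integrable_dominated[OF prod]) (auto simp: split_beta)
  have p2: "integrable (D a b \<Otimes>\<^sub>M D a b) (\<lambda>(s, t). if s < t then 0 else G s * H t)"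
    by (rule integrable_dominated[OF prod]) (auto simp: split_beta)
  have "indef a b g x * indef a b h x = (LINT s|D a b. G s) * (LINT t|D a b. H t)"
    by (simp add: indef_def G_def H_def)
  also have "\<dots> = (LINT s|D a b. (LINT t|D a b. G s * H t))" by simp
  also have "\<dots> = (\<integral>(s, t). G s * H t \<partial>(D a b \<Otimes>\<^sub>M D a b))"
    by (rule DD.integral_fst[OF prod])
  also have "\<dots> = (LINT z|(D a b \<Otimes>\<^sub>M D a b). (case z of (s, t) \<Rightarrow> if s < t then G s * H t else 0)
      + (case z of (s, t) \<Rightarrow> if s < t then 0 else G s * H t))"
    by (rule LINT_cong) auto
  also have "\<dots> = (\<integral>(s, t). (if s < t then G s * H t else 0) \<partial>(D a b \<Otimes>\<^sub>M D a b))
      + (\<integral>(s, t). (if s < t then 0 else G s * H t) \<partial>(D a b \<Otimes>\<^sub>M D a b))"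
    by (rule Bochner_Integration.integral_add[OF p1 p2])
  also have "(\<integral>(s, t). (if s < t then G s * H t else 0) \<partial>(D a b \<Otimes>\<^sub>M D a b))
      = (LINT t|D a b. (LINT s|D a b. (if s < t then G s * H t else 0)))"
    by (rule DD.integral_snd[OF p1, symmetric])
  also have "\<dots> = indef a b (\<lambda>y. indef a b g y * h y) x"
    unfolding indef_def[of a b _ x]
  proof (rule LINT_cong[OF refl])
    fix t
    have "(LINT s|D a b. (if s < t then G s * H t else 0)) = (LINT s|D a b. (if s < t then G s else 0) * H t)"
      by (rule LINT_cong) auto
    also have "\<dots> = (LINT s|D a b. (if s < t then G s else 0)) * H t" by simp
    also have "\<dots> = (if t < x then indef a b g t * h t else 0)"
    proof (cases "t < x")
      case True
      then have "(LINT s|D a b. (if s < t then G s else 0)) = indef a b g t"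
        unfolding indef_def G_def by (intro LINT_cong) auto
      with True show ?thesis by (simp add: H_def)
    qed (simp add: H_def)
    finally show "(LINT s|D a b. (if s < t then G s * H t else 0)) = (if t < x then indef a b g t * h t else 0)" .
  qed
  also have "(\<integral>(s, t). (if s < t then 0 else G s * H t) \<partial>(D a b \<Otimes>\<^sub>M D a b))
      = (LINT s|D a b. (LINT t|D a b. (if s < t then 0 else G s * H t)))"
    by (rule DD.integral_fst[OF p2, symmetric])
  also have "\<dots> = indef a b (\<lambda>y. g y * indef a b h y) x"
    unfolding indef_def[of a b _ x]
  proof (rule LINT_cong[OF refl])
    fix s
    \<comment> \<open>Where \<open>s < t\<close> fails, \<open>t < s\<close> holds except on the
      diagonal, which is null for each fixed \<open>s\<close>.\<close>
    have "(LINT t|D a b. (if s < t then 0 else G s * H t)) = (LINT t|D a b. G s * (if t < s then H t else 0))"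
    proof (rule integral_cong_AE)
      show "AE t in D a b. (if s < t then 0 else G s * H t) = G s * (if t < s then H t else 0)"
        using AE_D_neq[of s] by eventually_elim auto
    qed simp_all
    also have "\<dots> = G s * (LINT t|D a b. (if t < s then H t else 0))" by simp
    also have "\<dots> = (if s < x then g s * indef a b h s else 0)"
    proof (cases "s < x")
      case True
      then have "(LINT t|D a b. (if t < s then H t else 0)) = indef a b h s"
        unfolding indef_def H_def by (intro LINT_cong) auto
      with True show ?thesis by (simp add: G_def)
    qed (simp add: G_def)
    finally show "(LINT t|D a b. (if s < t then 0 else G s * H t)) = (if s < x then g s * indef a b h s else 0)" .
  qed
  finally show ?thesis .
qed

text \<open>Absolute continuity on \<open>{a..b}\<close> with almost everywhere derivative
  \<open>g\<close>, in integral form. Continuous representatives of Sobolev functions, boundary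
  values and integrated evolution equations are all expressed through it; nothing is said about
  \<open>F\<close> outside the closed interval.\<close>

definition prim :: "real \<Rightarrow> real \<Rightarrow> (real \<Rightarrow> real) \<Rightarrow> (real \<Rightarrow> real) \<Rightarrow> bool" where
  "prim a b F g \<longleftrightarrow> integrable (D a b) g \<and> (\<forall>x\<in>{a..b}. F x = F a + indef a b g x)"

lemma prim_integrable: "prim a b F g \<Longrightarrow> integrable (D a b) g"
  unfolding prim_def by blast

lemma prim_eq: "prim a b F g \<Longrightarrow> x \<in> {a..b} \<Longrightarrow> F x = F a + indef a b g x"
  unfolding prim_def by blast

lemma prim_indef: "integrable (D a b) g \<Longrightarrow> prim a b (\<lambda>x. c + indef a b g x) g"
  by (simp add: prim_def indef_start)

lemma prim_diff_eq: assumes "prim a b F g" "a \<le> b" shows "F b - F a = integral\<^sup>L (D a b) g"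
proof -
  have "F b = F a + indef a b g b" using assms by (intro prim_eq) auto
  then show ?thesis by (simp add: indef_end)
qed

lemma prim_continuous: assumes "prim a b F g" shows "continuous_on {a..b} F"
proof -
  have "continuous_on {a..b} (\<lambda>x. F a + indef a b g x)"
    by (rule continuous_on_add[OF continuous_on_const indef_continuous[OF prim_integrable[OF assms]]])
  then show ?thesis
    by (rule continuous_on_eq) (rule prim_eq[OF assms, symmetric])
qed

lemma continuous_on_measurable_D: assumes "continuous_on {a..b} F" shows "F \<in> borel_measurable (D a b)"
proof -
  have "continuous_on {a<..<b} F" using assms by (rule continuous_on_subset) auto
  then have "F \<in> borel_measurable (restrict_space borel {a<..<b})"
    by (rule borel_measurable_continuous_on_restrict)
  moreover have "sets (D a b) = sets (restrict_space borel {a<..<b})"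
    unfolding D_def by (rule sets_restrict_space_cong) (rule sets_lborel)
  ultimately show ?thesis using measurable_cong_sets[OF _ refl] by blast
qed

lemma continuous_on_Icc_bounded:
  assumes "continuous_on {a..b} (F :: real \<Rightarrow> real)" obtains K where "\<And>x. x \<in> {a..b} \<Longrightarrow> \<bar>F x\<bar> \<le> K" "K \<ge> 0"
proof -
  have "compact (F ` {a..b})" by (intro compact_continuous_image assms compact_Icc)
  then obtain K where K: "\<forall>y\<in>F ` {a..b}. norm y \<le> K" using compact_imp_bounded bounded_iff by metis
  show thesis
  proof (rule that[of "max 0 K"])
    show "\<bar>F x\<bar> \<le> max 0 K" if "x \<in> {a..b}" for x using K that by (auto simp: le_max_iff_disj)
  qed simp
qed

lemma integrable_mult_continuous:
  fixes F g :: "real \<Rightarrow> real"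
  assumes "integrable (D a b) g" "continuous_on {a..b} F"
  shows "integrable (D a b) (\<lambda>x. F x * g x)"
proof -
  obtain K where K: "\<And>x. x \<in> {a..b} \<Longrightarrow> \<bar>F x\<bar> \<le> K" "K \<ge> 0"
    using continuous_on_Icc_bounded[OF assms(2)] by blast
  show ?thesis
  proof (rule integrable_dominated)
    show "integrable (D a b) (\<lambda>x. K * g x)" using assms(1) by simp
    show "(\<lambda>x. F x * g x) \<in> borel_measurable (D a b)"
      using continuous_on_measurable_D[OF assms(2)] assms(1) by measurable
    show "AE x in D a b. norm (F x * g x) \<le> norm (K * g x)"
      by (rule AE_D_I) (use K in \<open>auto simp: abs_mult intro!: mult_right_mono\<close>)
  qed
qed

lemma sqi_continuous: assumes "continuous_on {a..b} F" shows "sqi (D a b) F"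
proof -
  obtain K where K: "\<And>x. x \<in> {a..b} \<Longrightarrow> \<bar>F x\<bar> \<le> K" using continuous_on_Icc_bounded[OF assms] by blast
  show ?thesis
    by (rule D.sqi_of_bounded[OF continuous_on_measurable_D[OF assms], of K]) (rule AE_D_I, use K in auto)
qed

lemma prim_cong: assumes F: "prim a b F g" and eq: "\<And>x. x \<in> {a..b} \<Longrightarrow> F x = H x" shows "prim a b H g"
  unfolding prim_def
proof (intro conjI ballI prim_integrable[OF F])
  fix x assume x: "x \<in> {a..b}"
  then have "a \<in> {a..b}" by simp
  with prim_eq[OF F x] eq x show "H x = H a + indef a b g x" by metis
qed

lemma prim_cong_AE:
  assumes F: "prim a b F g" and h: "h \<in> borel_measurable (D a b)" and eq: "AE x in D a b. g x = h x"
  shows "prim a b F h"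
  unfolding prim_def
proof (intro conjI ballI)
  note g = prim_integrable[OF F]
  show "integrable (D a b) h"
    using g by (subst integrable_cong_AE[OF h, of g]) (use g eq in \<open>auto elim: eventually_mono\<close>)
  fix x assume "x \<in> {a..b}"
  moreover have "indef a b g x = indef a b h x" using g h eq by (intro indef_cong_AE) auto
  ultimately show "F x = F a + indef a b h x" using prim_eq[OF F] by metis
qed

lemma prim_const: "prim a b (\<lambda>x. c) (\<lambda>x. 0)"
  unfolding prim_def indef_def by simp

text \<open>After writing each factor as its value at \<open>a\<close> plus an indefinite integral,
  the constants contribute by linearity and the product of the two integrals is handled by
  \<open>indef_mult\<close>.\<close>

lemma prim_mult:
  assumes F: "prim a b F g" and H: "prim a b H h"
  shows "prim a b (\<lambda>x. F x * H x) (\<lambda>x. F x * h x + g x * H x)"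
  unfolding prim_def
proof
  note g = prim_integrable[OF F] and h = prim_integrable[OF H]
  note cF = prim_continuous[OF F] and cH = prim_continuous[OF H]
  have i1: "integrable (D a b) (\<lambda>x. F x * h x)" by (rule integrable_mult_continuous[OF h cF])
  have i2: "integrable (D a b) (\<lambda>x. g x * H x)"
    using integrable_mult_continuous[OF g cH] by (simp add: mult.commute)
  show "integrable (D a b) (\<lambda>x. F x * h x + g x * H x)" using i1 i2 by simp
  show "\<forall>x\<in>{a..b}. F x * H x = F a * H a + indef a b (\<lambda>x. F x * h x + g x * H x) x"
  proof
    fix x assume x: "x \<in> {a..b}"
    let ?G = "indef a b g" and ?H = "indef a b h"
    have j1: "integrable (D a b) (\<lambda>x. ?G x * h x)"
      by (rule integrable_mult_continuous[OF h indef_continuous[OF g]])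
    have j2: "integrable (D a b) (\<lambda>x. g x * ?H x)"
      using integrable_mult_continuous[OF g indef_continuous[OF h]] by (simp add: mult.commute)
    have "indef a b (\<lambda>x. F x * h x + g x * H x) x
       = indef a b (\<lambda>y. (F a * h y + H a * g y) + (?G y * h y + g y * ?H y)) x"
      unfolding indef_def[of a b _ x]
    proof (rule LINT_cong[OF refl])
      fix y assume "y \<in> space (D a b)"
      then have "F y = F a + ?G y" "H y = H a + ?H y" using prim_eq[OF F, of y] prim_eq[OF H, of y] by simp_all
      then show "(if y < x then F y * h y + g y * H y else 0)
        = (if y < x then (F a * h y + H a * g y) + (?G y * h y + g y * ?H y) else 0)"
        by (simp add: algebra_simps)
    qed
    also have "\<dots> = F a * ?H x + H a * ?G x + ?G x * ?H x"
      using g h j1 j2 by (simp add: indef_add indef_cmult indef_mult)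
    finally have "indef a b (\<lambda>x. F x * h x + g x * H x) x = F a * ?H x + H a * ?G x + ?G x * ?H x" .
    moreover have "F x * H x = (F a + ?G x) * (H a + ?H x)"
      by (rule arg_cong2[of _ _ _ _ "(*)"]) (rule prim_eq[OF F x], rule prim_eq[OF H x])
    ultimately show "F x * H x = F a * H a + indef a b (\<lambda>x. F x * h x + g x * H x) x"
      by (simp only: algebra_simps)
  qed
qed

lemma prim_of_derivative:
  assumes der: "\<And>x. x \<in> {a..b} \<Longrightarrow> (F has_real_derivative g x) (at x within {a..b})"
    and cont: "continuous_on {a..b} g"
  shows "prim a b F g"
  unfolding prim_def
proof
  obtain K where K: "\<And>x. x \<in> {a..b} \<Longrightarrow> \<bar>g x\<bar> \<le> K" using continuous_on_Icc_bounded[OF cont] by blast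
  show g: "integrable (D a b) g"
    by (rule D.sqi_integrable[OF sqi_continuous[OF cont]])
  show "\<forall>x\<in>{a..b}. F x = F a + indef a b g x"
  proof
    fix x assume x: "x \<in> {a..b}"
    have "(LBINT y:{a..x}. g y) = F x - F a"
      unfolding set_lebesgue_integral_def
    proof (rule integral_FTC_Icc)
      show "(F has_vector_derivative g y) (at y within {a..x})" if "a \<le> y" "y \<le> x" for y
        using der[of y] that x unfolding has_real_derivative_iff_has_vector_derivative
        by (auto intro: has_vector_derivative_within_subset)
    qed (use x in \<open>auto intro: continuous_on_subset[OF cont]\<close>)
    moreover have "indef a b g x = (LBINT y:{a..x}. g y)"
      unfolding indef_def integral_D set_lebesgue_integral_def
    proof (rule integral_cong_AE)
      have "AE y in lborel. y \<noteq> a \<and> y \<noteq> x \<and> y \<noteq> b"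
        using AE_lborel_singleton[of a] AE_lborel_singleton[of b] AE_lborel_singleton[of x] by auto
      then show "AE y in lborel. indicat_real {a<..<b} y *\<^sub>R (if y < x then g y else 0) = indicat_real {a..x} y *\<^sub>R g y"
        by eventually_elim (use x in \<open>auto simp: indicator_def\<close>)
      have "integrable (D a b) (\<lambda>y. if y < x then g y else 0)" by (rule integrable_cut[OF g])
      then show "(\<lambda>y. indicat_real {a<..<b} y *\<^sub>R (if y < x then g y else 0)) \<in> borel_measurable lborel"
        by (simp add: integrable_D_iff set_integrable_def)
      show "(\<lambda>y. indicat_real {a..x} y *\<^sub>R g y) \<in> borel_measurable lborel"
        using borel_measurable_continuous_on_indicator[OF _ continuous_on_subset[OF cont, of "{a..x}"]] x
        by simp
    qed
    ultimately show "F x = F a + indef a b g x" by simp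
  qed
qed

subsection \<open>The fundamental lemma\<close>

text \<open>The positive and the negative part of \<open>f\<close> are densities of two measures
  that agree on all half-lines. The measures are then equal, the densities agree almost everywhere,
  and two parts of one function agree only where both are 0.\<close>

lemma indef_zero_imp_AE_zero:
  assumes f: "integrable (D a b) f" and zero: "\<And>x. indef a b f x = 0"
  shows "AE x in D a b. f x = 0"
proof -
  define F where "F x = indicat_real {a<..<b} x * f x" for x
  have F: "integrable lborel F" using f by (simp add: integrable_D_iff set_integrable_def F_def[abs_def])
  note mF = borel_measurable_integrable[OF F]
  have tail: "(\<integral>\<^sup>+y. ennreal (F y) * indicator {x<..} y \<partial>lborel) = (\<integral>\<^sup>+y. ennreal (- F y) * indicator {x<..} y \<partial>lborel)" for x
  proof -
    define G where "G y = F y * indicat_real {x<..} y" for y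
    have G: "integrable lborel G"
      unfolding G_def by (rule integrable_dominated[OF F]) (use mF in \<open>auto simp: indicator_def\<close>)
    have "integral\<^sup>L lborel G = (LINT y|lborel. F y - indicat_real {a<..<b} y *\<^sub>R (if y < x then f y else 0))"
    proof (rule integral_cong_AE)
      show "AE y in lborel. G y = F y - indicat_real {a<..<b} y *\<^sub>R (if y < x then f y else 0)"
        using AE_lborel_singleton[of x] by eventually_elim (auto simp: G_def F_def indicator_def)
      show "(\<lambda>y. F y - indicat_real {a<..<b} y *\<^sub>R (if y < x then f y else 0)) \<in> borel_measurable lborel"
        using F integrable_cut[OF f, of x] by (simp add: integrable_D_iff set_integrable_def)
    qed (use G in simp)
    also have "\<dots> = integral\<^sup>L lborel F - (LINT y|lborel. indicat_real {a<..<b} y *\<^sub>R (if y < x then f y else 0))"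
      by (rule Bochner_Integration.integral_diff[OF F])
        (use integrable_cut[OF f, of x] in \<open>simp add: integrable_D_iff set_integrable_def\<close>)
    also have "\<dots> = indef a b f b - indef a b f x"
      unfolding indef_end[OF order_refl] indef_def[of a b f x] integral_D set_lebesgue_integral_def
      by (simp add: F_def[abs_def])
    finally have "enn2real (\<integral>\<^sup>+y. ennreal (G y) \<partial>lborel) = enn2real (\<integral>\<^sup>+y. ennreal (- G y) \<partial>lborel)"
      using zero real_lebesgue_integral_def[OF G] by simp
    moreover have "(\<integral>\<^sup>+y. ennreal (G y) \<partial>lborel) < \<infinity>" "(\<integral>\<^sup>+y. ennreal (- G y) \<partial>lborel) < \<infinity>"
      using G by (simp_all add: real_integrable_def less_top)
    ultimately have "(\<integral>\<^sup>+y. ennreal (G y) \<partial>lborel) = (\<integral>\<^sup>+y. ennreal (- G y) \<partial>lborel)"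
      by (metis ennreal_enn2real infinity_ennreal_def)
    moreover have "ennreal (F y) * indicator {x<..} y = ennreal (G y)" "ennreal (- F y) * indicator {x<..} y = ennreal (- G y)" for y
      by (auto simp: G_def indicator_def)
    ultimately show ?thesis by simp
  qed
  have "density lborel (\<lambda>y. ennreal (F y)) = density lborel (\<lambda>y. ennreal (- F y))"
  proof (rule measure_eqI_lessThan)
    fix x
    have "(\<integral>\<^sup>+y. ennreal (F y) * indicator {x<..} y \<partial>lborel) \<le> (\<integral>\<^sup>+y. ennreal (F y) \<partial>lborel)"
      by (rule nn_integral_mono) (auto simp: indicator_def)
    also have "\<dots> < \<infinity>" using F by (simp add: real_integrable_def less_top)
    finally show "emeasure (density lborel (\<lambda>y. ennreal (F y))) {x<..} < \<infinity>" using mF by (simp add: emeasure_density)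
  qed (use mF tail in \<open>simp_all add: emeasure_density\<close>)
  then have "AE y in lborel. ennreal (F y) = ennreal (- F y)"
    using mF F by (subst (asm) finite_density_unique) (auto simp: real_integrable_def)
  then show ?thesis unfolding AE_D_iff
  proof eventually_elim
    case (elim y)
    have "F y = 0"
    proof (cases "0 \<le> F y")
      case True
      then show ?thesis using elim by (simp add: ennreal_neg ennreal_eq_0_iff)
    next
      case False
      then have "ennreal (F y) = 0" by (simp add: ennreal_neg)
      with elim have "ennreal (- F y) = 0" by simp
      with False show ?thesis by (simp add: ennreal_eq_0_iff)
    qed
    then show ?case by (simp add: F_def indicator_def)
  qed
qed

lemma closure_Rats_Ioo: "a < b \<Longrightarrow> closure ({a<..<b} \<inter> \<rat>) = {a..b::real}"
  by (subst closure_open_Int_superset) (auto simp: Rats_closure_real)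

lemma AE_D_not_False: assumes "c < d" shows "\<not> (AE x in D c d. False)"
proof
  assume "AE x in D c d. False"
  then have "emeasure (D c d) {x \<in> space (D c d). True} = 0"
    by (intro emeasure_eq_0_AE) simp
  then have "emeasure (D c d) {c<..<d} = 0" unfolding space_D by (simp only: simp_thms Collect_mem_eq)
  moreover have "emeasure (D c d) {c<..<d} = ennreal (d - c)"
    using assms unfolding D_def by (subst emeasure_restrict_space) (auto simp: emeasure_lborel_Ioo)
  ultimately show False using assms by (simp add: ennreal_eq_0_iff)
qed

text \<open>Countably many test functions suffice, so that the lemma applies to almost every time slice of a
  function of two variables.\<close>

lemma fundamental_lemma:
  assumes f: "integrable (D a b) f" and ab: "a < b"
    and zero: "\<And>c d n. c \<in> \<rat> \<Longrightarrow> d \<in> \<rat> \<Longrightarrow> a < c \<Longrightarrow> c < d \<Longrightarrow> d < b \<Longrightarrow>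
      (LINT x|D a b. f x * bump c d n x) = 0"
  shows "AE x in D a b. f x = 0"
proof (rule indef_zero_imp_AE_zero[OF f])
  have step: "indef a b f c = indef a b f d" if cd: "c \<in> \<rat>" "d \<in> \<rat>" "a < c" "c < d" "d < b" for c d
  proof -
    \<comment> \<open>The bumps tend boundedly to the indicator of the interval from
      \<open>c\<close> to \<open>d\<close>, over which the integral of \<open>f\<close> therefore
      vanishes.\<close>
    have "(\<lambda>n. \<integral>x. f x * bump c d n x \<partial>D a b) \<longlonglongrightarrow> (LINT x|D a b. f x * (if c < x \<and> x < d then 1 else 0))"
    proof (rule integral_dominated_convergence[where w = "\<lambda>x. norm (f x)"])
      show "AE x in D a b. (\<lambda>n. f x * bump c d n x) \<longlonglongrightarrow> f x * (if c < x \<and> x < d then 1 else 0)"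
        by (intro AE_I2 tendsto_mult bump_limit tendsto_const)
      show "(\<lambda>x. f x * bump c d n x) \<in> borel_measurable (D a b)" for n
        using f borel_measurable_D_compose[OF bump_measurable[of c d n], of a b] by measurable
      show "AE x in D a b. norm (f x * bump c d n x) \<le> norm (f x)" for n
        using bump_bounds[of c d n] by (auto simp: abs_mult intro!: mult_left_le)
    qed (use f in auto)
    then have "(LINT x|D a b. f x * (if c < x \<and> x < d then 1 else 0)) = 0"
      using zero[OF cd] by (simp add: LIMSEQ_const_iff)
    moreover have "(LINT x|D a b. f x * (if c < x \<and> x < d then 1 else 0))
      = (LINT x|D a b. (if x < d then f x else 0) - (if x < c then f x else 0))"
    proof (rule integral_cong_AE)
      show "AE x in D a b. f x * (if c < x \<and> x < d then 1 else 0) = (if x < d then f x else 0) - (if x < c then f x else 0)"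
        using AE_D_neq[of c] by eventually_elim (use cd in auto)
    qed (use f in auto)
    ultimately show ?thesis using f by (simp add: indef_def integrable_cut)
  qed
  obtain q where q: "q \<in> \<rat>" "a < q" "q < b" using Rats_dense_in_real[OF ab] by auto
  have "indef a b f x = indef a b f q" if "x \<in> {a<..<b} \<inter> \<rat>" for x
  proof (cases x q rule: linorder_cases)
    case less
    then show ?thesis using that q by (intro step) simp_all
  next
    case greater
    then have "indef a b f q = indef a b f x" using that q by (intro step) simp_all
    then show ?thesis by (rule sym)
  qed simp
  \<comment> \<open>Constancy at rational points extends by continuity to the closed interval, and
    at \<open>a\<close> the value is 0.\<close>
  then have const: "indef a b f x = indef a b f q" if "x \<in> {a..b}" for x
    using continuous_constant_on_closure[of "{a<..<b} \<inter> \<rat>" "indef a b f" "indef a b f q" x] that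
    unfolding closure_Rats_Ioo[OF ab] by (auto intro: indef_continuous[OF f])
  have q0: "indef a b f q = 0" using const[of a] ab by (simp add: indef_start)
  fix x
  consider "x \<le> a" | "x \<in> {a..b}" | "x \<ge> b" by fastforce
  then show "indef a b f x = 0"
  proof cases
    case 3
    then show ?thesis using const[of b] ab q0 by (simp add: indef_end)
  qed (use const q0 in \<open>auto simp: indef_start\<close>)
qed

lemma integrable_mult_test_fun:
  assumes f: "integrable (D a b) f" and \<phi>: "test_fun c d \<phi>" shows "integrable (D a b) (\<lambda>x. f x * \<phi> x)"
  using integrable_mult_continuous[OF f test_fun_continuous[OF \<phi>]] by (simp add: mult.commute)

text \<open>Subtracting a multiple of a fixed bump \<theta> gives any test function mean zero and so
  makes it the derivative of a test function. The constant must be the average of \<open>f\<close>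
  weighted by \<theta>, which is the \<open>k\<close> below.\<close>

lemma du_Bois_Reymond:
  assumes f: "integrable (D a b) f" and ab: "a < b"
    and zero: "\<And>\<phi>. test_fun a b \<phi> \<Longrightarrow> (LINT x|D a b. f x * deriv \<phi> x) = 0"
  obtains k where "AE x in D a b. f x = k"
proof -
  obtain p where p: "a < p" "p < b" using dense[OF ab] by auto
  obtain q where q: "p < q" "q < b" using dense[OF p(2)] by auto
  define \<theta> where "\<theta> = bump p q 0"
  have \<theta>: "test_fun a b \<theta>" unfolding \<theta>_def by (rule bump_test_fun[OF p(1) q(2)])
  have one: "integrable (D a b) (\<lambda>x. 1)" by simp
  have int\<theta>: "integrable (D a b) \<theta>" using integrable_mult_test_fun[OF one \<theta>] by simp
  have "integral\<^sup>L (D a b) \<theta> \<noteq> 0"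
  proof
    assume "integral\<^sup>L (D a b) \<theta> = 0"
    then have "AE x in D a b. \<theta> x = 0"
      using int\<theta> by (subst (asm) integral_nonneg_eq_0_iff_AE) (auto simp: \<theta>_def bump_bounds)
    then have "AE x in D p q. False"
      unfolding AE_D_iff by eventually_elim (use p q in \<open>auto simp: \<theta>_def bump_eq\<close>)
    with AE_D_not_False[OF q(1)] show False by blast
  qed
  define I where "I = integral\<^sup>L (D a b) \<theta>"
  define k where "k = (LINT x|D a b. f x * \<theta> x) / I"
  have "AE x in D a b. f x - k = 0"
  proof (rule fundamental_lemma[OF _ ab])
    show "integrable (D a b) (\<lambda>x. f x - k)" using f by simp
    fix c d n assume cd: "a < c" "c < d" "d < b"
    define \<phi> where "\<phi> = bump c d n"
    have \<phi>: "test_fun a b \<phi>" unfolding \<phi>_def by (rule bump_test_fun) (use cd in auto)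
    have int\<phi>: "integrable (D a b) \<phi>" using integrable_mult_test_fun[OF one \<phi>] by simp
    \<comment> \<open>Chosen so that \<open>\<phi> - s \<theta>\<close> has mean zero.\<close>
    define s where "s = integral\<^sup>L (D a b) \<phi> / I"
    have "integral\<^sup>L (D a b) (\<lambda>x. \<phi> x + (- s) * \<theta> x) = integral\<^sup>L (D a b) \<phi> + (- s) * I"
      using int\<phi> int\<theta> by (simp add: I_def)
    also have "\<dots> = 0" using \<open>integral\<^sup>L (D a b) \<theta> \<noteq> 0\<close> by (simp add: s_def I_def)
    finally obtain \<Phi> where \<Phi>: "test_fun a b \<Phi>" "deriv \<Phi> = (\<lambda>x. \<phi> x + (- s) * \<theta> x)"
      using test_fun_primitive[OF test_fun_add_cmult[OF \<phi> \<theta>] ab] by blast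
    have i: "integrable (D a b) (\<lambda>x. f x * \<phi> x)" "integrable (D a b) (\<lambda>x. f x * \<theta> x)"
      by (rule integrable_mult_test_fun[OF f] \<phi> \<theta>)+
    have "0 = (LINT x|D a b. f x * \<phi> x + (- s) * (f x * \<theta> x))"
      using zero[OF \<Phi>(1)] unfolding \<Phi>(2) by (simp add: algebra_simps)
    also have "\<dots> = (LINT x|D a b. f x * \<phi> x) - s * (LINT x|D a b. f x * \<theta> x)" using i by simp
    also have "s * (LINT x|D a b. f x * \<theta> x) = k * integral\<^sup>L (D a b) \<phi>" by (simp add: s_def k_def)
    also have "(LINT x|D a b. f x * \<phi> x) - k * integral\<^sup>L (D a b) \<phi> = (LINT x|D a b. f x * \<phi> x - k * \<phi> x)"
      using i int\<phi> by simp
    finally show "(LINT x|D a b. (f x - k) * bump c d n x) = 0"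
      by (simp add: \<phi>_def left_diff_distrib)
  qed
  then have "AE x in D a b. f x = k" by eventually_elim simp
  then show thesis by (rule that)
qed

subsection \<open>Weak derivatives in one variable\<close>

lemma weak_deriv_eq: "weak_deriv a b f g \<Longrightarrow> test_fun a b \<phi> \<Longrightarrow>
    (LINT x|D a b. f x * deriv \<phi> x) = - (LINT x|D a b. g x * \<phi> x)"
  unfolding weak_deriv_def integral_D[symmetric] by blast

lemma integrable_loc: assumes "integrable (D a b) f" shows "loc_integrable a b f"
  unfolding loc_integrable_def
proof (intro allI impI)
  fix c d assume "a < c \<and> d < b"
  then have "{c..d} \<subseteq> {a<..<b}" by auto
  then show "set_integrable lborel {c..d} f"
    using set_integrable_subset[OF assms[unfolded integrable_D_iff], of "{c..d}"] by simp
qed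

lemma weak_derivI:
  assumes "integrable (D a b) f" "integrable (D a b) g"
    "\<And>\<phi>. test_fun a b \<phi> \<Longrightarrow> (LINT x|D a b. f x * deriv \<phi> x) = - (LINT x|D a b. g x * \<phi> x)"
  shows "weak_deriv a b f g"
  unfolding weak_deriv_def integral_D[symmetric]
  by (intro conjI allI impI integrable_loc assms)

lemma prim_test_fun: assumes "test_fun a b \<phi>" shows "prim c d \<phi> (deriv \<phi>)"
proof (rule prim_of_derivative)
  show "(\<phi> has_real_derivative deriv \<phi> x) (at x within {c..d})" for x
    by (rule has_field_derivative_at_within[OF test_fun_has_derivative[OF assms]])
  show "continuous_on {c..d} (deriv \<phi>)"
    by (rule test_fun_continuous[OF test_fun_deriv[OF assms]])
qed

lemma prim_by_parts:
  assumes F: "prim a b F g" and H: "prim a b H h" and ab: "a \<le> b"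
  shows "(LINT x|D a b. F x * h x) = F b * H b - F a * H a - (LINT x|D a b. g x * H x)"
proof -
  have "integrable (D a b) (\<lambda>x. F x * h x)"
    by (rule integrable_mult_continuous[OF prim_integrable[OF H] prim_continuous[OF F]])
  moreover have "integrable (D a b) (\<lambda>x. g x * H x)"
    using integrable_mult_continuous[OF prim_integrable[OF F] prim_continuous[OF H]] by (simp add: mult.commute)
  ultimately show ?thesis using prim_diff_eq[OF prim_mult[OF F H] ab] by simp
qed

lemma prim_integrable_self: assumes "prim a b F g" shows "integrable (D a b) F"
  by (rule D.sqi_integrable[OF sqi_continuous[OF prim_continuous[OF assms]]])

lemma prim_weak_deriv: assumes F: "prim a b F g" and ab: "a \<le> b" shows "weak_deriv a b F g"
proof (rule weak_derivI[OF prim_integrable_self[OF F] prim_integrable[OF F]])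
  fix \<phi> assume \<phi>: "test_fun a b \<phi>"
  show "(LINT x|D a b. F x * deriv \<phi> x) = - (LINT x|D a b. g x * \<phi> x)"
    using prim_by_parts[OF F prim_test_fun[OF \<phi>] ab] test_fun_endpoints[OF \<phi>] by simp
qed

lemma weak_deriv_cong_AE:
  assumes "weak_deriv a b f g" "AE x in D a b. f x = f' x" "AE x in D a b. g x = g' x"
    "integrable (D a b) f'" "integrable (D a b) g'" "integrable (D a b) f" "integrable (D a b) g"
  shows "weak_deriv a b f' g'"
proof (rule weak_derivI[OF assms(4,5)])
  fix \<phi> assume \<phi>: "test_fun a b \<phi>"
  note [measurable] = borel_measurable_D_compose[OF test_fun_measurable[OF \<phi>]]
    borel_measurable_D_compose[OF test_fun_measurable[OF test_fun_deriv[OF \<phi>]]]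
    borel_measurable_integrable[OF assms(4)] borel_measurable_integrable[OF assms(5)]
    borel_measurable_integrable[OF assms(6)] borel_measurable_integrable[OF assms(7)]
  have "(LINT x|D a b. f x * deriv \<phi> x) = (LINT x|D a b. f' x * deriv \<phi> x)"
    by (rule integral_cong_AE) (use assms(2) in \<open>measurable, auto elim: eventually_mono\<close>)
  moreover have "(LINT x|D a b. g x * \<phi> x) = (LINT x|D a b. g' x * \<phi> x)"
    by (rule integral_cong_AE) (use assms(3) in \<open>measurable, auto elim: eventually_mono\<close>)
  ultimately show "(LINT x|D a b. f' x * deriv \<phi> x) = - (LINT x|D a b. g' x * \<phi> x)"
    using weak_deriv_eq[OF assms(1) \<phi>] by simp
qed

text \<open>The difference of \<open>f\<close> and the indefinite integral of \<open>g\<close> has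
  weak derivative 0, hence is constant. As \<open>g\<close> is integrable up to the endpoints, the
  representative is continuous on the closed interval and has boundary values.\<close>

lemma weak_deriv_prim:
  assumes w: "weak_deriv a b f g" and f: "integrable (D a b) f" and g: "integrable (D a b) g" and ab: "a < b"
  obtains F where "prim a b F g" "AE x in D a b. f x = F x"
proof -
  let ?G = "\<lambda>x. 0 + indef a b g x"
  have G: "prim a b ?G g" by (rule prim_indef[OF g])
  have "integrable (D a b) (\<lambda>x. f x - ?G x)" using f prim_integrable_self[OF G] by simp
  then obtain k where k: "AE x in D a b. f x - ?G x = k"
  proof (rule du_Bois_Reymond[OF _ ab])
    fix \<phi> assume \<phi>: "test_fun a b \<phi>"
    have "integrable (D a b) (\<lambda>x. f x * deriv \<phi> x)" "integrable (D a b) (\<lambda>x. ?G x * deriv \<phi> x)"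
      by (rule integrable_mult_test_fun f prim_integrable_self[OF G] test_fun_deriv[OF \<phi>])+
    then have "(LINT x|D a b. (f x - ?G x) * deriv \<phi> x) = (LINT x|D a b. f x * deriv \<phi> x) - (LINT x|D a b. ?G x * deriv \<phi> x)"
      by (simp add: left_diff_distrib)
    also have "\<dots> = 0"
      using weak_deriv_eq[OF w \<phi>] weak_deriv_eq[OF prim_weak_deriv[OF G] \<phi>] ab by simp
    finally show "(LINT x|D a b. (f x - ?G x) * deriv \<phi> x) = 0" .
  qed
  show thesis
  proof (rule that)
    show "prim a b (\<lambda>x. k + indef a b g x) g" by (rule prim_indef[OF g])
    show "AE x in D a b. f x = k + indef a b g x" using k by eventually_elim simp
  qed
qed

lemma integral_D_subinterval:
  assumes "a \<le> c" "d \<le> b" "\<And>x. x \<notin> {c<..<d} \<Longrightarrow> f x = 0"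
  shows "integral\<^sup>L (D a b) f = integral\<^sup>L (D c d) (f :: real \<Rightarrow> real)"
  unfolding integral_D set_lebesgue_integral_def
proof (rule LINT_cong[OF refl])
  fix x
  show "indicat_real {a<..<b} x *\<^sub>R f x = indicat_real {c<..<d} x *\<^sub>R f x"
  proof (cases "x \<in> {c<..<d}")
    case True
    with assms(1,2) show ?thesis by simp
  next
    case False
    then have "f x = 0" by (rule assms(3))
    then show ?thesis by simp
  qed
qed

text \<open>A weak derivative is by definition only locally integrable, so the fundamental lemma is
  applied on subintervals with rational endpoints inside the open interval; countably many of them
  cover it. This generality is what \<open>weak_der\<close> calls for, being an arbitrary choice of
  weak derivative.\<close>

lemma weak_deriv_unique:
  assumes w: "weak_deriv a b f g" "weak_deriv a b f h"
  shows "AE x in D a b. g x = h x"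
proof -
  have sub: "AE x in D c d. g x - h x = 0" if cd: "a < c" "c < d" "d < b" for c d
  proof (rule fundamental_lemma[OF _ cd(2)])
    have loc: "integrable (D c d) k" if "loc_integrable a b k" for k
      unfolding integrable_D_iff
    proof (rule set_integrable_subset)
      show "set_integrable lborel {c..d} k" using that cd unfolding loc_integrable_def by blast
    qed auto
    have g: "integrable (D c d) g" and h: "integrable (D c d) h"
      by (rule loc, use w in \<open>simp add: weak_deriv_def\<close>)+
    then show "integrable (D c d) (\<lambda>x. g x - h x)" by simp
    fix p q n assume pq: "c < p" "p < q" "q < d"
    have t: "test_fun a b (bump p q n)" "test_fun c d (bump p q n)"
      using pq cd by (auto intro!: bump_test_fun)
    have z: "x \<notin> {c<..<d} \<Longrightarrow> bump p q n x = 0" for x using pq by (auto simp: bump_eq)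
    have "(LINT x|D c d. g x * bump p q n x) = (LINT x|D a b. g x * bump p q n x)"
      by (rule integral_D_subinterval[symmetric]) (use cd z in auto)
    also have "\<dots> = (LINT x|D a b. h x * bump p q n x)"
      using weak_deriv_eq[OF w(1) t(1)] weak_deriv_eq[OF w(2) t(1)] by simp
    also have "\<dots> = (LINT x|D c d. h x * bump p q n x)"
      by (rule integral_D_subinterval) (use cd z in auto)
    finally show "(LINT x|D c d. (g x - h x) * bump p q n x) = 0"
      using integrable_mult_test_fun[OF g t(2)] integrable_mult_test_fun[OF h t(2)] by (simp add: left_diff_distrib)
  qed
  have "AE x in lborel. \<forall>c\<in>\<rat>. \<forall>d\<in>\<rat>. a < c \<and> c < d \<and> d < b \<longrightarrow> x \<in> {c<..<d} \<longrightarrow> g x - h x = 0"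
    by (intro AE_ball_countable[THEN iffD2] ballI countable_rat) (use sub in \<open>auto simp: AE_D_iff\<close>)
  then show ?thesis
    unfolding AE_D_iff
  proof eventually_elim
    case (elim x)
    show ?case
    proof
      assume x: "x \<in> {a<..<b}"
      then obtain c d where "c \<in> \<rat>" "a < c" "c < x" "d \<in> \<rat>" "x < d" "d < b"
        using Rats_dense_in_real[of a x] Rats_dense_in_real[of x b] by auto
      with elim show "g x = h x" by fastforce
    qed
  qed
qed

lemma continuous_AE_eq:
  assumes F: "continuous_on {a..b} F" and G: "continuous_on {a..b} (G :: real \<Rightarrow> real)"
    and ab: "a < b" and eq: "AE x in D a b. F x = G x" and x: "x \<in> {a..b}"
  shows "F x = G x"
proof -
  have "F y - G y = 0" if y: "y \<in> {a<..<b}" for y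
  proof (rule ccontr)
    assume ne: "F y - G y \<noteq> 0"
    have c: "continuous_on {a<..<b} (\<lambda>x. F x - G x)"
      using continuous_on_subset[OF continuous_on_diff[OF F G], of "{a<..<b}"] by (simp add: subset_iff)
    have "open {x \<in> {a<..<b}. F x - G x \<noteq> 0}"
      using continuous_open_preimage[OF c, of "- {0}"] by (simp add: vimage_def Int_def open_Compl)
    then obtain e where e: "e > 0" "ball y e \<subseteq> {x \<in> {a<..<b}. F x - G x \<noteq> 0}"
      using y ne by (auto simp: open_contains_ball)
    have "AE x in D (y - e) (y + e). False"
      using eq unfolding AE_D_iff
    proof eventually_elim
      case (elim x)
      show ?case
      proof
        assume "x \<in> {y - e<..<y + e}"
        then have "x \<in> ball y e" by (auto simp: dist_real_def)
        with e elim show False by auto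
      qed
    qed
    with AE_D_not_False[of "y - e" "y + e"] e(1) show False by auto
  qed
  then have "F x - G x = 0"
    using continuous_constant_on_closure[of "{a<..<b}" "\<lambda>x. F x - G x" 0 x] x ab
      continuous_on_diff[OF F G] by simp
  then show ?thesis by simp
qed

text \<open>Converts the existential notion of a point value into the value of whatever continuous
  representative is at hand, since two of them that agree almost everywhere agree up to the
  endpoints.\<close>

lemma point_value_unique:
  assumes "point_value a b f p y" "continuous_on {a..b} F" "AE x in D a b. f x = F x" "a < b" "p \<in> {a..b}"
  shows "F p = y"
proof -
  obtain G where G: "continuous_on {a..b} G" "AE x in D a b. G x = f x" "G p = y"
    using assms(1) by (auto simp: point_value_def AE_D_iff)
  have "AE x in D a b. F x = G x" using G(2) assms(3) by eventually_elim simp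
  from continuous_AE_eq[OF assms(2) G(1) assms(4) this assms(5)] G(3) show ?thesis by simp
qed

subsection \<open>Evolution equations\<close>

lemma AE_D_obtain: assumes "AE t in D a b. P t" "a < b" obtains t where "t \<in> {a<..<b}" "P t"
proof (rule ccontr)
  assume *: "\<not> thesis"
  have "AE t in D a b. False"
    using assms(1) unfolding AE_D_iff
  proof eventually_elim
    case (elim t)
    with * that show ?case by blast
  qed
  with AE_D_not_False[OF assms(2)] show False by blast
qed

lemma AE_D_subinterval: assumes "AE t in D a b. P t" "a \<le> c" "d \<le> b" shows "AE t in D c d. P t"
  using assms(1) unfolding AE_D_iff
proof eventually_elim
  case (elim t)
  with assms(2,3) show ?case by simp
qed

text \<open>No right neighbourhood of 0 is a null set, so equality almost everywhere is enough to
  identify the two limits.\<close>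

lemma AE_limit_unique:
  assumes F: "(F \<longlongrightarrow> l) (at_right 0)" and Q: "(Q \<longlongrightarrow> k) (at_right 0)"
    and eq: "AE t in D 0 T. F t = Q t" and T: "T > 0"
  shows "l = (k :: real)"
proof (rule ccontr)
  assume "l \<noteq> k"
  have "((\<lambda>t. F t - Q t) \<longlongrightarrow> l - k) (at_right 0)" by (rule tendsto_diff[OF F Q])
  moreover have "l - k \<noteq> 0" using \<open>l \<noteq> k\<close> by auto
  ultimately have "eventually (\<lambda>t. F t - Q t \<noteq> 0) (at_right 0)"
    by (rule tendsto_imp_eventually_ne)
  then obtain e where e: "e > 0" "\<And>t. 0 < t \<Longrightarrow> t < e \<Longrightarrow> F t - Q t \<noteq> 0"
    unfolding eventually_at_right_field by blast
  have "AE t in D 0 (min e T). F t = Q t" by (rule AE_D_subinterval[OF eq]) simp_all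
  then obtain t where "t \<in> {0<..<min e T}" "F t = Q t"
    by (rule AE_D_obtain) (use e T in simp_all)
  with e(2)[of t] show False by simp
qed

lemma case_prod_test_measurable:
  fixes f g :: "real \<Rightarrow> real"
  assumes "f \<in> borel_measurable (D a b)" "g \<in> borel_measurable (D c d)"
  shows "(\<lambda>(t, x). f t * g x) \<in> borel_measurable (rect a b c d)"
proof -
  have "(\<lambda>z. f (fst z)) \<in> borel_measurable (rect a b c d)"
    by (rule measurable_compose[OF measurable_fst assms(1)])
  moreover have "(\<lambda>z. g (snd z)) \<in> borel_measurable (rect a b c d)"
    by (rule measurable_compose[OF measurable_snd assms(2)])
  ultimately have "(\<lambda>z. f (fst z) * g (snd z)) \<in> borel_measurable (rect a b c d)"
    by (rule borel_measurable_times)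
  then show ?thesis by (simp add: split_beta')
qed

lemma integrable_pair_mult_bounded:
  fixes q :: "real \<Rightarrow> real \<Rightarrow> real"
  assumes q: "integrable (rect a b c d) (case_prod q)"
    and f: "f \<in> borel_measurable borel" "\<And>t. \<bar>f t\<bar> \<le> K" and g: "g \<in> borel_measurable borel" "\<And>t. \<bar>g t\<bar> \<le> L"
  shows "integrable (rect a b c d) (\<lambda>(t, x). q t x * (f t * g x))"
proof (rule integrable_dominated)
  have [measurable]: "case_prod q \<in> borel_measurable (rect a b c d)" using q by auto
  have [measurable]: "(\<lambda>(t, x). f t * g x) \<in> borel_measurable (rect a b c d)"
    by (intro case_prod_test_measurable borel_measurable_D_compose f g)
  have "(\<lambda>z. case_prod q z * (case z of (t, x) \<Rightarrow> f t * g x)) \<in> borel_measurable (rect a b c d)"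
    by measurable
  then show "(\<lambda>(t, x). q t x * (f t * g x)) \<in> borel_measurable (rect a b c d)" by (simp add: split_beta')
  show "integrable (rect a b c d) (\<lambda>z. (K * L) * case_prod q z)" using q by simp
  have "\<bar>q t x * (f t * g x)\<bar> \<le> \<bar>K * L * q t x\<bar>" for t x
  proof -
    have "\<bar>f t * g x\<bar> \<le> K * L"
      unfolding abs_mult by (rule mult_mono) (use f(2)[of t] g(2)[of x] abs_ge_zero[of "f t"] in linarith)+
    also have "\<dots> \<le> \<bar>K * L\<bar>" by simp
    finally show ?thesis unfolding abs_mult[of "q t x"] abs_mult[of _ "q t x"] mult.commute[of _ "\<bar>q t x\<bar>"]
      by (rule mult_left_mono) simp
  qed
  then show "AE z in rect a b c d. norm (case z of (t, x) \<Rightarrow> q t x * (f t * g x)) \<le> norm (K * L * case_prod q z)"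
    by (intro AE_I2) (auto simp: split_beta)
qed

lemma integrable_pair_cut:
  fixes g :: "real \<Rightarrow> real \<Rightarrow> real"
  assumes g: "integrable (rect a b c d) (case_prod g)"
  shows "integrable (rect a b c d) (\<lambda>(s, x). if s < t then g s x else 0)"
  using integrable_pair_mult_bounded[OF g, of "\<lambda>s. if s < t then 1 else 0" 1 "\<lambda>_. 1" 1]
  by (rule back_subst[where P = "integrable _"]) (auto simp: fun_eq_iff)

lemma indef_integral_swap:
  fixes g :: "real \<Rightarrow> real \<Rightarrow> real"
  assumes g: "integrable (rect a b c d) (case_prod g)"
  shows "indef a b (\<lambda>s. \<integral>x. g s x \<partial>D c d) t = (LINT x|D c d. indef a b (\<lambda>s. g s x) t)"
    and "integrable (D c d) (\<lambda>x. indef a b (\<lambda>s. g s x) t)"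
proof -
  have "indef a b (\<lambda>s. \<integral>x. g s x \<partial>D c d) t = (LINT s|D a b. (LINT x|D c d. (if s < t then g s x else 0)))"
    unfolding indef_def by (intro LINT_cong refl) simp
  also have "\<dots> = (LINT x|D c d. indef a b (\<lambda>s. g s x) t)"
    unfolding indef_def by (rule DD.Fubini_integral[OF integrable_pair_cut[OF g], symmetric])
  finally show "indef a b (\<lambda>s. \<integral>x. g s x \<partial>D c d) t = (LINT x|D c d. indef a b (\<lambda>s. g s x) t)" .
  show "integrable (D c d) (\<lambda>x. indef a b (\<lambda>s. g s x) t)"
    unfolding indef_def by (rule DD.integrable_snd[OF integrable_pair_cut[OF g]])
qed

lemma indef_pair_measurable:
  assumes [measurable]: "case_prod g \<in> borel_measurable (rect a b c d)"
  shows "(\<lambda>z. indef a b (\<lambda>s. g s (snd z)) (fst z)) \<in> borel_measurable (rect a b c d)"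
  unfolding indef_def
proof (rule D.borel_measurable_lebesgue_integral)
  have [measurable]: "(\<lambda>w. case_prod g (snd w, snd (fst w))) \<in> borel_measurable ((rect a b c d) \<Otimes>\<^sub>M D a b)"
    by (rule measurable_compose[where g = "case_prod g" and N = "rect a b c d"]) measurable
  have [measurable]: "(\<lambda>w. snd w) \<in> borel_measurable ((rect a b c d) \<Otimes>\<^sub>M D a b)"
    by measurable
  have [measurable]: "(\<lambda>w. fst (fst w)) \<in> borel_measurable ((rect a b c d) \<Otimes>\<^sub>M D a b)"
    by (rule measurable_compose[OF measurable_fst borel_measurable_D_fst])
  have "(\<lambda>w. if snd w < fst (fst w) then case_prod g (snd w, snd (fst w)) else 0) \<in>
     borel_measurable ((rect a b c d) \<Otimes>\<^sub>M D a b)"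
    by measurable
  then show "(\<lambda>(z, s). if s < fst z then g s (snd z) else 0) \<in> borel_measurable ((rect a b c d) \<Otimes>\<^sub>M D a b)"
    by (simp add: split_beta')
qed

text \<open>With \<psi> frozen, the equation says that the scalar function \<open>P\<close> of time
  has the integrable weak derivative \<open>G\<close>, so \<open>P\<close> has an absolutely
  continuous representative. Its value at 0 is read off from \<open>Q\<close>, a function with a
  limit at 0 that agrees with \<open>P\<close> almost everywhere.\<close>

lemma evolution_weak:
  fixes q g :: "real \<Rightarrow> real \<Rightarrow> real"
  assumes T: "T > 0"
    and q: "integrable (cyl T) (case_prod q)"
    and g: "integrable (cyl T) (case_prod g)"
    and eq: "\<And>\<theta>. test_fun 0 T \<theta> \<Longrightarrow>
      (LINT (t, x)|(cyl T). q t x * (deriv \<theta> t * \<psi> x))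
        = - (LINT (t, x)|(cyl T). g t x * (\<theta> t * \<psi> x))"
    and \<psi>: "test_fun 0 1 \<psi>"
    and q0: "integrable (D 0 1) q0"
    and Q: "(Q \<longlongrightarrow> (LINT x|D 0 1. q0 x * \<psi> x)) (at_right 0)"
      "AE t in D 0 T. Q t = (LINT x|D 0 1. q t x * \<psi> x)"
  shows "AE t in D 0 T. (LINT x|D 0 1. (q t x - (q0 x + indef 0 T (\<lambda>s. g s x) t)) * \<psi> x) = 0"
proof -
  obtain K where K: "\<And>x. \<bar>\<psi> x\<bar> \<le> K" using test_fun_bounded[OF \<psi>] by blast
  note m\<psi> = test_fun_measurable[OF \<psi>]
  have i\<psi>: "integrable (cyl T) (\<lambda>(t, x). p t x * \<psi> x)"
    if "integrable (cyl T) (case_prod p)" for p :: "real \<Rightarrow> real \<Rightarrow> real"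
    using integrable_pair_mult_bounded[OF that, of "\<lambda>_. 1" 1 \<psi> K] m\<psi> K by simp
  define G where "G t = (LINT x|D 0 1. g t x * \<psi> x)" for t
  define P where "P t = (LINT x|D 0 1. q t x * \<psi> x)" for t
  have iG: "integrable (D 0 T) G" and iP: "integrable (D 0 T) P"
    unfolding G_def P_def by (rule DD.integrable_fst[OF i\<psi>[OF g]] DD.integrable_fst[OF i\<psi>[OF q]])+
  have fub: "(LINT t|D 0 T. (LINT x|D 0 1. p t x * \<psi> x) * \<theta> t) = (LINT (t, x)|(cyl T). p t x * (\<theta> t * \<psi> x))"
    if p: "integrable (cyl T) (case_prod p)" and \<theta>: "test_fun 0 T \<theta>" for p :: "real \<Rightarrow> real \<Rightarrow> real" and \<theta>
  proof -
    obtain L where L: "\<And>x. \<bar>\<theta> x\<bar> \<le> L" using test_fun_bounded[OF \<theta>] by blast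
    have "(LINT t|D 0 T. (LINT x|D 0 1. p t x * \<psi> x) * \<theta> t) = (LINT t|D 0 T. (LINT x|D 0 1. p t x * (\<theta> t * \<psi> x)))"
    proof (intro LINT_cong refl)
      fix t
      show "(LINT x|D 0 1. p t x * \<psi> x) * \<theta> t = (LINT x|D 0 1. p t x * (\<theta> t * \<psi> x))"
        unfolding integral_mult_left_zero[symmetric] by (simp add: ac_simps)
    qed
    also have "\<dots> = (LINT (t, x)|(cyl T). p t x * (\<theta> t * \<psi> x))"
      by (rule DD.integral_fst[OF integrable_pair_mult_bounded[OF p test_fun_measurable[OF \<theta>] L m\<psi> K]])
    finally show ?thesis .
  qed
  have "weak_deriv 0 T P G"
  proof (rule weak_derivI[OF iP iG])
    fix \<theta> assume \<theta>: "test_fun 0 T \<theta>"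
    show "(LINT t|D 0 T. P t * deriv \<theta> t) = - (LINT t|D 0 T. G t * \<theta> t)"
      unfolding P_def G_def fub[OF q test_fun_deriv[OF \<theta>]] fub[OF g \<theta>] by (rule eq[OF \<theta>])
  qed
  then obtain F where F: "prim 0 T F G" "AE t in D 0 T. P t = F t"
    using weak_deriv_prim[OF _ iP iG T] by blast
  have "(F \<longlongrightarrow> F 0) (at_right 0)"
  proof -
    have "(F \<longlongrightarrow> F 0) (at 0 within {0..T})"
      using prim_continuous[OF F(1)] T by (simp add: continuous_on_def)
    then show ?thesis using T by (simp add: at_within_Icc_at_right)
  qed
  then have F0: "F 0 = (LINT x|D 0 1. q0 x * \<psi> x)"
  proof (rule AE_limit_unique[OF _ Q(1) _ T])
    show "AE t in D 0 T. F t = Q t" using F(2) Q(2) unfolding P_def by eventually_elim simp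
  qed
  have iq: "AE t in D 0 T. integrable (D 0 1) (\<lambda>x. q t x * \<psi> x)" by (rule DD.AE_integrable_fst[OF i\<psi>[OF q]])
  have "AE t in D 0 T. t \<in> {0..T}" by (rule AE_D_I) auto
  with iq F(2) show ?thesis
  proof eventually_elim
    case (elim t)
    have i1: "integrable (D 0 1) (\<lambda>x. q0 x * \<psi> x)" by (rule integrable_mult_test_fun[OF q0 \<psi>])
    have i2: "integrable (D 0 1) (\<lambda>x. indef 0 T (\<lambda>s. g s x) t * \<psi> x)"
      by (rule integrable_mult_test_fun[OF indef_integral_swap(2)[OF g] \<psi>])
    have "indef 0 T G t = (LINT x|D 0 1. indef 0 T (\<lambda>s. g s x * \<psi> x) t)"
      unfolding G_def by (rule indef_integral_swap(1)[OF i\<psi>[OF g]])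
    also have "\<dots> = (LINT x|D 0 1. indef 0 T (\<lambda>s. g s x) t * \<psi> x)"
    proof (intro LINT_cong refl)
      fix x show "indef 0 T (\<lambda>s. g s x * \<psi> x) t = indef 0 T (\<lambda>s. g s x) t * \<psi> x"
        using indef_cmult[of 0 T "\<psi> x" "\<lambda>s. g s x" t] by (simp add: mult.commute)
    qed
    finally have "(LINT x|D 0 1. q t x * \<psi> x) = (LINT x|D 0 1. q0 x * \<psi> x) + (LINT x|D 0 1. indef 0 T (\<lambda>s. g s x) t * \<psi> x)"
      using prim_eq[OF F(1) elim(3)] elim(2) F0 by (simp add: P_def)
    then show ?case using elim(1) i1 i2 by (simp add: left_diff_distrib distrib_right)
  qed
qed

text \<open>The exceptional set of times in \<open>evolution_weak\<close> depends on \<psi>.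
  Restricting to countably many bumps yields one null set outside of which the fundamental lemma in
  \<open>x\<close> applies.\<close>

lemma evolution:
  fixes q g :: "real \<Rightarrow> real \<Rightarrow> real"
  assumes T: "T > 0"
    and q: "integrable (cyl T) (case_prod q)"
    and g: "integrable (cyl T) (case_prod g)"
    and eq: "\<And>\<theta> \<psi>. test_fun 0 T \<theta> \<Longrightarrow> test_fun 0 1 \<psi> \<Longrightarrow>
      (LINT (t, x)|(cyl T). q t x * (deriv \<theta> t * \<psi> x))
        = - (LINT (t, x)|(cyl T). g t x * (\<theta> t * \<psi> x))"
    and q0: "integrable (D 0 1) q0"
    and Q: "\<And>\<psi>. test_fun 0 1 \<psi> \<Longrightarrow> \<exists>Q. (Q \<longlongrightarrow> (LINT x|D 0 1. q0 x * \<psi> x)) (at_right 0) \<and>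
      (AE t in D 0 T. Q t = (LINT x|D 0 1. q t x * \<psi> x))"
  shows "AE t in D 0 T. AE x in D 0 1. q t x = q0 x + indef 0 T (\<lambda>s. g s x) t"
proof -
  let ?r = "\<lambda>t x. q t x - (q0 x + indef 0 T (\<lambda>s. g s x) t)"
  have 1: "AE t in D 0 T. 0 < c \<and> c < d \<and> d < 1 \<longrightarrow> (LINT x|D 0 1. ?r t x * bump c d n x) = 0" for c d n
  proof (cases "0 < c \<and> c < d \<and> d < 1")
    case True
    then have \<psi>: "test_fun 0 1 (bump c d n)" by (intro bump_test_fun) auto
    obtain Q where QQ: "(Q \<longlongrightarrow> (LINT x|D 0 1. q0 x * bump c d n x)) (at_right 0)"
      "AE t in D 0 T. Q t = (LINT x|D 0 1. q t x * bump c d n x)" using Q[OF \<psi>] by blast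
    have "AE t in D 0 T. (LINT x|D 0 1. ?r t x * bump c d n x) = 0"
      by (rule evolution_weak[OF T q g _ \<psi> q0 QQ]) (rule eq[OF _ \<psi>])
    then show ?thesis by eventually_elim simp
  next
    case False
    then show ?thesis by (intro AE_I2 impI) blast
  qed
  have "AE t in D 0 T. \<forall>c\<in>\<rat>. \<forall>d\<in>\<rat>. \<forall>n. 0 < c \<and> c < d \<and> d < 1 \<longrightarrow> (LINT x|D 0 1. ?r t x * bump c d n x) = 0"
    unfolding AE_ball_countable[OF countable_rat] AE_all_countable using 1 by blast
  with DD.AE_integrable_fst[OF q] show ?thesis
  proof eventually_elim
    case (elim t)
    have "AE x in D 0 1. ?r t x = 0"
      by (rule fundamental_lemma) (use elim q0 indef_integral_swap(2)[OF g] in auto)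
    then show ?case by eventually_elim simp
  qed
qed

text \<open>The chain rule for \<open>q\<^sup>2\<close> is applied for fixed \<open>x\<close>, where \<open>q\<close> is absolutely continuous in time.\<close>

lemma evolution_energy:
  fixes q g :: "real \<Rightarrow> real \<Rightarrow> real"
  assumes q: "case_prod q \<in> borel_measurable (cyl T)"
    and g: "integrable (cyl T) (case_prod g)"
    and qg: "integrable (cyl T) (\<lambda>(t, x). q t x * g t x)"
    and eq: "AE t in D 0 T. AE x in D 0 1. q t x = indef 0 T (\<lambda>s. g s x) t"
  shows "AE t in D 0 T. sqn (q t) = 2 * indef 0 T (\<lambda>s. \<integral>x. q s x * g s x \<partial>D 0 1) t"
proof -
  let ?m = "\<lambda>t x. indef 0 T (\<lambda>s. g s x) t"
  have mg: "case_prod g \<in> borel_measurable (cyl T)" using g by auto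
  \<comment> \<open>Exchanging the two almost everywhere quantifiers requires joint measurability of
    the set where equality holds.\<close>
  have eq': "AE x in D 0 1. AE t in D 0 T. q t x = ?m t x"
  proof (rule DD.AE_commute[THEN iffD1, OF _ eq])
    have [measurable]: "(\<lambda>z. q (fst z) (snd z)) \<in> borel_measurable (cyl T)"
      using q by (simp add: split_beta')
    note [measurable] = indef_pair_measurable[OF mg]
    show "{z \<in> space (cyl T). q (fst z) (snd z) = ?m (fst z) (snd z)} \<in> sets (cyl T)"
      by measurable
  qed
  \<comment> \<open>The exceptional set of \<open>x\<close> is independent of \<open>t\<close>:
    \<open>?m\<close> is an indefinite integral for every \<open>t\<close>, and replacing it by
    \<open>q\<close> under the time integral costs only a null set of times.\<close>
  have sq: "AE x in D 0 1. \<forall>t. (?m t x)\<^sup>2 = 2 * indef 0 T (\<lambda>s. q s x * g s x) t"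
    using eq' DD.AE_integrable_snd[OF g] DD.AE_integrable_snd[OF qg]
  proof eventually_elim
    case (elim x)
    have mm: "(\<lambda>t. ?m t x) \<in> borel_measurable (D 0 T)"
      by (rule continuous_on_measurable_D[OF indef_continuous[OF elim(2)]])
    have mgx: "(\<lambda>t. g t x) \<in> borel_measurable (D 0 T)" using elim(2) by auto
    show ?case
    proof
      fix t
      have "indef 0 T (\<lambda>s. ?m s x * g s x) t = indef 0 T (\<lambda>s. q s x * g s x) t"
      proof (rule indef_cong_AE)
        show "AE s in D 0 T. ?m s x * g s x = q s x * g s x" using elim(1) by eventually_elim simp
        show "(\<lambda>s. ?m s x * g s x) \<in> borel_measurable (D 0 T)" using mm mgx by measurable
      qed (use elim(3) in auto)
      moreover have "indef 0 T (\<lambda>s. g s x * ?m s x) t = indef 0 T (\<lambda>s. ?m s x * g s x) t"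
        by (simp add: mult.commute)
      ultimately show "(?m t x)\<^sup>2 = 2 * indef 0 T (\<lambda>s. q s x * g s x) t"
        using indef_mult[OF elim(2) elim(2), of t] by (simp add: power2_eq_square)
    qed
  qed
  have "AE t in D 0 T. (\<lambda>x. q t x) \<in> borel_measurable (D 0 1)"
    by (rule AE_I2, rule measurable_compose[OF measurable_Pair1' q, simplified]) simp
  with eq show ?thesis
  proof eventually_elim
    case (elim t)
    have mt: "(\<lambda>x. ?m t x) \<in> borel_measurable (D 0 1)" using indef_integral_swap(2)[OF g] by auto
    have i: "(\<lambda>x. indef 0 T (\<lambda>s. q s x * g s x) t) \<in> borel_measurable (D 0 1)"
      using indef_integral_swap(2)[OF qg] by auto
    have "sqn (q t) = (LINT x|D 0 1. 2 * indef 0 T (\<lambda>s. q s x * g s x) t)"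
    proof (rule integral_cong_AE)
      show "AE x in D 0 1. (q t x)\<^sup>2 = 2 * indef 0 T (\<lambda>s. q s x * g s x) t"
        using elim(1) sq by eventually_elim simp
    qed (use elim(2) i in measurable)
    also have "\<dots> = 2 * indef 0 T (\<lambda>s. \<integral>x. q s x * g s x \<partial>D 0 1) t"
      using indef_integral_swap(1)[OF qg] by simp
    finally show ?case .
  qed
qed

subsection \<open>Gronwall's inequality\<close>

lemma indef_diff:
  assumes g: "integrable (D a b) g" and "s \<le> t"
  shows "indef a b g t - indef a b g s = (LINT y|D a b. (if s \<le> y \<and> y < t then g y else 0))"
    and "integrable (D a b) (\<lambda>y. if s \<le> y \<and> y < t then g y else 0)"
proof -
  have eq: "(\<lambda>y. if s \<le> y \<and> y < t then g y else 0) = (\<lambda>y. (if y < t then g y else 0) - (if y < s then g y else 0))"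
    using assms(2) by (auto simp: fun_eq_iff)
  show "indef a b g t - indef a b g s = (LINT y|D a b. (if s \<le> y \<and> y < t then g y else 0))"
    unfolding eq indef_def using integrable_cut[OF g] by simp
  show "integrable (D a b) (\<lambda>y. if s \<le> y \<and> y < t then g y else 0)"
    unfolding eq using integrable_cut[OF g] by simp
qed

lemma indef_mono:
  assumes g: "integrable (D a b) g" and "s \<le> t" "AE y in D a b. 0 \<le> g y"
  shows "indef a b g s \<le> indef a b g t"
proof -
  have "0 \<le> (LINT y|D a b. (if s \<le> y \<and> y < t then g y else 0))"
    by (rule integral_nonneg_AE) (use assms(3) in eventually_elim, simp)
  then show ?thesis using indef_diff(1)[OF g assms(2)] by simp
qed

text \<open>With \<open>a\<close> merely integrable and \<open>y\<close> known almost everywhere,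
  the argument works with the continuous nondecreasing integral \<open>Y\<close>. If its last zero
  \<open>t0\<close> came before \<open>T\<close>, then on a short interval after \<open>t0\<close>
  the integral of \<open>a\<close> would be at most 1/2, forcing \<open>Y\<close> to vanish beyond
  \<open>t0\<close>.\<close>

lemma Gronwall_zero:
  assumes T: "T > 0" and a: "integrable (D 0 T) a" "AE t in D 0 T. 0 \<le> a t"
    and ay: "integrable (D 0 T) (\<lambda>t. a t * y t)"
    and y: "AE t in D 0 T. 0 \<le> y t \<and> y t \<le> indef 0 T (\<lambda>s. a s * y s) t"
  shows "AE t in D 0 T. y t = 0"
proof -
  define Y where "Y = indef 0 T (\<lambda>s. a s * y s)"
  have nn: "AE t in D 0 T. 0 \<le> a t * y t" using a(2) y by eventually_elim simp
  have Y0: "Y 0 = 0" by (simp add: Y_def indef_start)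
  have mono: "Y s \<le> Y t" if "s \<le> t" for s t unfolding Y_def by (rule indef_mono[OF ay that nn])
  have contY: "continuous_on {0..T} Y" unfolding Y_def by (rule indef_continuous[OF ay])
  define S where "S = {t \<in> {0..T}. Y t = 0}"
  have S: "closed S" "S \<noteq> {}" "bdd_above S"
  proof -
    show "closed S" unfolding S_def
      using continuous_closed_preimage_constant[OF contY, of 0] by simp
    have "0 \<in> S" using T Y0 by (simp add: S_def)
    then show "S \<noteq> {}" by blast
    show "bdd_above S" unfolding S_def by (rule bdd_aboveI[of _ T]) simp
  qed
  define t0 where "t0 = Sup S"
  have t0: "t0 \<in> S" unfolding t0_def by (rule closed_contains_Sup[OF S(2,3,1)])
  have "t0 = T"
  proof (rule ccontr)
    assume "t0 \<noteq> T"
    with t0 have lt: "0 \<le> t0" "t0 < T" "Y t0 = 0" by (auto simp: S_def)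
    have "isCont (indef 0 T a) t0"
      using indef_continuous[OF a(1), of UNIV] by (simp add: continuous_on_eq_continuous_at)
    then obtain d where d: "d > 0" "\<And>t. \<bar>t - t0\<bar> < d \<Longrightarrow> \<bar>indef 0 T a t - indef 0 T a t0\<bar> < 1/2"
      unfolding continuous_at_eps_delta dist_real_def by (metis half_gt_zero zero_less_one)
    \<comment> \<open>Half of \<open>d\<close> keeps \<open>t1\<close> strictly within the range
      where the integral of \<open>a\<close> from \<open>t0\<close> stays below 1/2; this leads to
      \<open>Y t1 \<le> Y t1 * (1/2)\<close>.\<close>
    define t1 where "t1 = min T (t0 + d / 2)"
    have t1: "t0 < t1" "t1 \<le> T" "\<bar>t1 - t0\<bar> < d" using d(1) lt by (auto simp: t1_def min_def)
    have "Y t1 = Y t1 - Y t0" using lt by simp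
    also have "\<dots> = (LINT s|D 0 T. (if t0 \<le> s \<and> s < t1 then a s * y s else 0))"
      unfolding Y_def by (rule indef_diff[OF ay]) (use t1 in simp)
    also have "\<dots> \<le> (LINT s|D 0 T. Y t1 * (if t0 \<le> s \<and> s < t1 then a s else 0))"
    proof (rule integral_mono_AE)
      show "integrable (D 0 T) (\<lambda>s. if t0 \<le> s \<and> s < t1 then a s * y s else 0)"
        by (rule indef_diff[OF ay]) (use t1 in simp)
      have "integrable (D 0 T) (\<lambda>s. if t0 \<le> s \<and> s < t1 then a s else 0)"
        by (rule indef_diff[OF a(1)]) (use t1 in simp)
      then show "integrable (D 0 T) (\<lambda>s. Y t1 * (if t0 \<le> s \<and> s < t1 then a s else 0))" by simp
      show "AE s in D 0 T. (if t0 \<le> s \<and> s < t1 then a s * y s else 0) \<le> Y t1 * (if t0 \<le> s \<and> s < t1 then a s else 0)"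
        using a(2) y
      proof eventually_elim
        case (elim s)
        show ?case
        proof (cases "t0 \<le> s \<and> s < t1")
          case True
          then have "y s \<le> Y t1" using elim(2) mono[of s t1] unfolding Y_def by simp
          then have "a s * y s \<le> a s * Y t1" using elim(1) by (rule mult_left_mono)
          with True show ?thesis by (simp add: mult.commute)
        next
          case False
          then show ?thesis by auto
        qed
      qed
    qed
    also have "\<dots> = Y t1 * (indef 0 T a t1 - indef 0 T a t0)"
      using indef_diff(1)[OF a(1), of t0 t1] t1 by simp
    also have "\<dots> \<le> Y t1 * (1/2)"
    proof (rule mult_left_mono)
      show "indef 0 T a t1 - indef 0 T a t0 \<le> 1/2" using d(2)[OF t1(3)] by linarith
      show "0 \<le> Y t1" using mono[of t0 t1] t1 lt by simp
    qed
    finally have "Y t1 \<le> 0" by simp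
    moreover have "0 \<le> Y t1" using mono[of t0 t1] t1 lt by simp
    ultimately have "t1 \<in> S" using t1 lt by (simp add: S_def)
    then have "t1 \<le> t0" unfolding t0_def by (rule cSup_upper[OF _ S(3)])
    with t1 show False by simp
  qed
  then have "Y T = 0" using t0 by (simp add: S_def)
  have "AE t in D 0 T. t \<le> T" by (rule AE_D_I) simp
  with y show ?thesis
  proof eventually_elim
    case (elim t)
    then have "y t \<le> Y T" using mono[of t T] unfolding Y_def by simp
    with elim \<open>Y T = 0\<close> show ?case by simp
  qed
qed

subsection \<open>One space dimension\<close>

lemma measure_D [simp]: "a \<le> b \<Longrightarrow> measure (D a b) {a<..<b} = b - a"
  unfolding D_def by (subst measure_restrict_space) auto

lemma sqi_abs: "sqi M f \<Longrightarrow> sqi M (\<lambda>x. \<bar>f x\<bar>)"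
  by (auto simp: sqi_def)

lemma integral_abs_le_L2:
  assumes "sqi (D 0 1) g" shows "(LINT x|D 0 1. \<bar>g x\<bar>) \<le> nrm g"
  using sqi_Cauchy_Schwarz[OF sqi_abs[OF assms] D.sqi_const[of 0 1 1]] by simp

text \<open>The embedding of H1 into bounded functions, with constant 1: \<open>F x\<close> differs
  from any \<open>F y\<close> by at most the integral of the absolute value of \<open>g\<close>, and
  averaging over \<open>y\<close> in an interval of length 1 costs no factor.\<close>

lemma prim_sup_bound:
  assumes F: "prim 0 1 F g" and g: "sqi (D 0 1) g" and x: "x \<in> {0..1}"
  shows "\<bar>F x\<bar> \<le> nrm F + nrm g"
proof -
  note ig = prim_integrable[OF F]
  have sF: "sqi (D 0 1) F" by (rule sqi_continuous[OF prim_continuous[OF F]])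
  have iF: "integrable (D 0 1) (\<lambda>y. \<bar>F y\<bar>)" using prim_integrable_self[OF F] by simp
  have le: "\<bar>F x\<bar> \<le> \<bar>F y\<bar> + (LINT z|D 0 1. \<bar>g z\<bar>)" if y: "y \<in> {0..1}" for y
  proof -
    have "\<bar>indef 0 1 g s - indef 0 1 g t\<bar> \<le> (LINT z|D 0 1. \<bar>g z\<bar>)" if "t \<le> s" for s t
    proof -
      have "\<bar>indef 0 1 g s - indef 0 1 g t\<bar> \<le> (LINT z|D 0 1. \<bar>if t \<le> z \<and> z < s then g z else 0\<bar>)"
        unfolding indef_diff(1)[OF ig that] by (rule integral_abs_bound)
      also have "\<dots> \<le> (LINT z|D 0 1. \<bar>g z\<bar>)"
        using indef_diff(2)[OF ig that] ig by (intro integral_mono) auto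
      finally show ?thesis .
    qed
    from this[of x y] this[of y x] have "\<bar>indef 0 1 g x - indef 0 1 g y\<bar> \<le> (LINT z|D 0 1. \<bar>g z\<bar>)"
      by (cases "x \<le> y") (auto simp: abs_minus_commute)
    then show ?thesis using prim_eq[OF F x] prim_eq[OF F y] by linarith
  qed
  have "(LINT y|D 0 1. \<bar>F x\<bar>) \<le> (LINT y|D 0 1. \<bar>F y\<bar> + (LINT z|D 0 1. \<bar>g z\<bar>))"
    by (rule integral_mono) (use iF le in auto)
  then have "\<bar>F x\<bar> \<le> (LINT y|D 0 1. \<bar>F y\<bar>) + (LINT z|D 0 1. \<bar>g z\<bar>)" using iF by simp
  then show ?thesis using integral_abs_le_L2[OF sF] integral_abs_le_L2[OF g] by linarith
qed

lemma sqi_weak_deriv_prim: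
  assumes "weak_deriv 0 1 f g" "sqi (D 0 1) f" "sqi (D 0 1) g"
  obtains F where "prim 0 1 F g" "AE x in D 0 1. f x = F x"
    "\<forall>x\<in>{0..1}. \<bar>F x\<bar> \<le> nrm f + nrm g"
proof -
  obtain F where F: "prim 0 1 F g" "AE x in D 0 1. f x = F x"
    using weak_deriv_prim[OF assms(1) D.sqi_integrable[OF assms(2)] D.sqi_integrable[OF assms(3)]] by auto
  have "sqn F = sqn f"
  proof (rule integral_cong_AE)
    show "AE x in D 0 1. (F x)\<^sup>2 = (f x)\<^sup>2" using F(2) by eventually_elim simp
  qed (use sqi_measurable[OF assms(2)] continuous_on_measurable_D[OF prim_continuous[OF F(1)]] in measurable)
  with prim_sup_bound[OF F(1) assms(3)]
  have "\<forall>x\<in>{0..1}. \<bar>F x\<bar> \<le> nrm f + nrm g" by simp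
  with F show thesis by (rule that)
qed

lemma weak_deriv_mult:
  assumes f: "weak_deriv 0 1 f f'" "sqi (D 0 1) f" "sqi (D 0 1) f'"
    and g: "weak_deriv 0 1 g g'" "sqi (D 0 1) g" "sqi (D 0 1) g'"
  shows "weak_deriv 0 1 (\<lambda>x. f x * g x) (\<lambda>x. f' x * g x + f x * g' x)"
proof -
  obtain F where F: "prim 0 1 F f'" "AE x in D 0 1. f x = F x" by (rule sqi_weak_deriv_prim[OF f])
  obtain G where G: "prim 0 1 G g'" "AE x in D 0 1. g x = G x" by (rule sqi_weak_deriv_prim[OF g])
  note FG = prim_mult[OF F(1) G(1)]
  show ?thesis
  proof (rule weak_deriv_cong_AE[OF prim_weak_deriv[OF FG]])
    show "AE x in D 0 1. F x * G x = f x * g x" using F(2) G(2) by eventually_elim simp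
    show "AE x in D 0 1. F x * g' x + f' x * G x = f' x * g x + f x * g' x"
      using F(2) G(2) by eventually_elim simp
  qed (use sqi_mult[OF f(2) g(2)] sqi_mult[OF f(3) g(2)] sqi_mult[OF f(2) g(3)]
      prim_integrable[OF FG] prim_integrable_self[OF FG] in auto)
qed

lemma weak_deriv_lincomb:
  assumes f: "weak_deriv a b f f'" "integrable (D a b) f" "integrable (D a b) f'"
    and g: "weak_deriv a b g g'" "integrable (D a b) g" "integrable (D a b) g'"
  shows "weak_deriv a b (\<lambda>x. f x + c * g x) (\<lambda>x. f' x + c * g' x)"
proof (rule weak_derivI)
  show "integrable (D a b) (\<lambda>x. f x + c * g x)" "integrable (D a b) (\<lambda>x. f' x + c * g' x)"
    using f g by auto
  fix \<phi> assume \<phi>: "test_fun a b \<phi>"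
  note i = integrable_mult_test_fun[OF _ \<phi>] and i' = integrable_mult_test_fun[OF _ test_fun_deriv[OF \<phi>]]
  have "(LINT x|D a b. (f x + c * g x) * deriv \<phi> x) = (LINT x|D a b. f x * deriv \<phi> x + c * (g x * deriv \<phi> x))"
    by (simp add: algebra_simps)
  also have "\<dots> = - (LINT x|D a b. f' x * \<phi> x) + c * - (LINT x|D a b. g' x * \<phi> x)"
    using i'[OF f(2)] i'[OF g(2)] weak_deriv_eq[OF f(1) \<phi>] weak_deriv_eq[OF g(1) \<phi>] by simp
  also have "\<dots> = - (LINT x|D a b. f' x * \<phi> x + c * (g' x * \<phi> x))"
    using i[OF f(3)] i[OF g(3)] by simp
  also have "\<dots> = - (LINT x|D a b. (f' x + c * g' x) * \<phi> x)"
    by (simp add: algebra_simps)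
  finally show "(LINT x|D a b. (f x + c * g x) * deriv \<phi> x) = - (LINT x|D a b. (f' x + c * g' x) * \<phi> x)" .
qed

subsection \<open>The cylinder\<close>

lemma finite_measure_D_pair: "finite_measure (rect a b c d)"
  by (rule finite_measure_pair_measure) (rule finite_measure_D)+

interpretation DP: finite_measure "rect a b c d" for a b c d by (rule finite_measure_D_pair)

lemma slice_measurable:
  assumes "case_prod f \<in> borel_measurable (rect a b c d)" "t \<in> {a<..<b}"
  shows "f t \<in> borel_measurable (D c d)"
proof -
  have "t \<in> space (D a b)" using assms(2) by simp
  from measurable_compose[OF measurable_Pair1'[OF this] assms(1)] show ?thesis by simp
qed

lemma AE_pairI:
  assumes "AE t in D a b. AE x in D c d. P t x"
    and "Measurable.pred (rect a b c d) (\<lambda>z. P (fst z) (snd z))"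
  shows "AE z in rect a b c d. P (fst z) (snd z)"
  using assms by (intro DD.AE_pair_measure) (simp_all add: pred_def)

lemma sqi_slices:
  assumes "sqi (rect a b c d) (case_prod f)"
  shows "AE t in D a b. sqi (D c d) (f t)" "integrable (D a b) (\<lambda>t. \<integral>x. (f t x)\<^sup>2 \<partial>D c d)"
proof -
  have i: "integrable (rect a b c d) (\<lambda>(t, x). (f t x)\<^sup>2)"
    using assms by (simp add: sqi_def split_beta')
  have "AE t in D a b. t \<in> {a<..<b}" by (rule AE_D_I)
  with DD.AE_integrable_fst[OF i] show "AE t in D a b. sqi (D c d) (f t)"
  proof eventually_elim
    case (elim t)
    have "f t \<in> borel_measurable (D c d)"
      by (rule slice_measurable[OF sqi_measurable[OF assms] elim(2)])
    with elim(1) show ?case by (simp add: sqi_def)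
  qed
  show "integrable (D a b) (\<lambda>t. \<integral>x. (f t x)\<^sup>2 \<partial>D c d)" by (rule DD.integrable_fst[OF i])
qed

text \<open>A bound on the L2 norm of the slices that is uniform in time compensates for a weight
  that is only integrable in time. The weights in view are those that control suprema of
  \<open>u\<close> and \<open>ux\<close>.\<close>

lemma integrable_weight:
  fixes f :: "real \<Rightarrow> real \<Rightarrow> real"
  assumes f: "case_prod f \<in> borel_measurable (rect a b c d)"
    and K: "AE t in D a b. sqi (D c d) (f t) \<and> (LINT x|D c d. (f t x)\<^sup>2) \<le> K"
    and w: "integrable (D a b) w"
  shows "integrable (rect a b c d) (\<lambda>(t, x). w t * (f t x)\<^sup>2)"
proof (rule DD.Fubini_integrable)
  have f': "(\<lambda>z. f (fst z) (snd z)) \<in> borel_measurable (rect a b c d)" using f by (simp add: split_beta')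
  have w': "(\<lambda>z. w (fst z)) \<in> borel_measurable (rect a b c d)"
    using w by (intro measurable_compose[OF measurable_fst]) auto
  have "(\<lambda>z. w (fst z) * (f (fst z) (snd z))\<^sup>2) \<in> borel_measurable (rect a b c d)"
    using f' w' by measurable
  then show m: "(\<lambda>(t, x). w t * (f t x)\<^sup>2) \<in> borel_measurable (rect a b c d)" by (simp add: split_beta')
  show "AE t in D a b. integrable (D c d) (\<lambda>x. case (t, x) of (t, x) \<Rightarrow> w t * (f t x)\<^sup>2)"
    using K by eventually_elim (simp add: sqi_def)
  show "integrable (D a b) (\<lambda>t. \<integral>x. norm (case (t, x) of (t, x) \<Rightarrow> w t * (f t x)\<^sup>2) \<partial>D c d)"
  proof (rule integrable_dominated)
    show "integrable (D a b) (\<lambda>t. K * w t)" using w by simp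
    have "(\<lambda>z. norm (case z of (t, x) \<Rightarrow> w t * (f t x)\<^sup>2)) \<in> borel_measurable (rect a b c d)"
      using m by measurable
    then have "(\<lambda>(t, x). norm (w t * (f t x)\<^sup>2)) \<in> borel_measurable (rect a b c d)"
      by (simp add: split_beta')
    from D.borel_measurable_lebesgue_integral[OF this]
    show "(\<lambda>t. \<integral>x. norm (case (t, x) of (t, x) \<Rightarrow> w t * (f t x)\<^sup>2) \<partial>D c d) \<in> borel_measurable (D a b)"
      by simp
    show "AE t in D a b. norm (LINT x|D c d. norm (case (t, x) of (t, x) \<Rightarrow> w t * (f t x)\<^sup>2)) \<le> norm (K * w t)"
      using K
    proof eventually_elim
      case (elim t)
      have nn: "0 \<le> (LINT x|D c d. (f t x)\<^sup>2)" by simp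
      have "(LINT x|D c d. norm (w t * (f t x)\<^sup>2)) = \<bar>w t\<bar> * (LINT x|D c d. (f t x)\<^sup>2)"
        by (simp add: abs_mult)
      also have "\<dots> \<le> \<bar>w t\<bar> * K" using elim by (intro mult_left_mono) simp_all
      also have "\<dots> \<le> \<bar>K * w t\<bar>"
        using mult_left_mono[OF abs_ge_self[of K] abs_ge_zero[of "w t"]] by (simp add: abs_mult mult.commute)
      finally show ?case by simp
    qed
  qed
qed

lemma sqi_pairI:
  assumes f: "case_prod f \<in> borel_measurable (rect a b c d)"
    and K: "AE t in D a b. sqi (D c d) (f t) \<and> (LINT x|D c d. (f t x)\<^sup>2) \<le> K"
  shows "sqi (rect a b c d) (case_prod f)"
  using integrable_weight[OF f K, of "\<lambda>_. 1"] f by (simp add: sqi_def split_beta')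

lemma weak_deriv_cylinder:
  fixes f k :: "real \<Rightarrow> real \<Rightarrow> real"
  assumes f: "integrable (cyl T) (case_prod f)" and k: "integrable (cyl T) (case_prod k)"
    and fk: "AE t in D 0 T. weak_deriv 0 1 (f t) (k t)"
    and \<theta>: "test_fun 0 T \<theta>" and \<psi>: "test_fun 0 1 \<psi>"
  shows "(LINT (t, x)|(cyl T). f t x * (\<theta> t * deriv \<psi> x))
    = - (LINT (t, x)|(cyl T). k t x * (\<theta> t * \<psi> x))"
proof -
  have fub: "(LINT t|D 0 T. \<theta> t * (LINT x|D 0 1. p t x * \<phi> x)) = (LINT (t, x)|(cyl T). p t x * (\<theta> t * \<phi> x))"
    "(\<lambda>t. \<theta> t * (LINT x|D 0 1. p t x * \<phi> x)) \<in> borel_measurable (D 0 T)"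
    if p: "integrable (cyl T) (case_prod p)" and \<phi>: "test_fun 0 1 \<phi>" for p :: "real \<Rightarrow> real \<Rightarrow> real" and \<phi>
  proof -
    obtain K where K: "\<And>x. \<bar>\<theta> x\<bar> \<le> K" using test_fun_bounded[OF \<theta>] by blast
    obtain L where L: "\<And>x. \<bar>\<phi> x\<bar> \<le> L" using test_fun_bounded[OF \<phi>] by blast
    note i = integrable_pair_mult_bounded[OF p test_fun_measurable[OF \<theta>] K test_fun_measurable[OF \<phi>] L]
    have eq: "\<theta> t * (LINT x|D 0 1. p t x * \<phi> x) = (LINT x|D 0 1. p t x * (\<theta> t * \<phi> x))" for t
      unfolding integral_mult_right_zero[symmetric] by (simp add: ac_simps)
    show "(LINT t|D 0 T. \<theta> t * (LINT x|D 0 1. p t x * \<phi> x)) = (LINT (t, x)|(cyl T). p t x * (\<theta> t * \<phi> x))"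
      unfolding eq by (rule DD.integral_fst[OF i])
    show "(\<lambda>t. \<theta> t * (LINT x|D 0 1. p t x * \<phi> x)) \<in> borel_measurable (D 0 T)"
      unfolding eq by (rule borel_measurable_integrable[OF DD.integrable_fst[OF i]])
  qed
  have "(LINT t|D 0 T. \<theta> t * (LINT x|D 0 1. f t x * deriv \<psi> x)) = (LINT t|D 0 T. - (\<theta> t * (LINT x|D 0 1. k t x * \<psi> x)))"
  proof (rule integral_cong_AE)
    show "AE t in D 0 T. \<theta> t * (LINT x|D 0 1. f t x * deriv \<psi> x) = - (\<theta> t * (LINT x|D 0 1. k t x * \<psi> x))"
      using fk by eventually_elim (simp add: weak_deriv_eq[OF _ \<psi>])
  qed (use fub(2)[OF f test_fun_deriv[OF \<psi>]] fub(2)[OF k \<psi>] in auto)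
  then show ?thesis
    unfolding fub(1)[OF f test_fun_deriv[OF \<psi>], symmetric] fub(1)[OF k \<psi>, symmetric] by simp
qed

subsection \<open>Traces in time\<close>

abbreviation trace_rep where
  "trace_rep T w s g W \<equiv> W s = g \<and> (\<forall>t\<in>{0..T}. sqi (D 0 1) (W t)) \<and>
    (\<forall>t\<in>{0..T}. ((\<lambda>\<tau>. nrm (\<lambda>x. W \<tau> x - W t x)) \<longlongrightarrow> 0) (at t within {0..T})) \<and>
    (AE t in D 0 T. AE x in D 0 1. W t x = w t x)"

lemma time_value_limit:
  assumes "time_value T w s g"
  shows "\<exists>W. trace_rep T w s g W"
proof -
  obtain W where W: "(\<forall>t\<in>{0..T}. sqi (D 0 1) (W t) \<and>
        ((\<lambda>\<tau>. nrm (\<lambda>x. W \<tau> x - W t x)) \<longlongrightarrow> 0) (at t within {0..T})) \<and>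
     (AE t in D 0 T. AE x in D 0 1. W t x = w t x) \<and> W s = g"
    using assms unfolding time_value_def L2_on_iff L2_norm_on_eq AE_D_iff by (elim exE)
  show ?thesis by (rule exI[of _ W]) (use W in simp)
qed

lemma L2_norm_diff_le:
  assumes "sqi (D a b) f" "sqi (D a b) g"
  shows "sqrt (LINT x|D a b. (f x)\<^sup>2) \<le> sqrt (LINT x|D a b. (f x - g x)\<^sup>2) + sqrt (LINT x|D a b. (g x)\<^sup>2)"
  using sqi_triangle[OF sqi_diff[OF assms] assms(2)] by simp

text \<open>The uniform bound comes from the continuous representative supplied by
  \<open>time_value\<close>: its norm is continuous on the compact time interval, and it agrees with
  \<open>w\<close> on almost every slice. This provides the constant \<open>K\<close> for the
  velocity.\<close>

lemma time_value_bounded: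
  assumes tv: "time_value T w s g" and m: "\<And>t. t \<in> {0<..<T} \<Longrightarrow> w t \<in> borel_measurable (D 0 1)"
  obtains K where "AE t in D 0 T. sqi (D 0 1) (w t) \<and> sqn (w t) \<le> K"
proof -
  obtain W where W0: "trace_rep T w s g W"
    using time_value_limit[OF tv] by (elim exE)
  have W: "\<And>t. t \<in> {0..T} \<Longrightarrow> sqi (D 0 1) (W t)"
    "\<And>t. t \<in> {0..T} \<Longrightarrow> ((\<lambda>\<tau>. nrm (\<lambda>x. W \<tau> x - W t x)) \<longlongrightarrow> 0) (at t within {0..T})"
    "AE t in D 0 T. AE x in D 0 1. W t x = w t x"
    using W0 by simp_all
  define N where "N t = nrm (W t)" for t
  have "continuous_on {0..T} N"
    unfolding continuous_on_def
  proof
    fix t assume t: "t \<in> {0..T}"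
    have "((\<lambda>\<tau>. N \<tau> - N t) \<longlongrightarrow> 0) (at t within {0..T})"
    proof (rule Lim_null_comparison[OF _ W(2)[OF t]])
      have "\<bar>N \<tau> - N t\<bar> \<le> nrm (\<lambda>x. W \<tau> x - W t x)" if "\<tau> \<in> {0..T}" for \<tau>
        using L2_norm_diff_le[OF W(1)[OF that] W(1)[OF t]] L2_norm_diff_le[OF W(1)[OF t] W(1)[OF that]]
        unfolding N_def power2_commute[of "W t _"] by linarith
      then show "\<forall>\<^sub>F \<tau> in at t within {0..T}. norm (N \<tau> - N t) \<le> nrm (\<lambda>x. W \<tau> x - W t x)"
        by (simp add: eventually_at_filter)
    qed
    then show "(N \<longlongrightarrow> N t) (at t within {0..T})" by (simp add: LIM_zero_iff)
  qed
  then obtain K where K: "\<And>t. t \<in> {0..T} \<Longrightarrow> \<bar>N t\<bar> \<le> K" "K \<ge> 0" using continuous_on_Icc_bounded by blast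
  have "AE t in D 0 T. t \<in> {0<..<T}" by (rule AE_D_I)
  with W(3) have "AE t in D 0 T. sqi (D 0 1) (w t) \<and> sqn (w t) \<le> K\<^sup>2"
  proof eventually_elim
    case (elim t)
    then have t: "t \<in> {0..T}" by simp
    note mW = sqi_measurable[OF W(1)[OF t]] and mw = m[OF elim(2)]
    have ae: "AE x in D 0 1. (W t x)\<^sup>2 = (w t x)\<^sup>2" using elim(1) by eventually_elim simp
    have eq: "sqn (w t) = sqn (W t)"
    proof (rule integral_cong_AE[symmetric])
      show "AE x in D 0 1. (W t x)\<^sup>2 = (w t x)\<^sup>2" by (rule ae)
    qed (use mW mw in measurable)
    have i: "integrable (D 0 1) (\<lambda>x. (w t x)\<^sup>2)"
      using W(1)[OF t] mw by (subst integrable_cong_AE[OF _ _ ae, symmetric]) (auto simp: sqi_def)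
    have "\<bar>N t\<bar>\<^sup>2 \<le> K\<^sup>2" by (rule power_mono[OF K(1)[OF t]]) simp
    then have "sqn (w t) \<le> K\<^sup>2" by (simp add: eq N_def)
    with i show ?case using mw by (simp add: sqi_def)
  qed
  then show thesis by (rule that)
qed

subsection \<open>The effective momentum\<close>

text \<open>Testing with tensor products suffices, because \<open>evolution\<close> freezes the
  space factor and treats the time factor as a test function of one variable.\<close>

definition pairing ::
  "real \<Rightarrow> (real \<Rightarrow> real \<Rightarrow> real) \<Rightarrow> (real \<Rightarrow> real) \<Rightarrow> (real \<Rightarrow> real) \<Rightarrow> real" where
  "pairing T q \<theta> \<psi> = (LINT (t, x)|(cyl T). q t x * (\<theta> t * \<psi> x))"

lemma integrable_pairing:
  fixes q :: "real \<Rightarrow> real \<Rightarrow> real"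
  assumes "integrable (cyl T) (case_prod q)" "test_fun 0 T \<theta>" "test_fun 0 1 \<psi>"
  shows "integrable (cyl T) (\<lambda>(t, x). q t x * (\<theta> t * \<psi> x))"
proof -
  obtain K where K: "\<And>x. \<bar>\<theta> x\<bar> \<le> K" using test_fun_bounded[OF assms(2)] by blast
  obtain L where L: "\<And>x. \<bar>\<psi> x\<bar> \<le> L" using test_fun_bounded[OF assms(3)] by blast
  show ?thesis
    by (rule integrable_pair_mult_bounded[OF assms(1) test_fun_measurable[OF assms(2)] K
          test_fun_measurable[OF assms(3)] L])
qed

lemma pairing_lincomb:
  assumes q: "integrable (cyl T) (case_prod q)" and g: "integrable (cyl T) (case_prod g)"
    and \<theta>: "test_fun 0 T \<theta>" and \<psi>: "test_fun 0 1 \<psi>"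
  shows "pairing T (\<lambda>t x. q t x + c * g t x) \<theta> \<psi> = pairing T q \<theta> \<psi> + c * pairing T g \<theta> \<psi>"
proof -
  have "pairing T (\<lambda>t x. q t x + c * g t x) \<theta> \<psi>
    = (LINT z|(cyl T). (case z of (t, x) \<Rightarrow> q t x * (\<theta> t * \<psi> x)) + c * (case z of (t, x) \<Rightarrow> g t x * (\<theta> t * \<psi> x)))"
    unfolding pairing_def by (rule LINT_cong) (auto simp: algebra_simps)
  also have "\<dots> = pairing T q \<theta> \<psi> + c * pairing T g \<theta> \<psi>"
    unfolding pairing_def using integrable_pairing[OF q \<theta> \<psi>] integrable_pairing[OF g \<theta> \<psi>] by simp
  finally show ?thesis .
qed

text \<open>Regularity without the equations. The integrability facts proved here are needed to
  bring the distributional equations into the form that \<open>sw_flow\<close> assumes.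
  \<open>M\<close> and \<open>K\<close> bound squared norms.\<close>

locale sw_regular =
  fixes \<mu> Fr T :: real and h hx hxx u ux uxx :: "real \<Rightarrow> real \<Rightarrow> real" and M K :: real
  assumes mu: "\<mu> > 0" and Fr: "Fr > 0" and T: "T > 0"
    and h_meas: "case_prod h \<in> borel_measurable (cyl T)"
    and hx_meas: "case_prod hx \<in> borel_measurable (cyl T)"
    and hxx_meas: "case_prod hxx \<in> borel_measurable (cyl T)"
    and h_deriv: "AE t in D 0 T. weak_deriv 0 1 (h t) (hx t)"
    and hx_deriv: "AE t in D 0 T. weak_deriv 0 1 (hx t) (hxx t)"
    and h_bound: "AE t in D 0 T. sqi (D 0 1) (h t) \<and> sqn (h t) \<le> M"
    and hx_bound: "AE t in D 0 T. sqi (D 0 1) (hx t) \<and> sqn (hx t) \<le> M"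
    and hxx_bound: "AE t in D 0 T. sqi (D 0 1) (hxx t) \<and> sqn (hxx t) \<le> M"
    and u_sqi: "sqi (cyl T) (case_prod u)"
    and ux_sqi: "sqi (cyl T) (case_prod ux)"
    and uxx_sqi: "sqi (cyl T) (case_prod uxx)"
    and u_deriv: "AE t in D 0 T. weak_deriv 0 1 (u t) (ux t)"
    and ux_deriv: "AE t in D 0 T. weak_deriv 0 1 (ux t) (uxx t)"
    and u_bound: "AE t in D 0 T. sqi (D 0 1) (u t) \<and> sqn (u t) \<le> K"
begin

abbreviation Cyl where "Cyl \<equiv> cyl T"

definition hu where "hu t x = h t x * u t x"
definition hux where "hux t x = hx t x * u t x + h t x * ux t x"
definition m where "m t x = hu t x + \<mu> * hx t x"
definition mx where "mx t x = hux t x + \<mu> * hxx t x"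
definition p where "p t x = ux t x * m t x + u t x * mx t x"

lemma z_sqi:
  "sqi Cyl (\<lambda>z. h (fst z) (snd z))" "sqi Cyl (\<lambda>z. hx (fst z) (snd z))" "sqi Cyl (\<lambda>z. hxx (fst z) (snd z))"
  "sqi Cyl (\<lambda>z. u (fst z) (snd z))" "sqi Cyl (\<lambda>z. ux (fst z) (snd z))"
  using sqi_pairI[OF h_meas h_bound] sqi_pairI[OF hx_meas hx_bound] sqi_pairI[OF hxx_meas hxx_bound] u_sqi ux_sqi
  by (simp_all add: split_beta')

text \<open>The embedding on almost every slice, for \<open>h\<close> with derivative
  \<open>hx\<close> and for \<open>hx\<close> with derivative \<open>hxx\<close>. The factor 2
  counts the two L2 norms in \<open>prim_sup_bound\<close>, each at most
  \<open>sqrt M\<close>.\<close>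

lemma sup_h:
  "AE z in Cyl. \<bar>h (fst z) (snd z)\<bar> \<le> 2 * sqrt M" "AE z in Cyl. \<bar>hx (fst z) (snd z)\<bar> \<le> 2 * sqrt M"
proof -
  have s: "AE t in D 0 T. AE x in D 0 1. \<bar>f t x\<bar> \<le> 2 * sqrt M"
    if "AE t in D 0 T. weak_deriv 0 1 (f t) (g t)"
      "AE t in D 0 T. sqi (D 0 1) (f t) \<and> sqn (f t) \<le> M"
      "AE t in D 0 T. sqi (D 0 1) (g t) \<and> sqn (g t) \<le> M" for f g
    using that
  proof eventually_elim
    case (elim t)
    obtain F where "prim 0 1 F (g t)" and F: "AE x in D 0 1. f t x = F x"
      "\<forall>x\<in>{0..1}. \<bar>F x\<bar> \<le> nrm (f t) + nrm (g t)"
      by (rule sqi_weak_deriv_prim[OF elim(1) conjunct1[OF elim(2)] conjunct1[OF elim(3)]])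
    have le: "nrm (f t) \<le> sqrt M" "nrm (g t) \<le> sqrt M"
      using elim by simp_all
    have "AE x in D 0 1. x \<in> {0..1}" by (rule AE_D_I) simp
    with F(1) show ?case
    proof eventually_elim
      case (elim x)
      show ?case unfolding elim(1) using F(2)[rule_format, OF elim(2)] le by linarith
    qed
  qed
  have mz: "(\<lambda>z. h (fst z) (snd z)) \<in> borel_measurable Cyl" "(\<lambda>z. hx (fst z) (snd z)) \<in> borel_measurable Cyl"
    using z_sqi(1,2) by (auto simp: sqi_def)
  note [measurable] = mz
  show "AE z in Cyl. \<bar>h (fst z) (snd z)\<bar> \<le> 2 * sqrt M"
    by (rule AE_pairI[OF s[OF h_deriv h_bound hx_bound]]) measurable
  show "AE z in Cyl. \<bar>hx (fst z) (snd z)\<bar> \<le> 2 * sqrt M"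
    by (rule AE_pairI[OF s[OF hx_deriv hx_bound hxx_bound]]) measurable
qed

lemma z_sqi2:
  "sqi Cyl (\<lambda>z. hu (fst z) (snd z))" "sqi Cyl (\<lambda>z. hux (fst z) (snd z))"
  "sqi Cyl (\<lambda>z. m (fst z) (snd z))" "sqi Cyl (\<lambda>z. mx (fst z) (snd z))"
proof -
  note b = sqi_bounded[OF _ sqi_measurable[OF z_sqi(1)] sup_h(1)]
    and bx = sqi_bounded[OF _ sqi_measurable[OF z_sqi(2)] sup_h(2)]
  show 1: "sqi Cyl (\<lambda>z. hu (fst z) (snd z))" using b[OF z_sqi(4)] by (simp add: hu_def mult.commute)
  show 2: "sqi Cyl (\<lambda>z. hux (fst z) (snd z))"
    using sqi_add[OF bx[OF z_sqi(4)] b[OF z_sqi(5)]] by (simp add: hux_def mult.commute)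
  show "sqi Cyl (\<lambda>z. m (fst z) (snd z))" using sqi_add[OF 1 sqi_cmult[OF z_sqi(2)]] by (simp add: m_def)
  show "sqi Cyl (\<lambda>z. mx (fst z) (snd z))" using sqi_add[OF 2 sqi_cmult[OF z_sqi(3)]] by (simp add: mx_def)
qed

lemma c_sqi: "sqi Cyl (case_prod hu)" "sqi Cyl (case_prod hux)" "sqi Cyl (case_prod m)" "sqi Cyl (case_prod mx)"
  "sqi Cyl (case_prod h)" "sqi Cyl (case_prod hx)"
  using z_sqi z_sqi2 by (simp_all add: split_beta')

lemmas c_int = c_sqi[THEN DP.sqi_integrable]

lemma um_int: "integrable Cyl (\<lambda>(t, x). u t x * m t x)"
  using sqi_mult[OF z_sqi(4) z_sqi2(3)] by (simp add: split_beta')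

lemma p_int: "integrable Cyl (case_prod p)"
  using Bochner_Integration.integrable_add[OF sqi_mult[OF z_sqi(5) z_sqi2(3)] sqi_mult[OF z_sqi(4) z_sqi2(4)]]
  by (simp add: split_beta' p_def)

lemma slices:
  "AE t in D 0 T. sqi (D 0 1) (hu t) \<and> sqi (D 0 1) (hux t) \<and> sqi (D 0 1) (m t) \<and> sqi (D 0 1) (mx t) \<and>
    sqi (D 0 1) (u t) \<and> sqi (D 0 1) (ux t) \<and> sqi (D 0 1) (uxx t) \<and>
    sqi (D 0 1) (h t) \<and> sqi (D 0 1) (hx t) \<and> sqi (D 0 1) (hxx t) \<and>
    weak_deriv 0 1 (h t) (hx t) \<and> weak_deriv 0 1 (hx t) (hxx t) \<and>
    weak_deriv 0 1 (u t) (ux t) \<and> weak_deriv 0 1 (ux t) (uxx t)"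
  using c_sqi(1-4)[THEN sqi_slices(1)] h_bound hx_bound hxx_bound
    u_sqi[THEN sqi_slices(1)] ux_sqi[THEN sqi_slices(1)] uxx_sqi[THEN sqi_slices(1)]
    h_deriv hx_deriv u_deriv ux_deriv
  by eventually_elim simp

lemma product_derivs:
  "AE t in D 0 T. weak_deriv 0 1 (hu t) (hux t) \<and> weak_deriv 0 1 (m t) (mx t) \<and>
    weak_deriv 0 1 (\<lambda>x. u t x * m t x) (p t)"
  using slices
proof eventually_elim
  case (elim t)
  have s: "sqi (D 0 1) (hu t)" "sqi (D 0 1) (hux t)" "sqi (D 0 1) (m t)" "sqi (D 0 1) (mx t)"
    "sqi (D 0 1) (u t)" "sqi (D 0 1) (ux t)" "sqi (D 0 1) (h t)" "sqi (D 0 1) (hx t)" "sqi (D 0 1) (hxx t)"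
    and d: "weak_deriv 0 1 (h t) (hx t)" "weak_deriv 0 1 (hx t) (hxx t)" "weak_deriv 0 1 (u t) (ux t)"
    using elim by simp_all
  have 1: "weak_deriv 0 1 (hu t) (hux t)"
    using weak_deriv_mult[OF d(1) s(7,8) d(3) s(5,6)] by (simp add: hu_def[abs_def] hux_def[abs_def])
  have 2: "weak_deriv 0 1 (m t) (mx t)"
    using weak_deriv_lincomb[OF 1 D.sqi_integrable[OF s(1)] D.sqi_integrable[OF s(2)]
       d(2) D.sqi_integrable[OF s(8)] D.sqi_integrable[OF s(9)], of \<mu>]
    by (simp add: m_def[abs_def] mx_def[abs_def])
  have 3: "weak_deriv 0 1 (\<lambda>x. u t x * m t x) (p t)"
    using weak_deriv_mult[OF d(3) s(5,6) 2 s(3,4)] by (simp add: p_def[abs_def])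
  from 1 2 3 show ?case by blast
qed

lemma momentum_flux_int:
  "integrable Cyl (\<lambda>(t, x). h t x * (u t x)\<^sup>2 - \<mu> * h t x * ux t x + h t x / Fr\<^sup>2)"
proof -
  have "integrable Cyl (\<lambda>z. hu (fst z) (snd z) * u (fst z) (snd z) - \<mu> * (h (fst z) (snd z) * ux (fst z) (snd z)) + h (fst z) (snd z) / Fr\<^sup>2)"
    using sqi_mult[OF z_sqi2(1) z_sqi(4)] sqi_mult[OF z_sqi(1) z_sqi(5)] DP.sqi_integrable[OF z_sqi(1)] by simp
  then show ?thesis by (simp add: split_beta' hu_def power2_eq_square ac_simps)
qed

end

text \<open>The initial data, height 1 and velocity 0, enter through the limits of spatial moments
  at time 0, the form in which \<open>evolution\<close> consumes them. The inflow condition is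
  phrased with \<open>hx\<close> in place of the chosen \<open>weak_der\<close>.\<close>

locale sw_flow = sw_regular \<mu> Fr T h hx hxx u ux uxx M K
  for \<mu> Fr T h hx hxx u ux uxx M K +
  fixes r :: real and v1 v2 :: "real \<Rightarrow> real"
  assumes r: "r = 1 / (\<mu> * Fr\<^sup>2)"
    and mass: "\<And>\<theta> \<psi>. test_fun 0 T \<theta> \<Longrightarrow> test_fun 0 1 \<psi> \<Longrightarrow>
      pairing T h (deriv \<theta>) \<psi> + pairing T (\<lambda>t x. h t x * u t x) \<theta> (deriv \<psi>) = 0"
    and momentum: "\<And>\<theta> \<psi>. test_fun 0 T \<theta> \<Longrightarrow> test_fun 0 1 \<psi> \<Longrightarrow>
      pairing T (\<lambda>t x. h t x * u t x) (deriv \<theta>) \<psi>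
      + pairing T (\<lambda>t x. h t x * (u t x)\<^sup>2 - \<mu> * h t x * ux t x + h t x / Fr\<^sup>2) \<theta> (deriv \<psi>)
      - r * pairing T (\<lambda>t x. h t x * u t x) \<theta> \<psi> = 0"
    and traces: "AE t in D 0 T. point_value 0 1 (u t) 0 (v1 t) \<and> point_value 0 1 (u t) 1 (v2 t)"
    and inflow: "AE t in D 0 T. (v1 t > 0 \<longrightarrow> point_value 0 1 (\<lambda>x. h t x * u t x + \<mu> * hx t x) 0 0) \<and>
      (v2 t < 0 \<longrightarrow> point_value 0 1 (\<lambda>x. h t x * u t x + \<mu> * hx t x) 1 0)"
    and init_h: "\<And>\<psi>. test_fun 0 1 \<psi> \<Longrightarrow> \<exists>Q. (Q \<longlongrightarrow> (LINT x|D 0 1. \<psi> x)) (at_right 0) \<and>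
      (AE t in D 0 T. Q t = (LINT x|D 0 1. h t x * \<psi> x))"
    and init_hu: "\<And>\<psi>. test_fun 0 1 \<psi> \<Longrightarrow> \<exists>Q. (Q \<longlongrightarrow> 0) (at_right 0) \<and>
      (AE t in D 0 T. Q t = (LINT x|D 0 1. h t x * u t x * \<psi> x))"
begin

text \<open>\<mu> times the x-derivative of the mass equation is added to the momentum equation.
  Weakly this means testing mass with \<open>deriv \<psi>\<close> and integrating by parts in
  \<open>x\<close>. The special value of \<open>r\<close> makes the pressure gradient
  \<open>h_x / Fr^2\<close> equal to \<open>r \<mu> h_x\<close>, which completes the friction
  \<open>r h u\<close> to \<open>r m\<close>.\<close>

lemma effective_momentum_equation:
  assumes \<theta>: "test_fun 0 T \<theta>" and \<psi>: "test_fun 0 1 \<psi>"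
  shows "pairing T m (deriv \<theta>) \<psi> = pairing T (\<lambda>t x. p t x + r * m t x) \<theta> \<psi>"
proof -
  note \<theta>' = test_fun_deriv[OF \<theta>] and \<psi>' = test_fun_deriv[OF \<psi>]
  have dhu: "AE t in D 0 T. weak_deriv 0 1 (hu t) (hux t)"
    and dum: "AE t in D 0 T. weak_deriv 0 1 (\<lambda>x. u t x * m t x) (p t)"
    using product_derivs by (eventually_elim, simp)+
  have "pairing T h (deriv \<theta>) (deriv \<psi>) + pairing T hu \<theta> (deriv (deriv \<psi>)) = 0"
    using mass[OF \<theta> \<psi>'] by (simp add: hu_def[abs_def])
  moreover have "pairing T h (deriv \<theta>) (deriv \<psi>) = - pairing T hx (deriv \<theta>) \<psi>"
    unfolding pairing_def by (rule weak_deriv_cylinder[OF c_int(5,6) h_deriv \<theta>' \<psi>])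
  moreover have "pairing T hu \<theta> (deriv (deriv \<psi>)) = - pairing T hux \<theta> (deriv \<psi>)"
    unfolding pairing_def by (rule weak_deriv_cylinder[OF c_int(1,2) dhu \<theta> \<psi>'])
  ultimately have a: "pairing T hux \<theta> (deriv \<psi>) = - pairing T hx (deriv \<theta>) \<psi>" by simp
  let ?F = "\<lambda>t x. h t x * (u t x)\<^sup>2 - \<mu> * h t x * ux t x + h t x / Fr\<^sup>2"
  note iF = momentum_flux_int
  \<comment> \<open>The viscous flux \<open>- \<mu> h u_x\<close> cancels one of the two terms of
    \<open>\<mu> (h u)_x\<close>; what remains is \<open>u m\<close> and the pressure.\<close>
  have "(\<lambda>t x. ?F t x + \<mu> * hux t x) = (\<lambda>t x. u t x * m t x + (1 / Fr\<^sup>2) * h t x)"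
    by (simp add: fun_eq_iff m_def hu_def hux_def power2_eq_square algebra_simps)
  then have b: "pairing T ?F \<theta> (deriv \<psi>) + \<mu> * pairing T hux \<theta> (deriv \<psi>)
    = pairing T (\<lambda>t x. u t x * m t x) \<theta> (deriv \<psi>) + (1 / Fr\<^sup>2) * pairing T h \<theta> (deriv \<psi>)"
    using pairing_lincomb[OF iF c_int(2) \<theta> \<psi>', of \<mu>] pairing_lincomb[OF um_int c_int(5) \<theta> \<psi>', of "1 / Fr\<^sup>2"]
    by (simp only:)
  have c: "pairing T (\<lambda>t x. u t x * m t x) \<theta> (deriv \<psi>) = - pairing T p \<theta> \<psi>"
    unfolding pairing_def by (rule weak_deriv_cylinder[OF um_int p_int dum \<theta> \<psi>])
  have d: "pairing T h \<theta> (deriv \<psi>) = - pairing T hx \<theta> \<psi>"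
    unfolding pairing_def by (rule weak_deriv_cylinder[OF c_int(5,6) h_deriv \<theta> \<psi>])
  have mom: "pairing T hu (deriv \<theta>) \<psi> + pairing T ?F \<theta> (deriv \<psi>) - r * pairing T hu \<theta> \<psi> = 0"
    using momentum[OF \<theta> \<psi>] by (simp add: hu_def[abs_def])
  have rmu: "1 / Fr\<^sup>2 = r * \<mu>" using mu r by simp
  have m1: "pairing T m (deriv \<theta>) \<psi> = pairing T hu (deriv \<theta>) \<psi> + \<mu> * pairing T hx (deriv \<theta>) \<psi>"
    using pairing_lincomb[OF c_int(1,6) \<theta>' \<psi>, of \<mu>] by (simp add: m_def[abs_def])
  have m2: "pairing T m \<theta> \<psi> = pairing T hu \<theta> \<psi> + \<mu> * pairing T hx \<theta> \<psi>"
    using pairing_lincomb[OF c_int(1,6) \<theta> \<psi>, of \<mu>] by (simp add: m_def[abs_def])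
  have "pairing T ?F \<theta> (deriv \<psi>) = \<mu> * pairing T hx (deriv \<theta>) \<psi> - pairing T p \<theta> \<psi> - r * \<mu> * pairing T hx \<theta> \<psi>"
    using b unfolding a c d rmu by simp
  then have "pairing T m (deriv \<theta>) \<psi> = pairing T p \<theta> \<psi> + r * pairing T m \<theta> \<psi>"
    using mom unfolding m1 m2 by (simp add: algebra_simps)
  then show ?thesis using pairing_lincomb[OF p_int c_int(3) \<theta> \<psi>, of r] by simp
qed

lemma effective_momentum_evolution:
  "AE t in D 0 T. AE x in D 0 1. m t x = indef 0 T (\<lambda>s. - (p s x + r * m s x)) t"
proof -
  have g: "integrable Cyl (\<lambda>(t, x). - (p t x + r * m t x))"
    using p_int c_int(3) by (simp add: split_beta')
  have "AE t in D 0 T. AE x in D 0 1. m t x = 0 + indef 0 T (\<lambda>s. - (p s x + r * m s x)) t"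
  proof (rule evolution[OF T c_int(3) g])
    fix \<theta> \<psi> assume t: "test_fun 0 T \<theta>" "test_fun 0 1 \<psi>"
    have "(LINT (t, x)|Cyl. - (p t x + r * m t x) * (\<theta> t * \<psi> x)) = - pairing T (\<lambda>t x. p t x + r * m t x) \<theta> \<psi>"
      unfolding pairing_def Bochner_Integration.integral_minus[symmetric]
      by (rule LINT_cong) (auto simp: algebra_simps)
    then show "(LINT (t, x)|Cyl. m t x * (deriv \<theta> t * \<psi> x)) = - (LINT (t, x)|Cyl. - (p t x + r * m t x) * (\<theta> t * \<psi> x))"
      using effective_momentum_equation[OF t] by (simp add: pairing_def)
  next
    fix \<psi> assume \<psi>: "test_fun 0 1 \<psi>"
    note \<psi>' = test_fun_deriv[OF \<psi>]
    obtain Q where Q: "(Q \<longlongrightarrow> 0) (at_right 0)" "AE t in D 0 T. Q t = (LINT x|D 0 1. h t x * u t x * \<psi> x)"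
      using init_hu[OF \<psi>] by blast
    obtain R where R: "(R \<longlongrightarrow> (LINT x|D 0 1. deriv \<psi> x)) (at_right 0)" "AE t in D 0 T. R t = (LINT x|D 0 1. h t x * deriv \<psi> x)"
      using init_h[OF \<psi>'] by blast
    \<comment> \<open>\<open>hx\<close> against \<psi> is minus \<open>h\<close> against
      \<open>deriv \<psi>\<close>. As the height starts at the constant 1, the limit is the integral
      of \<open>deriv \<psi>\<close>.\<close>
    have "(LINT x|D 0 1. deriv \<psi> x) = 0"
      using prim_diff_eq[OF prim_test_fun[OF \<psi>, of 0 1]] test_fun_endpoints[OF \<psi>] by simp
    then have "((\<lambda>t. Q t - \<mu> * R t) \<longlongrightarrow> 0 - \<mu> * 0) (at_right 0)" using Q(1) R(1) by (intro tendsto_intros) simp_all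
    then have "((\<lambda>t. Q t - \<mu> * R t) \<longlongrightarrow> (LINT x|D 0 1. 0 * \<psi> x)) (at_right 0)" by simp
    moreover have "AE t in D 0 T. Q t - \<mu> * R t = (LINT x|D 0 1. m t x * \<psi> x)"
      using Q(2) R(2) slices
    proof eventually_elim
      case (elim t)
      have i: "integrable (D 0 1) (\<lambda>x. hu t x * \<psi> x)" "integrable (D 0 1) (\<lambda>x. hx t x * \<psi> x)"
        using elim(3) by (auto intro!: integrable_mult_test_fun[OF D.sqi_integrable \<psi>])
      have "(LINT x|D 0 1. m t x * \<psi> x) = (LINT x|D 0 1. hu t x * \<psi> x + \<mu> * (hx t x * \<psi> x))"
        by (simp add: m_def algebra_simps)
      also have "\<dots> = (LINT x|D 0 1. hu t x * \<psi> x) + \<mu> * (LINT x|D 0 1. hx t x * \<psi> x)" using i by simp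
      also have "(LINT x|D 0 1. hx t x * \<psi> x) = - R t"
        using weak_deriv_eq[OF _ \<psi>, of "h t" "hx t"] elim by simp
      finally show ?case using elim(1) by (simp add: hu_def)
    qed
    ultimately show "\<exists>Q. (Q \<longlongrightarrow> (LINT x|D 0 1. 0 * \<psi> x)) (at_right 0) \<and> (AE t in D 0 T. Q t = (LINT x|D 0 1. m t x * \<psi> x))"
      by (intro exI[of _ "\<lambda>t. Q t - \<mu> * R t"] conjI)
  qed simp
  then show ?thesis by simp
qed

section \<open>Energy estimate for the effective momentum\<close>

definition A where "A t = 1 + sqn (ux t) + sqn (uxx t)"
definition U where "U t = 2 * (sqn (u t) + sqn (ux t))"

lemma AU_int: "integrable (D 0 T) A" "integrable (D 0 T) U"
  using u_sqi[THEN sqi_slices(2)] ux_sqi[THEN sqi_slices(2)] uxx_sqi[THEN sqi_slices(2)]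
  unfolding A_def[abs_def] U_def[abs_def]
  by (intro integrable_mult_right Bochner_Integration.integrable_add; simp)+

lemma A_nonneg: "0 \<le> A t"
proof -
  have "0 \<le> sqn (ux t)" "0 \<le> sqn (uxx t)" by simp_all
  then show ?thesis unfolding A_def by linarith
qed

text \<open>\<open>A\<close> and \<open>U\<close> are majorants integrable in time, obtained from
  the embedding in \<open>x\<close>. The summand 1 in \<open>A\<close> stems from
  \<open>sqrt y \<le> (1 + y) / 2\<close>, which trades norms for squared norms; the factor 2 in
  \<open>U\<close> stems from squaring a sum of two norms.\<close>

lemma sup_u: "AE t in D 0 T. AE x in D 0 1. (u t x)\<^sup>2 \<le> U t \<and> \<bar>ux t x\<bar> \<le> A t"
  using slices
proof eventually_elim
  case (elim t)
  have s: "sqi (D 0 1) (u t)" "sqi (D 0 1) (ux t)" "sqi (D 0 1) (uxx t)" and d: "weak_deriv 0 1 (u t) (ux t)" "weak_deriv 0 1 (ux t) (uxx t)"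
    using elim by simp_all
  define i0 i1 i2 where "i0 = sqn (u t)" "i1 = sqn (ux t)" "i2 = sqn (uxx t)"
  have nn: "0 \<le> i0" "0 \<le> i1" "0 \<le> i2" by (simp_all add: i0_i1_i2_def)
  obtain F where "prim 0 1 F (ux t)" and F: "AE x in D 0 1. u t x = F x" "\<forall>x\<in>{0..1}. \<bar>F x\<bar> \<le> sqrt i0 + sqrt i1"
    unfolding i0_i1_i2_def by (rule sqi_weak_deriv_prim[OF d(1) s(1,2)])
  obtain G where "prim 0 1 G (uxx t)" and G: "AE x in D 0 1. ux t x = G x" "\<forall>x\<in>{0..1}. \<bar>G x\<bar> \<le> sqrt i1 + sqrt i2"
    unfolding i0_i1_i2_def by (rule sqi_weak_deriv_prim[OF d(2) s(2,3)])
  have s1: "sqrt y \<le> (1 + y) / 2" if "0 \<le> y" for y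
  proof -
    have "0 \<le> (sqrt y - 1)\<^sup>2" by simp
    then show ?thesis using that by (simp add: power2_diff)
  qed
  have s2: "(sqrt i0 + sqrt i1)\<^sup>2 \<le> 2 * (i0 + i1)"
  proof -
    have "0 \<le> (sqrt i0 - sqrt i1)\<^sup>2" by simp
    then show ?thesis using nn by (simp add: power2_diff power2_sum)
  qed
  have "AE x in D 0 1. x \<in> {0..1}" by (rule AE_D_I) simp
  with F(1) G(1) show ?case
  proof eventually_elim
    case (elim x)
    have "\<bar>u t x\<bar>\<^sup>2 \<le> (sqrt i0 + sqrt i1)\<^sup>2" using F(2)[rule_format, OF elim(3)] elim(1) by (intro power_mono) simp_all
    then have "(u t x)\<^sup>2 \<le> U t" using s2 unfolding U_def i0_i1_i2_def[symmetric] by simp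
    moreover have "\<bar>ux t x\<bar> \<le> A t"
    proof -
      have "\<bar>ux t x\<bar> \<le> sqrt i1 + sqrt i2" unfolding elim(2) by (rule G(2)[rule_format, OF elim(3)])
      also have "\<dots> \<le> (1 + i1) / 2 + (1 + i2) / 2" by (rule add_mono[OF s1[OF nn(2)] s1[OF nn(3)]])
      also have "\<dots> \<le> 1 + i1 + i2" using nn(2,3) by (simp add: field_simps)
      finally show ?thesis by (simp add: A_def i0_i1_i2_def)
    qed
    ultimately show ?case ..
  qed
qed

text \<open>\<open>h\<close> is bounded, and \<open>u\<close> and \<open>hx\<close> are bounded in
  L2 uniformly in time. The result makes \<open>A\<close> and \<open>U\<close> times the square of
  \<open>m\<close> integrable over the cylinder.\<close>

lemma m_bound: "\<exists>N. AE t in D 0 T. sqi (D 0 1) (m t) \<and> sqn (m t) \<le> N"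
proof -
  have "AE t in D 0 T. \<bar>nrm (m t)\<bar> \<le> 2 * sqrt M * sqrt K + \<mu> * sqrt M"
    using slices u_bound h_bound hx_bound
  proof eventually_elim
    case (elim t)
    have s: "sqi (D 0 1) (h t)" "sqi (D 0 1) (hx t)" "sqi (D 0 1) (hu t)" "sqi (D 0 1) (u t)"
      and d: "weak_deriv 0 1 (h t) (hx t)" using elim(1) by simp_all
    have M: "nrm (h t) \<le> sqrt M" "nrm (hx t) \<le> sqrt M" using elim by simp_all
    have "0 \<le> sqn (h t)" by simp
    then have M0: "0 \<le> M" using elim(3) by linarith
    obtain F where "prim 0 1 F (hx t)" and F: "AE x in D 0 1. h t x = F x"
      "\<forall>x\<in>{0..1}. \<bar>F x\<bar> \<le> nrm (h t) + nrm (hx t)"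
      by (rule sqi_weak_deriv_prim[OF d s(1,2)])
    have "sqn (hu t) \<le> (LINT x|D 0 1. (2 * sqrt M)\<^sup>2 * (u t x)\<^sup>2)"
    proof (rule integral_mono_AE)
      have "AE x in D 0 1. x \<in> {0..1}" by (rule AE_D_I) simp
      with F(1) show "AE x in D 0 1. (hu t x)\<^sup>2 \<le> (2 * sqrt M)\<^sup>2 * (u t x)\<^sup>2"
      proof eventually_elim
        case (elim x)
        have "\<bar>h t x\<bar> \<le> 2 * sqrt M" unfolding elim(1) using F(2)[rule_format, OF elim(2)] M by linarith
        then have "\<bar>h t x\<bar>\<^sup>2 \<le> (2 * sqrt M)\<^sup>2" by (intro power_mono) simp_all
        then show ?case unfolding hu_def power_mult_distrib[of "h t x"] by (intro mult_right_mono) simp_all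
      qed
    qed (use s(3,4) in \<open>simp_all add: sqi_def\<close>)
    also have "\<dots> = (2 * sqrt M)\<^sup>2 * sqn (u t)" by simp
    also have "\<dots> \<le> (2 * sqrt M)\<^sup>2 * K" using elim(2) by (intro mult_left_mono) simp_all
    finally have "nrm (hu t) \<le> sqrt ((2 * sqrt M)\<^sup>2 * K)" by (rule real_sqrt_le_mono)
    also have "\<dots> = 2 * sqrt M * sqrt K" using M0 by (simp add: real_sqrt_mult)
    finally have 1: "nrm (hu t) \<le> 2 * sqrt M * sqrt K" .
    have "nrm (\<lambda>x. \<mu> * hx t x) = \<mu> * nrm (hx t)"
      using mu by (simp add: power_mult_distrib real_sqrt_mult)
    also have "\<dots> \<le> \<mu> * sqrt M" using M(2) mu by (intro mult_left_mono) simp_all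
    finally have 2: "nrm (\<lambda>x. \<mu> * hx t x) \<le> \<mu> * sqrt M" .
    have "nrm (m t) \<le> nrm (hu t) + nrm (\<lambda>x. \<mu> * hx t x)"
      unfolding m_def by (rule sqi_triangle[OF s(3) sqi_cmult[OF s(2)]])
    with 1 2 show ?case by simp
  qed
  with slices have "AE t in D 0 T. sqi (D 0 1) (m t) \<and> sqn (m t) \<le> (2 * sqrt M * sqrt K + \<mu> * sqrt M)\<^sup>2"
  proof eventually_elim
    case (elim t)
    then have "(nrm (m t))\<^sup>2 \<le> (2 * sqrt M * sqrt K + \<mu> * sqrt M)\<^sup>2" by (intro power_mono) simp_all
    with elim show ?case by simp
  qed
  then show ?thesis by blast
qed

lemma weight_int: assumes "integrable (D 0 T) w" shows "integrable Cyl (\<lambda>z. w (fst z) * (m (fst z) (snd z))\<^sup>2)"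
proof -
  obtain N where N: "AE t in D 0 T. sqi (D 0 1) (m t) \<and> sqn (m t) \<le> N" using m_bound by blast
  show ?thesis using integrable_weight[OF sqi_measurable[OF c_sqi(3)] N assms] by (simp add: split_beta')
qed

text \<open>\<open>evolution_energy\<close> requires this product to be integrable, although
  integrability of each factor alone would not give it. The terms are estimated by
  \<open>|u_x| m^2 \<le> A m^2\<close> and \<open>|u m m_x| \<le> U m^2 + m_x^2\<close>.\<close>

lemma mp_int: "integrable Cyl (\<lambda>z. m (fst z) (snd z) * p (fst z) (snd z))"
proof (rule integrable_dominated)
  let ?B = "\<lambda>z. A (fst z) * (m (fst z) (snd z))\<^sup>2 + U (fst z) * (m (fst z) (snd z))\<^sup>2 + (mx (fst z) (snd z))\<^sup>2"
  show "integrable Cyl ?B"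
    using weight_int[OF AU_int(1)] weight_int[OF AU_int(2)] z_sqi2(4) by (simp add: sqi_def)
  have mm: "(\<lambda>z. u (fst z) (snd z)) \<in> borel_measurable Cyl" "(\<lambda>z. ux (fst z) (snd z)) \<in> borel_measurable Cyl"
    "(\<lambda>z. m (fst z) (snd z)) \<in> borel_measurable Cyl"
    using z_sqi(4,5) z_sqi2(3) by (auto simp: sqi_def)
  have pm: "(\<lambda>z. p (fst z) (snd z)) \<in> borel_measurable Cyl" using p_int by (auto simp: split_beta')
  have am: "(\<lambda>z. A (fst z)) \<in> borel_measurable Cyl" "(\<lambda>z. U (fst z)) \<in> borel_measurable Cyl"
    by (rule measurable_compose[OF measurable_fst], use AU_int in auto)+
  note [measurable] = mm pm am
  show "(\<lambda>z. m (fst z) (snd z) * p (fst z) (snd z)) \<in> borel_measurable Cyl" by measurable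
  have "AE z in Cyl. (u (fst z) (snd z))\<^sup>2 \<le> U (fst z) \<and> \<bar>ux (fst z) (snd z)\<bar> \<le> A (fst z)"
    by (rule AE_pairI[OF sup_u]) measurable
  then show "AE z in Cyl. norm (m (fst z) (snd z) * p (fst z) (snd z)) \<le> norm (?B z)"
  proof eventually_elim
    case (elim z)
    define a b c d where "a = m (fst z) (snd z)" "b = u (fst z) (snd z)" "c = mx (fst z) (snd z)" "d = ux (fst z) (snd z)"
    have "\<bar>d * a\<^sup>2\<bar> \<le> A (fst z) * a\<^sup>2"
      unfolding abs_mult using elim by (simp add: a_b_c_d_def mult_right_mono)
    moreover have "\<bar>(b * a) * c\<bar> \<le> U (fst z) * a\<^sup>2 + c\<^sup>2"
    proof -
      have "0 \<le> (\<bar>b * a\<bar> - \<bar>c\<bar>)\<^sup>2" by simp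
      then have "2 * (\<bar>b * a\<bar> * \<bar>c\<bar>) \<le> (b * a)\<^sup>2 + c\<^sup>2" by (simp add: power2_diff)
      moreover have "0 \<le> \<bar>b * a\<bar> * \<bar>c\<bar>" by simp
      moreover have "(b * a)\<^sup>2 \<le> U (fst z) * a\<^sup>2"
        unfolding power_mult_distrib using elim by (simp add: a_b_c_d_def mult_right_mono)
      ultimately show ?thesis unfolding abs_mult[of "b * a"] by linarith
    qed
    moreover have "a * (d * a + b * c) = d * a\<^sup>2 + (b * a) * c" by (simp add: power2_eq_square algebra_simps)
    ultimately have "\<bar>a * (d * a + b * c)\<bar> \<le> A (fst z) * a\<^sup>2 + U (fst z) * a\<^sup>2 + c\<^sup>2" by linarith
    then show ?case by (simp add: p_def a_b_c_d_def)
  qed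
qed

text \<open>The boundary term of the energy estimate has a sign because no effective momentum flows in.\<close>

lemma effective_momentum_dissipation:
  "AE t in D 0 T. - 2 * (LINT x|D 0 1. m t x * p t x) \<le> A t * sqn (m t)"
  using slices product_derivs sup_u traces inflow
proof eventually_elim
  case (elim t)
  have s: "sqi (D 0 1) (u t)" "sqi (D 0 1) (ux t)" "sqi (D 0 1) (m t)" "sqi (D 0 1) (mx t)"
    and d: "weak_deriv 0 1 (u t) (ux t)" "weak_deriv 0 1 (m t) (mx t)" using elim(1,2) by simp_all
  obtain F where F: "prim 0 1 F (ux t)" "AE x in D 0 1. u t x = F x" by (rule sqi_weak_deriv_prim[OF d(1) s(1,2)])
  obtain G where G: "prim 0 1 G (mx t)" "AE x in D 0 1. m t x = G x" by (rule sqi_weak_deriv_prim[OF d(2) s(3,4)])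
  note cF = prim_continuous[OF F(1)] and cG = prim_continuous[OF G(1)]
  note P = prim_mult[OF F(1) prim_mult[OF G(1) G(1)]]
  have F01: "F 0 = v1 t" "F 1 = v2 t"
    using point_value_unique[OF _ cF F(2)] elim(4) by auto
  have m_eq: "(\<lambda>x. h t x * u t x + \<mu> * hx t x) = m t" by (simp add: fun_eq_iff m_def hu_def)
  have G01: "v1 t > 0 \<Longrightarrow> G 0 = 0" "v2 t < 0 \<Longrightarrow> G 1 = 0"
    using point_value_unique[OF _ cG G(2)] elim(5) unfolding m_eq by auto
  have bd: "0 \<le> F 1 * (G 1 * G 1) - F 0 * (G 0 * G 0)"
  proof -
    have "0 \<le> F 1 * (G 1 * G 1)" using G01(2) F01(2) by (cases "v2 t < 0") simp_all
    moreover have "F 0 * (G 0 * G 0) \<le> 0" using G01(1) F01(1) by (cases "v1 t > 0") (simp_all add: mult_nonpos_nonneg)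
    ultimately show ?thesis by simp
  qed
  have cGG: "continuous_on {0..1} (\<lambda>x. G x * G x)" by (intro continuous_on_mult cG)
  have i1: "integrable (D 0 1) (\<lambda>x. ux t x * (G x * G x))"
    using integrable_mult_continuous[OF prim_integrable[OF F(1)] cGG] by (simp add: mult.commute)
  have "F 1 * (G 1 * G 1) - F 0 * (G 0 * G 0) = (LINT x|D 0 1. F x * (G x * mx t x + mx t x * G x) + ux t x * (G x * G x))"
    by (rule prim_diff_eq[OF P]) simp
  \<comment> \<open>Pointwise \<open>2 m p = (u m^2)_x + u_x m^2\<close>. The first term integrates
    to the boundary contribution and the second is absorbed by \<open>A\<close>.\<close>
  moreover have "(LINT x|D 0 1. F x * (G x * mx t x + mx t x * G x) + ux t x * (G x * G x))
     + (LINT x|D 0 1. ux t x * (G x * G x))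
     = (LINT x|D 0 1. 2 * (m t x * p t x))"
  proof -
    have mp: "(\<lambda>x. m t x * p t x) \<in> borel_measurable (D 0 1)"
      unfolding p_def using s[THEN sqi_measurable] by measurable
    have "(LINT x|D 0 1. F x * (G x * mx t x + mx t x * G x) + ux t x * (G x * G x)) + (LINT x|D 0 1. ux t x * (G x * G x))
      = (LINT x|D 0 1. (F x * (G x * mx t x + mx t x * G x) + ux t x * (G x * G x)) + ux t x * (G x * G x))"
      by (rule Bochner_Integration.integral_add[symmetric, OF prim_integrable[OF P] i1])
    also have "\<dots> = (LINT x|D 0 1. 2 * (m t x * p t x))"
    proof (rule integral_cong_AE)
      show "AE x in D 0 1. (F x * (G x * mx t x + mx t x * G x) + ux t x * (G x * G x)) + ux t x * (G x * G x) = 2 * (m t x * p t x)"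
        using F(2) G(2) by eventually_elim (simp add: p_def algebra_simps)
      show "(\<lambda>x. (F x * (G x * mx t x + mx t x * G x) + ux t x * (G x * G x)) + ux t x * (G x * G x)) \<in> borel_measurable (D 0 1)"
        by (rule borel_measurable_integrable[OF Bochner_Integration.integrable_add[OF prim_integrable[OF P] i1]])
    qed (use mp in measurable)
    finally show ?thesis .
  qed
  moreover have "- (LINT x|D 0 1. ux t x * (G x * G x)) \<le> A t * sqn (m t)"
  proof -
    have "- (LINT x|D 0 1. ux t x * (G x * G x)) = (LINT x|D 0 1. - (ux t x * (G x * G x)))" by simp
    also have "\<dots> \<le> (LINT x|D 0 1. A t * (m t x)\<^sup>2)"
    proof (rule integral_mono_AE)
      show "AE x in D 0 1. - (ux t x * (G x * G x)) \<le> A t * (m t x)\<^sup>2"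
        using elim(3) G(2)
      proof eventually_elim
        case (elim x)
        have "- ux t x * (G x * G x) \<le> A t * (G x * G x)" using elim(1) by (intro mult_right_mono) auto
        then show ?case using elim(2) by (simp add: power2_eq_square)
      qed
    qed (use i1 s(3) in \<open>simp_all add: sqi_def\<close>)
    also have "\<dots> = A t * sqn (m t)" by simp
    finally show ?thesis .
  qed
  ultimately show ?case using bd by simp
qed

text \<open>The energy starts from 0. Friction only decreases it since \<open>r \<ge> 0\<close>, and
  transport increases it at a rate of at most \<open>A\<close> times the energy itself, which is the
  situation of \<open>Gronwall_zero\<close>.\<close>

lemma effective_momentum_zero: "AE t in D 0 T. AE x in D 0 1. m t x = 0"
proof -
  let ?g = "\<lambda>t x. - (p t x + r * m t x)"
  have r0: "r \<ge> 0" using mu r by simp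
  have g: "integrable Cyl (case_prod ?g)" using p_int c_int(3) by (simp add: split_beta')
  have "integrable Cyl (\<lambda>z. - (m (fst z) (snd z) * p (fst z) (snd z)) - r * (m (fst z) (snd z))\<^sup>2)"
    using mp_int z_sqi2(3) by (simp add: sqi_def)
  moreover have "(\<lambda>(t, x). m t x * ?g t x)
      = (\<lambda>z. - (m (fst z) (snd z) * p (fst z) (snd z)) - r * (m (fst z) (snd z))\<^sup>2)"
    by (simp add: fun_eq_iff power2_eq_square algebra_simps)
  ultimately have mg: "integrable Cyl (\<lambda>(t, x). m t x * ?g t x)" by simp
  define y where "y t = sqn (m t)" for t
  have Ay: "integrable (D 0 T) (\<lambda>t. A t * y t)"
  proof -
    have "integrable Cyl (\<lambda>(t, x). A t * (m t x)\<^sup>2)" using weight_int[OF AU_int(1)] by (simp add: split_beta')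
    from DD.integrable_fst[OF this] show ?thesis by (simp add: y_def)
  qed
  have G: "integrable (D 0 T) (\<lambda>t. 2 * (LINT x|D 0 1. m t x * ?g t x))"
    using DD.integrable_fst[OF mg] by simp
  have mp_slice: "AE t in D 0 T. integrable (D 0 1) (\<lambda>x. m t x * p t x)"
    using DD.AE_integrable_fst[of 0 T 0 1 "\<lambda>t x. m t x * p t x"] mp_int by (simp add: split_beta')
  have le: "AE t in D 0 T. 2 * (LINT x|D 0 1. m t x * ?g t x) \<le> A t * y t"
    using mp_slice effective_momentum_dissipation slices
  proof eventually_elim
    case (elim t)
    have "(LINT x|D 0 1. m t x * ?g t x) = (LINT x|D 0 1. - (m t x * p t x) - r * (m t x)\<^sup>2)"
      by (rule LINT_cong) (simp_all add: power2_eq_square algebra_simps)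
    also have "\<dots> = - (LINT x|D 0 1. m t x * p t x) - r * y t"
      using elim(1,3) by (simp add: y_def sqi_def)
    also have "\<dots> \<le> - (LINT x|D 0 1. m t x * p t x)" using r0 by (simp add: y_def)
    finally show ?case using elim(2) by (simp add: y_def)
  qed
  have "AE t in D 0 T. y t = 2 * indef 0 T (\<lambda>s. \<integral>x. m s x * ?g s x \<partial>D 0 1) t"
    unfolding y_def by (rule evolution_energy[OF sqi_measurable[OF c_sqi(3)] g mg effective_momentum_evolution])
  then have "AE t in D 0 T. 0 \<le> y t \<and> y t \<le> indef 0 T (\<lambda>s. A s * y s) t"
  proof eventually_elim
    case (elim t)
    have "y t = indef 0 T (\<lambda>s. 2 * (LINT x|D 0 1. m s x * ?g s x)) t" using elim by (simp add: indef_cmult)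
    also have "\<dots> \<le> indef 0 T (\<lambda>s. A s * y s) t"
      unfolding indef_def
      by (rule integral_mono_AE[OF integrable_cut[OF G] integrable_cut[OF Ay]]) (use le in \<open>eventually_elim, simp\<close>)
    finally show ?case by (simp add: y_def)
  qed
  from Gronwall_zero[OF T AU_int(1) _ Ay this] A_nonneg have "AE t in D 0 T. y t = 0" by simp
  with slices show ?thesis
  proof eventually_elim
    case (elim t)
    then have "AE x in D 0 1. (m t x)\<^sup>2 = 0"
      using integral_nonneg_eq_0_iff_AE[of "D 0 1" "\<lambda>x. (m t x)\<^sup>2"] by (simp add: y_def sqi_def)
    then show ?case by eventually_elim simp
  qed
qed

end

subsection \<open>Positivity of the sine moments\<close>

text \<open>The differential inequality is available only while \<open>E\<close> is positive. Up to
  the first time \<open>s\<close> with \<open>E s \<le> 0\<close> it says that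
  \<open>exp (\<kappa> * x) * E x\<close> does not decrease, so this quantity would still be
  positive at \<open>s\<close>.\<close>

lemma linear_ode_pos:
  assumes E: "prim 0 T E B" and E0: "E 0 > 0"
    and pos: "AE t in D 0 T. E t > 0 \<longrightarrow> 0 \<le> B t + \<kappa> * E t"
    and t: "t \<in> {0..T}"
  shows "E t > 0"
proof (rule ccontr)
  assume neg: "\<not> E t > 0"
  define S where "S = {t \<in> {0..T}. E t \<in> {..0}}"
  have "closed S" unfolding S_def
    using continuous_closed_preimage[OF prim_continuous[OF E], of "{..0}"] by (simp add: vimage_def Int_def)
  moreover have "S \<noteq> {}" using t neg by (auto simp: S_def)
  moreover have bdd: "bdd_below S" unfolding S_def by (rule bdd_belowI[of _ 0]) simp
  ultimately have s: "Inf S \<in> S" by (intro closed_contains_Inf)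
  define s where "s = Inf S"
  have sS: "0 \<le> s" "s \<le> T" "E s \<le> 0" using s by (auto simp: S_def s_def)
  have before: "E y > 0" if "y \<in> {0..T}" "y < s" for y
  proof (rule ccontr)
    assume "\<not> E y > 0"
    then have "y \<in> S" using that by (simp add: S_def)
    then have "s \<le> y" unfolding s_def by (rule cInf_lower[OF _ bdd])
    with that show False by simp
  qed
  have ex: "prim 0 T (\<lambda>x. exp (\<kappa> * x)) (\<lambda>x. \<kappa> * exp (\<kappa> * x))"
    by (rule prim_of_derivative) (auto intro!: derivative_eq_intros continuous_intros)
  note X = prim_mult[OF ex E]
  have "0 \<le> indef 0 T (\<lambda>x. exp (\<kappa> * x) * B x + \<kappa> * exp (\<kappa> * x) * E x) s"
    unfolding indef_def
  proof (rule integral_nonneg_AE)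
    have "AE y in D 0 T. y \<in> {0..T}" by (rule AE_D_I) simp
    with pos show "AE y in D 0 T. 0 \<le> (if y < s then exp (\<kappa> * y) * B y + \<kappa> * exp (\<kappa> * y) * E y else 0)"
    proof eventually_elim
      case (elim y)
      show ?case
      proof (cases "y < s")
        case True
        then have "0 \<le> exp (\<kappa> * y) * (B y + \<kappa> * E y)" using elim before[OF elim(2)] by simp
        with True show ?thesis by (simp add: algebra_simps)
      qed simp
    qed
  qed
  moreover have "s \<in> {0..T}" using sS by simp
  ultimately have "exp (\<kappa> * s) * E s > 0" using prim_eq[OF X, of s] E0 by simp
  then show False using sS(3) by (simp add: zero_less_mult_iff)
qed

text \<open>The integrating factor for a first order linear equation in \<open>x\<close>. The detour
  through \<open>integral {0..x} F\<close> provides a classical derivative up to the endpoints, so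
  that the ordinary chain rule applies.\<close>

lemma exp_prim:
  assumes c: "continuous_on {0..1} F" and "c \<noteq> 0"
  shows "prim 0 1 (\<lambda>x. exp (indef 0 1 F x / c)) (\<lambda>x. exp (indef 0 1 F x / c) * (F x / c))"
proof -
  have iF: "prim 0 1 (\<lambda>x. integral {0..x} F) F"
    by (rule prim_of_derivative[OF integral_has_real_derivative c]) (rule c)
  have eq: "integral {0..x} F = indef 0 1 F x" if "x \<in> {0..1}" for x
    using prim_eq[OF iF that] by simp
  have "prim 0 1 (\<lambda>x. exp (integral {0..x} F / c)) (\<lambda>x. exp (integral {0..x} F / c) * (F x / c))"
  proof (rule prim_of_derivative)
    fix x :: real assume x: "x \<in> {0..1}"
    show "((\<lambda>x. exp (integral {0..x} F / c)) has_real_derivative exp (integral {0..x} F / c) * (F x / c)) (at x within {0..1})"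
      using integral_has_real_derivative[OF c x] assms(2) by (auto intro!: derivative_eq_intros)
  next
    have "continuous_on {0..1} (\<lambda>x. integral {0..x} F)" by (rule prim_continuous[OF iF])
    then show "continuous_on {0..1} (\<lambda>x. exp (integral {0..x} F / c) * (F x / c))"
      unfolding divide_inverse by (intro continuous_intros c)
  qed
  then have "prim 0 1 (\<lambda>x. exp (indef 0 1 F x / c)) (\<lambda>x. exp (integral {0..x} F / c) * (F x / c))"
    by (rule prim_cong) (simp add: eq)
  then show ?thesis
  proof (rule prim_cong_AE)
    show "(\<lambda>x. exp (indef 0 1 F x / c) * (F x / c)) \<in> borel_measurable (D 0 1)"
      using continuous_on_measurable_D[OF c] continuous_on_measurable_D[OF indef_continuous[OF prim_integrable[OF iF]]]
      by measurable
    show "AE x in D 0 1. exp (integral {0..x} F / c) * (F x / c) = exp (indef 0 1 F x / c) * (F x / c)"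
      by (rule AE_D_I) (simp add: eq)
  qed
qed

text \<open>The odd parity of both values of \<open>k\<close> is what counts: the cosine is 1 at the
  left end and -1 at the right end, and the mean of the sine is positive.\<close>

lemma sine_prims:
  assumes "k = 1 \<or> k = (3::real)"
  shows "prim a b (\<lambda>x. sin (k * pi * x)) (\<lambda>x. k * pi * cos (k * pi * x))"
    "prim a b (\<lambda>x. k * pi * cos (k * pi * x)) (\<lambda>x. - (k * pi)\<^sup>2 * sin (k * pi * x))"
    "sin (k * pi) = 0" "cos (k * pi) = - 1" "(LINT x|D 0 1. sin (k * pi * x)) = 2 / (k * pi)"
proof -
  show "prim a b (\<lambda>x. sin (k * pi * x)) (\<lambda>x. k * pi * cos (k * pi * x))"
    by (rule prim_of_derivative) (auto intro!: derivative_eq_intros continuous_intros)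
  show "prim a b (\<lambda>x. k * pi * cos (k * pi * x)) (\<lambda>x. - (k * pi)\<^sup>2 * sin (k * pi * x))"
    by (rule prim_of_derivative)
      (auto intro!: derivative_eq_intros continuous_intros simp: power2_eq_square)
  show s: "sin (k * pi) = 0" using assms sin_npi[of 3] by auto
  show c: "cos (k * pi) = - 1" using assms cos_npi[of 3] by auto
  have k0: "k \<noteq> 0" using assms by auto
  have "prim 0 1 (\<lambda>x. - cos (k * pi * x) / (k * pi)) (\<lambda>x. sin (k * pi * x))"
    by (rule prim_of_derivative) (use k0 in \<open>auto intro!: derivative_eq_intros continuous_intros\<close>)
  from prim_diff_eq[OF this] show "(LINT x|D 0 1. sin (k * pi * x)) = 2 / (k * pi)"
    using c assms by (auto simp: field_simps)
qed

lemma sine_pos: "x \<in> {0<..<1} \<Longrightarrow> 0 < sin (1 * pi * x)"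
  by (simp add: sin_gt_zero)

section \<open>Heat equation for the height and its sine moments\<close>

context sw_flow
begin

lemma mass_evolution: "AE t in D 0 T. AE x in D 0 1. h t x = 1 + indef 0 T (\<lambda>s. - hux s x) t"
proof (rule evolution[OF T c_int(5)])
  show g: "integrable Cyl (\<lambda>(t, x). - hux t x)" using c_int(2) by (simp add: split_beta')
  fix \<theta> \<psi> assume t: "test_fun 0 T \<theta>" "test_fun 0 1 \<psi>"
  have dhu: "AE t in D 0 T. weak_deriv 0 1 (hu t) (hux t)" using product_derivs by eventually_elim simp
  have "pairing T h (deriv \<theta>) \<psi> = - pairing T hu \<theta> (deriv \<psi>)"
    using mass[OF t] by (simp add: hu_def[abs_def])
  also have "pairing T hu \<theta> (deriv \<psi>) = - pairing T hux \<theta> \<psi>"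
    unfolding pairing_def by (rule weak_deriv_cylinder[OF c_int(1,2) dhu t])
  also have "- pairing T hux \<theta> \<psi> = (LINT (t, x)|Cyl. - hux t x * (\<theta> t * \<psi> x))"
    unfolding pairing_def Bochner_Integration.integral_minus[symmetric]
    by (rule LINT_cong) auto
  finally show "(LINT (t, x)|Cyl. h t x * (deriv \<theta> t * \<psi> x)) = - (LINT (t, x)|Cyl. - hux t x * (\<theta> t * \<psi> x))"
    by (simp add: pairing_def)
next
  fix \<psi> assume "test_fun 0 1 \<psi>"
  from init_h[OF this] show "\<exists>Q. (Q \<longlongrightarrow> (LINT x|D 0 1. 1 * \<psi> x)) (at_right 0) \<and>
      (AE t in D 0 T. Q t = (LINT x|D 0 1. h t x * \<psi> x))" by simp
qed simp

text \<open>Since \<open>m\<close> vanishes, so does its weak derivative \<open>mx\<close>. Inserted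
  into the mass equation, this yields the heat equation with diffusivity \<mu>.\<close>

lemma hux_eq: "AE t in D 0 T. AE x in D 0 1. hux t x = - \<mu> * hxx t x"
  using effective_momentum_zero slices product_derivs
proof eventually_elim
  case (elim t)
  have "weak_deriv 0 1 (\<lambda>x. 0) (mx t)"
    by (rule weak_deriv_cong_AE[of 0 1 "m t" "mx t"]) (use elim D.sqi_integrable in auto)
  moreover have "weak_deriv 0 1 (\<lambda>x. 0) (\<lambda>x. 0)" by (rule prim_weak_deriv[OF prim_const]) simp
  ultimately have "AE x in D 0 1. mx t x = 0" by (rule weak_deriv_unique)
  then show ?case by eventually_elim (simp add: mx_def)
qed

text \<open>The moment of \<open>h\<close> against the sine, given by its integrated equation so
  that it is absolutely continuous and meaningful at every time. For \<open>k\<close> equal to 1 or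
  3, \<open>2 / (k * pi)\<close> is the moment of the initial height 1, and \<open>E_eq\<close>
  identifies \<open>E k\<close> with the moment of \<open>h\<close> at almost every time.\<close>

definition E where "E k t = 2 / (k * pi) + indef 0 T (\<lambda>s. \<integral>x. - hux s x * sin (k * pi * x) \<partial>D 0 1) t"

lemma sine_int:
  assumes q: "integrable Cyl (case_prod q)" shows "integrable Cyl (\<lambda>(t, x). q t x * sin (k * pi * x))"
  using integrable_pair_mult_bounded[OF q, of "\<lambda>_. 1" 1 "\<lambda>x. sin (k * pi * x)" 1] by simp

lemma E_prim: "prim 0 T (E k) (\<lambda>s. \<integral>x. - hux s x * sin (k * pi * x) \<partial>D 0 1)"
  unfolding E_def[abs_def]
proof (rule prim_indef, rule DD.integrable_fst)
  have "integrable Cyl (\<lambda>(t, x). - hux t x)" using c_int(2) by (simp add: split_beta')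
  from sine_int[OF this] show "integrable Cyl (\<lambda>(s, x). - hux s x * sin (k * pi * x))" .
qed

lemma E_eq: assumes k: "k = 1 \<or> k = (3::real)"
  shows "AE t in D 0 T. E k t = (LINT x|D 0 1. h t x * sin (k * pi * x))"
  using mass_evolution slices
proof eventually_elim
  case (elim t)
  have g: "integrable Cyl (\<lambda>(t, x). - hux t x)" using c_int(2) by (simp add: split_beta')
  note gS = sine_int[OF g, of k]
  have cont: "continuous_on {0..1} (\<lambda>x. sin (k * pi * x))" by (intro continuous_intros)
  note ms = continuous_on_measurable_D[OF cont]
  have i1: "integrable (D 0 1) (\<lambda>x. sin (k * pi * x))" by (rule D.sqi_integrable[OF sqi_continuous[OF cont]])
  have eq: "indef 0 T (\<lambda>s. - hux s x * sin (k * pi * x)) t = indef 0 T (\<lambda>s. - hux s x) t * sin (k * pi * x)" for x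
    using indef_cmult[of 0 T "sin (k * pi * x)" "\<lambda>s. - hux s x" t] by (simp add: mult.commute)
  have i2: "integrable (D 0 1) (\<lambda>x. indef 0 T (\<lambda>s. - hux s x) t * sin (k * pi * x))"
    using indef_integral_swap(2)[OF gS, of t] unfolding eq .
  have "(LINT x|D 0 1. h t x * sin (k * pi * x))
    = (LINT x|D 0 1. sin (k * pi * x) + indef 0 T (\<lambda>s. - hux s x) t * sin (k * pi * x))"
  proof (rule integral_cong_AE)
    show "AE x in D 0 1. h t x * sin (k * pi * x) = sin (k * pi * x) + indef 0 T (\<lambda>s. - hux s x) t * sin (k * pi * x)"
      using elim(1) by eventually_elim (simp only: distrib_right mult_1_left)
    show "(\<lambda>x. h t x * sin (k * pi * x)) \<in> borel_measurable (D 0 1)"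
      using elim(2) ms by (intro borel_measurable_times) (auto simp: sqi_def)
  qed (use i1 i2 in auto)
  also have "\<dots> = 2 / (k * pi) + (LINT x|D 0 1. indef 0 T (\<lambda>s. - hux s x) t * sin (k * pi * x))"
    using i1 i2 sine_prims(5)[OF k] by simp
  also have "\<dots> = E k t"
    unfolding E_def indef_integral_swap(1)[OF gS] eq ..
  finally show ?case ..
qed

text \<open>Without effective momentum \<open>h\<close> solves a linear equation in \<open>x\<close> and so has one sign at each time.\<close>

lemma profile:
  "AE t in D 0 T. \<exists>F. prim 0 1 F (hx t) \<and> (AE x in D 0 1. h t x = F x) \<and>
    (\<forall>x\<in>{0..1}. F x = F 0 * exp (- indef 0 1 (u t) x / \<mu>))"
  using effective_momentum_zero slices
proof eventually_elim
  case (elim t)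
  have s: "sqi (D 0 1) (h t)" "sqi (D 0 1) (hx t)" "sqi (D 0 1) (u t)" "sqi (D 0 1) (ux t)"
    and d: "weak_deriv 0 1 (h t) (hx t)" "weak_deriv 0 1 (u t) (ux t)" using elim(2) by simp_all
  obtain F where F: "prim 0 1 F (hx t)" "AE x in D 0 1. h t x = F x" by (rule sqi_weak_deriv_prim[OF d(1) s(1,2)])
  obtain V where V: "prim 0 1 V (ux t)" "AE x in D 0 1. u t x = V x" by (rule sqi_weak_deriv_prim[OF d(2) s(3,4)])
  note cV = prim_continuous[OF V(1)]
  have uV: "indef 0 1 (u t) x = indef 0 1 V x" for x
    by (rule indef_cong_AE[OF V(2) sqi_measurable[OF s(3)] continuous_on_measurable_D[OF cV]])
  \<comment> \<open>Integrating factor: with \<open>m = 0\<close> one has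
    \<open>\<mu> h_x = - u h\<close>, so that \<open>h\<close> times \<open>?e\<close> is constant
    in \<open>x\<close>.\<close>
  let ?e = "\<lambda>x. exp (indef 0 1 V x / \<mu>)"
  have "prim 0 1 (\<lambda>x. F x * ?e x) (\<lambda>x. 0)"
  proof (rule prim_cong_AE[OF prim_mult[OF F(1) exp_prim[OF cV less_imp_neq[OF mu, symmetric]]]])
    show "AE x in D 0 1. F x * (?e x * (V x / \<mu>)) + hx t x * ?e x = 0"
      using F(2) V(2) elim(1)
    proof eventually_elim
      case (elim x)
      then have "F x * V x + \<mu> * hx t x = 0" by (simp add: m_def hu_def)
      then have "F x * V x / \<mu> + hx t x = 0" using mu by (simp add: field_simps)
      then have "?e x * (F x * V x / \<mu> + hx t x) = 0" by simp
      then show ?case by (simp add: algebra_simps)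
    qed
  qed simp
  moreover have "indef 0 1 (\<lambda>x. 0) x = 0" for x :: real by (simp add: indef_def)
  ultimately have const: "F x * ?e x = F 0" if "x \<in> {0..1}" for x
    using prim_eq[of 0 1 "\<lambda>x. F x * ?e x" "\<lambda>x. 0" x] that by (simp add: indef_start)
  have "F x = F 0 * exp (- indef 0 1 (u t) x / \<mu>)" if "x \<in> {0..1}" for x
    using const[OF that] unfolding uV by (simp add: exp_minus divide_inverse flip: const[OF that])
  with F show ?case by blast
qed

text \<open>Two integrations by parts of \<open>hxx\<close> against the sine. The sine vanishes at
  both ends, which removes the boundary values of \<open>hx\<close>; the cosine has opposite signs
  there, so that the two boundary values of \<open>h\<close> add up.\<close>

lemma boundary_flux:
  assumes k: "k = 1 \<or> k = (3::real)"
  shows "AE t in D 0 T. \<forall>F. prim 0 1 F (hx t) \<and> (AE x in D 0 1. h t x = F x) \<longrightarrow>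
    (LINT x|D 0 1. - hux t x * sin (k * pi * x)) + \<mu> * (k * pi)\<^sup>2 * E k t = \<mu> * (k * pi) * (F 0 + F 1)"
  using hux_eq slices E_eq[OF k]
proof eventually_elim
  case (elim t)
  show ?case
  proof (intro allI impI, elim conjE)
    fix F assume F: "prim 0 1 F (hx t)" "AE x in D 0 1. h t x = F x"
    have s: "sqi (D 0 1) (hx t)" "sqi (D 0 1) (hxx t)" "sqi (D 0 1) (hux t)" "sqi (D 0 1) (h t)"
      and d: "weak_deriv 0 1 (hx t) (hxx t)" using elim(2) by simp_all
    obtain G where G: "prim 0 1 G (hxx t)" "AE x in D 0 1. hx t x = G x" by (rule sqi_weak_deriv_prim[OF d s(1,2)])
    note S = sine_prims[OF k]
    note ms = continuous_on_measurable_D[OF prim_continuous[OF S(1)]]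
      and mc = continuous_on_measurable_D[OF prim_continuous[OF S(2)]]
    have "(LINT x|D 0 1. - hux t x * sin (k * pi * x)) = (LINT x|D 0 1. \<mu> * (hxx t x * sin (k * pi * x)))"
    proof (rule integral_cong_AE)
      show "AE x in D 0 1. - hux t x * sin (k * pi * x) = \<mu> * (hxx t x * sin (k * pi * x))"
        using elim(1) by eventually_elim simp
    qed (use s[THEN sqi_measurable] ms in measurable)
    also have "\<dots> = \<mu> * (LINT x|D 0 1. hxx t x * sin (k * pi * x))" by simp
    also have "(LINT x|D 0 1. hxx t x * sin (k * pi * x)) = - (LINT x|D 0 1. G x * (k * pi * cos (k * pi * x)))"
      using prim_by_parts[OF G(1) S(1)] S(3) by simp
    also have "(LINT x|D 0 1. G x * (k * pi * cos (k * pi * x))) = (LINT x|D 0 1. hx t x * (k * pi * cos (k * pi * x)))"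
    proof (rule integral_cong_AE)
      show "AE x in D 0 1. G x * (k * pi * cos (k * pi * x)) = hx t x * (k * pi * cos (k * pi * x))"
        using G(2) by eventually_elim simp
    qed (use s[THEN sqi_measurable] mc continuous_on_measurable_D[OF prim_continuous[OF G(1)]] in \<open>auto intro: borel_measurable_times\<close>)
    also have "\<dots> = - (k * pi) * (F 0 + F 1) - (LINT x|D 0 1. F x * (- (k * pi)\<^sup>2 * sin (k * pi * x)))"
      using prim_by_parts[OF F(1) S(2)] S(4) by (simp add: algebra_simps)
    also have "(LINT x|D 0 1. F x * (- (k * pi)\<^sup>2 * sin (k * pi * x))) = (LINT x|D 0 1. - (k * pi)\<^sup>2 * (h t x * sin (k * pi * x)))"
    proof (rule integral_cong_AE)
      show "AE x in D 0 1. F x * (- (k * pi)\<^sup>2 * sin (k * pi * x)) = - (k * pi)\<^sup>2 * (h t x * sin (k * pi * x))"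
        using F(2) by eventually_elim simp
    qed (use s[THEN sqi_measurable] ms continuous_on_measurable_D[OF prim_continuous[OF F(1)]] in measurable)
    also have "\<dots> = - (k * pi)\<^sup>2 * E k t" by (simp add: elim(3))
    finally show "(LINT x|D 0 1. - hux t x * sin (k * pi * x)) + \<mu> * (k * pi)\<^sup>2 * E k t = \<mu> * (k * pi) * (F 0 + F 1)"
      by (simp add: algebra_simps)
  qed
qed

text \<open>If the profile were nonpositive at 0, it would be nonpositive throughout, and so would
  be its moment against the positive function \<open>sin (pi * x)\<close>. The premise on
  \<open>E 1\<close> stays in place because its positivity is deduced from this very fact.\<close>

lemma profile_sign:
  "AE t in D 0 T. E 1 t > 0 \<longrightarrow> (\<exists>F. prim 0 1 F (hx t) \<and> (AE x in D 0 1. h t x = F x) \<and>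
    (\<forall>x\<in>{0..1}. F x = F 0 * exp (- indef 0 1 (u t) x / \<mu>)) \<and> F 0 > 0)"
  using profile E_eq[OF disjI1[OF refl]] slices
proof eventually_elim
  case (elim t)
  show ?case
  proof
    assume pos: "E 1 t > 0"
    obtain F where F: "prim 0 1 F (hx t)" "AE x in D 0 1. h t x = F x"
      "\<forall>x\<in>{0..1}. F x = F 0 * exp (- indef 0 1 (u t) x / \<mu>)" using elim(1) by blast
    have "F 0 > 0"
    proof (rule ccontr)
      assume F0: "\<not> F 0 > 0"
      have "0 \<le> (LINT x|D 0 1. - (h t x * sin (1 * pi * x)))"
      proof (rule integral_nonneg_AE)
        have "AE x in D 0 1. x \<in> {0<..<1}" by (rule AE_D_I)
        with F(2) show "AE x in D 0 1. 0 \<le> - (h t x * sin (1 * pi * x))"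
        proof eventually_elim
          case (elim x)
          have "F x = F 0 * exp (- indef 0 1 (u t) x / \<mu>)" using F(3) elim(2) by (meson greaterThanLessThan_iff atLeastAtMost_iff less_imp_le)
          also have "\<dots> \<le> 0" using F0 by (intro mult_nonpos_nonneg) simp_all
          finally have "F x \<le> 0" .
          then have "F x * sin (1 * pi * x) \<le> 0" using sine_pos[OF elim(2)] by (intro mult_nonpos_nonneg) simp_all
          then show ?case by (simp add: elim(1))
        qed
      qed
      then show False using pos elim(2) by simp
    qed
    with F show "\<exists>F. prim 0 1 F (hx t) \<and> (AE x in D 0 1. h t x = F x) \<and>
      (\<forall>x\<in>{0..1}. F x = F 0 * exp (- indef 0 1 (u t) x / \<mu>)) \<and> F 0 > 0" by blast
  qed
qed

lemma flux_sign:
  assumes k: "k = 1 \<or> k = (3::real)"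
  shows "AE t in D 0 T. E 1 t > 0 \<longrightarrow>
    0 \<le> (LINT x|D 0 1. - hux t x * sin (k * pi * x)) + \<mu> * (k * pi)\<^sup>2 * E k t"
  using profile_sign boundary_flux[OF k]
proof eventually_elim
  case (elim t)
  show ?case
  proof
    assume "E 1 t > 0"
    then obtain F where F: "prim 0 1 F (hx t)" "AE x in D 0 1. h t x = F x"
      "\<forall>x\<in>{0..1}. F x = F 0 * exp (- indef 0 1 (u t) x / \<mu>)" "F 0 > 0" using elim(1) by blast
    have "F 1 = F 0 * exp (- indef 0 1 (u t) 1 / \<mu>)" using F(3)[rule_format, of 1] by simp
    then have "F 1 \<ge> 0" using F(4) by simp
    then have "0 \<le> \<mu> * (k * pi) * (F 0 + F 1)" using F(4) mu k by (intro mult_nonneg_nonneg add_nonneg_nonneg) auto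
    then show "0 \<le> (LINT x|D 0 1. - hux t x * sin (k * pi * x)) + \<mu> * (k * pi)\<^sup>2 * E k t"
      using elim(2)[rule_format, OF conjI[OF F(1,2)]] by simp
  qed
qed

text \<open>The apparent circularity, that the sign of the boundary term presupposes
  \<open>E 1 t > 0\<close>, is resolved by \<open>linear_ode_pos\<close>, which asks for the
  inequality only under that premise.\<close>

lemma E1_pos: assumes "t \<in> {0..T}" shows "E 1 t > 0"
proof (rule linear_ode_pos[OF E_prim _ _ assms])
  show "AE t in D 0 T. E 1 t > 0 \<longrightarrow> 0 \<le> (LINT x|D 0 1. - hux t x * sin (1 * pi * x)) + \<mu> * (1 * pi)\<^sup>2 * E 1 t"
    by (rule flux_sign) simp
qed (simp add: E_def indef_start)

lemma E3_pos: assumes "t \<in> {0..T}" shows "E 3 t > 0"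
proof (rule linear_ode_pos[OF E_prim _ _ assms])
  have "AE t in D 0 T. t \<in> {0..T}" by (rule AE_D_I) simp
  with flux_sign[OF disjI2[OF refl]]
  show "AE t in D 0 T. E 3 t > 0 \<longrightarrow> 0 \<le> (LINT x|D 0 1. - hux t x * sin (3 * pi * x)) + \<mu> * (3 * pi)\<^sup>2 * E 3 t"
  proof eventually_elim
    case (elim t)
    then show ?case using E1_pos by blast
  qed
qed (simp add: E_def indef_start)

text \<open>Dividing the third moment by \<open>F 0 > 0\<close> eliminates the height and leaves a
  condition on the velocity alone, which can be compared with the target.\<close>

lemma profile_moment_pos:
  "AE t in D 0 T. sqi (D 0 1) (u t) \<and> 0 < (LINT x|D 0 1. exp (- indef 0 1 (u t) x / \<mu>) * sin (3 * pi * x))"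
proof -
  have "AE t in D 0 T. t \<in> {0..T}" by (rule AE_D_I) simp
  with profile_sign E_eq[OF disjI2[OF refl]] slices show ?thesis
  proof eventually_elim
    case (elim t)
    obtain F where F: "prim 0 1 F (hx t)" "AE x in D 0 1. h t x = F x"
      "\<forall>x\<in>{0..1}. F x = F 0 * exp (- indef 0 1 (u t) x / \<mu>)" "F 0 > 0"
      using elim(1) E1_pos[OF elim(4)] by blast
    have s: "sqi (D 0 1) (h t)" "sqi (D 0 1) (u t)" using elim(3) by simp_all
    have iu: "(\<lambda>x. indef 0 1 (u t) x) \<in> borel_measurable (D 0 1)"
      by (rule continuous_on_measurable_D[OF indef_continuous[OF D.sqi_integrable[OF s(2)]]])
    have ms: "(\<lambda>x. sin (3 * pi * x)) \<in> borel_measurable (D 0 1)"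
      using continuous_on_measurable_D[OF prim_continuous[OF sine_prims(1)[of 3]]] by simp
    have "0 < (LINT x|D 0 1. h t x * sin (3 * pi * x))" using E3_pos[OF elim(4)] elim(2) by simp
    also have "(LINT x|D 0 1. h t x * sin (3 * pi * x)) = (LINT x|D 0 1. F 0 * (exp (- indef 0 1 (u t) x / \<mu>) * sin (3 * pi * x)))"
    proof (rule integral_cong_AE)
      have "AE x in D 0 1. x \<in> {0..1}" by (rule AE_D_I) simp
      with F(2) show "AE x in D 0 1. h t x * sin (3 * pi * x) = F 0 * (exp (- indef 0 1 (u t) x / \<mu>) * sin (3 * pi * x))"
      proof eventually_elim
        case (elim x)
        then show ?case unfolding elim(1) by (subst F(3)[rule_format, OF elim(2)]) simp
      qed
    qed (use s(1)[THEN sqi_measurable] iu ms in measurable)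
    also have "\<dots> = F 0 * (LINT x|D 0 1. exp (- indef 0 1 (u t) x / \<mu>) * sin (3 * pi * x))" by simp
    finally show ?case using F(4) s(2) by (simp add: zero_less_mult_iff)
  qed
qed

end

subsection \<open>Distributional solutions tested with products\<close>

lemma C_k_product:
  assumes "\<And>k. diff_times k \<theta>" "\<And>k. diff_times k \<psi>"
  shows "C_k k (\<lambda>t x. \<theta> t * \<psi> x)"
  using assms
proof (induction k arbitrary: \<theta> \<psi>)
  case 0
  have c: "continuous_on UNIV f" if f: "diff_times (Suc 0) f" for f
  proof -
    obtain f' where "\<And>x. (f has_real_derivative f' x) (at x)" using f by auto
    then show ?thesis by (meson DERIV_isCont continuous_at_imp_continuous_on)
  qed
  have "continuous_on UNIV (\<lambda>z. \<theta> (fst z) * \<psi> (snd z))"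
    by (intro continuous_on_mult continuous_on_compose2[OF c[OF 0(1)]]
        continuous_on_compose2[OF c[OF 0(2)]] continuous_intros) auto
  then show ?case by (simp add: split_beta')
next
  case (Suc k)
  have d: "(f has_real_derivative deriv f x) (at x)" if "\<And>k. diff_times k f" for f x
    using that[of 1] DERIV_deriv_iff_real_differentiable real_differentiable_def by auto
  have "C_k k (\<lambda>t x. deriv \<theta> t * \<psi> x)" "C_k k (\<lambda>t x. \<theta> t * deriv \<psi> x)"
    by (rule Suc.IH; (rule diff_times_deriv)?; rule Suc.prems)+
  moreover have "((\<lambda>s. \<theta> s * \<psi> x) has_real_derivative deriv \<theta> t * \<psi> x) (at t)"
    "((\<lambda>y. \<theta> t * \<psi> y) has_real_derivative \<theta> t * deriv \<psi> x) (at x)" for t x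
    using d[OF Suc.prems(1), of t] d[OF Suc.prems(2), of x] by (auto intro!: derivative_eq_intros)
  ultimately show ?case unfolding C_k.simps by blast
qed

lemma cyl_test_fun_product:
  assumes \<theta>: "test_fun 0 T \<theta>" and \<psi>: "test_fun 0 1 \<psi>"
  shows "cyl_test_fun T (\<lambda>t x. \<theta> t * \<psi> x)"
proof -
  obtain a b where ab: "0 < a" "b < T" "\<forall>x. x \<notin> {a..b} \<longrightarrow> \<theta> x = 0" using \<theta> unfolding test_fun_def by blast
  obtain c d where cd: "0 < c" "d < 1" "\<forall>x. x \<notin> {c..d} \<longrightarrow> \<psi> x = 0" using \<psi> unfolding test_fun_def by blast
  have "compact ({a..b} \<times> {c..d})" by (intro compact_Times compact_Icc)
  moreover have "{a..b} \<times> {c..d} \<subseteq> cylinder T" using ab cd by auto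
  moreover have "\<forall>t x. (t, x) \<notin> {a..b} \<times> {c..d} \<longrightarrow> \<theta> t * \<psi> x = 0" using ab(3) cd(3) by auto
  ultimately show ?thesis
    unfolding cyl_test_fun_def
    using C_k_product[OF test_fun_diff_times[OF \<theta>] test_fun_diff_times[OF \<psi>]] by blast
qed

lemma balance_law_pairing:
  assumes bl: "balance_law T q F S"
    and q: "integrable (cyl T) (case_prod q)" and F: "integrable (cyl T) (case_prod F)"
    and S: "integrable (cyl T) (case_prod S)"
    and \<theta>: "test_fun 0 T \<theta>" and \<psi>: "test_fun 0 1 \<psi>"
  shows "pairing T q (deriv \<theta>) \<psi> + pairing T F \<theta> (deriv \<psi>) - pairing T S \<theta> \<psi> = 0"
proof -
  note \<theta>' = test_fun_deriv[OF \<theta>] and \<psi>' = test_fun_deriv[OF \<psi>]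
  have dt: "deriv (\<lambda>s. \<theta> s * \<psi> x) t = deriv \<theta> t * \<psi> x" for t x
    by (rule DERIV_imp_deriv) (use test_fun_has_derivative[OF \<theta>, of t] in \<open>auto intro!: derivative_eq_intros\<close>)
  have dx: "deriv (\<lambda>y. \<theta> t * \<psi> y) x = \<theta> t * deriv \<psi> x" for t x
    by (rule DERIV_imp_deriv) (use test_fun_has_derivative[OF \<psi>, of x] in \<open>auto intro!: derivative_eq_intros\<close>)
  have "0 = (LINT (t, x)|(cyl T). q t x * d_t (\<lambda>t x. \<theta> t * \<psi> x) t x + F t x * d_x (\<lambda>t x. \<theta> t * \<psi> x) t x
      - S t x * (\<theta> t * \<psi> x))"
    using bl[unfolded balance_law_def, rule_format, OF cyl_test_fun_product[OF \<theta> \<psi>]]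
    unfolding integral_D_pair[symmetric] by simp
  also have "\<dots> = (LINT z|(cyl T). (case z of (t, x) \<Rightarrow> q t x * (deriv \<theta> t * \<psi> x)) + (case z of (t, x) \<Rightarrow> F t x * (\<theta> t * deriv \<psi> x))
      - (case z of (t, x) \<Rightarrow> S t x * (\<theta> t * \<psi> x)))"
    by (rule LINT_cong) (auto simp: dt dx)
  also have "\<dots> = pairing T q (deriv \<theta>) \<psi> + pairing T F \<theta> (deriv \<psi>) - pairing T S \<theta> \<psi>"
    unfolding pairing_def
    using integrable_pairing[OF q \<theta>' \<psi>] integrable_pairing[OF F \<theta> \<psi>'] integrable_pairing[OF S \<theta> \<psi>] by simp
  finally show ?thesis by simp
qed

lemma pairing_cong_AE:
  assumes "AE z in cyl T. case_prod q z = case_prod g z"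
    and q: "integrable (cyl T) (case_prod q)" and g: "integrable (cyl T) (case_prod g)"
    and t: "test_fun 0 T \<theta>" "test_fun 0 1 \<psi>"
  shows "pairing T q \<theta> \<psi> = pairing T g \<theta> \<psi>"
  unfolding pairing_def
proof (rule integral_cong_AE)
  show "AE z in cyl T. (case z of (t, x) \<Rightarrow> q t x * (\<theta> t * \<psi> x)) = (case z of (t, x) \<Rightarrow> g t x * (\<theta> t * \<psi> x))"
    using assms(1) by eventually_elim (simp add: split_beta')
qed (use integrable_pairing[OF q t] integrable_pairing[OF g t] in auto)

section \<open>Transfer between almost everywhere equal representatives\<close>

lemma space_deriv_iff:
  "space_deriv T w wx \<longleftrightarrow> case_prod wx \<in> borel_measurable (cyl T) \<and>
    (AE t in D 0 T. weak_deriv 0 1 (w t) (wx t))"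
  unfolding space_deriv_def cyl_borel_def measurable_D_pair_iff[symmetric] AE_D_iff ..

lemma point_value_cong:
  assumes "point_value 0 1 f p y" "AE x in D 0 1. f x = g x" shows "point_value 0 1 g p y"
proof -
  obtain F where F: "continuous_on {0..1} F" "AE x in D 0 1. F x = f x" "F p = y"
    using assms(1) by (auto simp: point_value_def AE_D_iff)
  have "AE x in D 0 1. F x = g x" using F(2) assms(2) by eventually_elim simp
  with F show ?thesis unfolding point_value_def AE_D_iff by blast
qed

lemma weak_der_AE: assumes "weak_deriv 0 1 f g" shows "AE x in D 0 1. weak_der 0 1 f x = g x"
  unfolding weak_der_def by (rule weak_deriv_unique[OF someI[of "weak_deriv 0 1 f", OF assms] assms])

lemma L2_norm_le_square:
  "L2_on {0<..<1} f \<and> L2_norm_on {0<..<1} f \<le> M \<Longrightarrow> sqi (D 0 1) f \<and> sqn f \<le> M\<^sup>2"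
  unfolding L2_on_iff L2_norm_on_eq by (auto dest: sqrt_le_D)

subsection \<open>Initial values\<close>

lemma initial_trace:
  assumes T: "T > 0" and tv: "time_value T w 0 w0" and \<psi>: "test_fun 0 1 \<psi>"
    and m: "\<And>t. t \<in> {0<..<T} \<Longrightarrow> w t \<in> borel_measurable (D 0 1)"
  shows "\<exists>Q. (Q \<longlongrightarrow> (LINT x|D 0 1. w0 x * \<psi> x)) (at_right 0) \<and> (AE t in D 0 T. Q t = (LINT x|D 0 1. w t x * \<psi> x))"
proof -
  obtain W where W: "trace_rep T w 0 w0 W"
    using time_value_limit[OF tv] by (elim exE)
  have sW: "\<And>t. t \<in> {0..T} \<Longrightarrow> sqi (D 0 1) (W t)" and aeW: "AE t in D 0 T. AE x in D 0 1. W t x = w t x" and W0: "W 0 = w0"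
    using W by auto
  have lim: "((\<lambda>\<tau>. nrm (\<lambda>x. W \<tau> x - w0 x)) \<longlongrightarrow> 0) (at_right 0)"
    using W T by (auto simp: at_within_Icc_at_right dest: bspec[of _ _ 0])
  have s\<psi>: "sqi (D 0 1) \<psi>" by (rule sqi_continuous[OF test_fun_continuous[OF \<psi>]])
  have sw0: "sqi (D 0 1) w0" using sW[of 0] W0 T by simp
  let ?Q = "\<lambda>t. \<integral>x. W t x * \<psi> x \<partial>D 0 1"
  have "((\<lambda>t. ?Q t - (LINT x|D 0 1. w0 x * \<psi> x)) \<longlongrightarrow> 0) (at_right 0)"
  proof (rule Lim_null_comparison)
    show "((\<lambda>t. nrm (\<lambda>x. W t x - w0 x) * nrm (\<lambda>x. \<psi> x)) \<longlongrightarrow> 0) (at_right 0)"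
      by (rule tendsto_mult_left_zero[OF lim])
    have "\<bar>?Q t - (LINT x|D 0 1. w0 x * \<psi> x)\<bar> \<le> nrm (\<lambda>x. W t x - w0 x) * nrm (\<lambda>x. \<psi> x)"
      if "t \<in> {0..T}" for t
    proof -
      have "?Q t - (LINT x|D 0 1. w0 x * \<psi> x) = (LINT x|D 0 1. (W t x - w0 x) * \<psi> x)"
        using sqi_mult[OF sW[OF that] s\<psi>] sqi_mult[OF sw0 s\<psi>] by (simp add: left_diff_distrib)
      then show ?thesis using sqi_Cauchy_Schwarz[OF sqi_diff[OF sW[OF that] sw0] s\<psi>] by simp
    qed
    then show "\<forall>\<^sub>F t in at_right 0. norm (?Q t - (LINT x|D 0 1. w0 x * \<psi> x)) \<le> nrm (\<lambda>x. W t x - w0 x) * nrm (\<lambda>x. \<psi> x)"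
      using T by (auto simp: eventually_at_right_field intro!: exI[of _ T])
  qed
  then have "(?Q \<longlongrightarrow> (LINT x|D 0 1. w0 x * \<psi> x)) (at_right 0)" by (simp add: LIM_zero_iff)
  moreover have "AE t in D 0 T. t \<in> {0<..<T}" by (rule AE_D_I)
  with aeW have "AE t in D 0 T. ?Q t = (LINT x|D 0 1. w t x * \<psi> x)"
  proof eventually_elim
    case (elim t)
    have "sqi (D 0 1) (W t)" using elim(2) by (intro sW) simp
    then show ?case
      by (intro integral_cong_AE borel_measurable_times sqi_measurable[OF s\<psi>] m[OF elim(2)] sqi_measurable)
        (use elim(1) in \<open>auto elim: eventually_mono\<close>)
  qed
  ultimately show ?thesis by (intro exI[of _ ?Q] conjI)
qed

text \<open>One factor stays bounded in L2 near time 0 while the other tends to 0 there, so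
  Cauchy-Schwarz handles the product. The bound for the first factor is its distance to
  \<open>w0\<close> plus the norm of \<open>w0\<close>.\<close>

lemma initial_trace_product:
  assumes T: "T > 0" and tvw: "time_value T w 0 w0" and tvv: "time_value T v 0 (\<lambda>x. 0)" and \<psi>: "test_fun 0 1 \<psi>"
    and m: "\<And>t. t \<in> {0<..<T} \<Longrightarrow> w t \<in> borel_measurable (D 0 1)" "\<And>t. t \<in> {0<..<T} \<Longrightarrow> v t \<in> borel_measurable (D 0 1)"
  shows "\<exists>Q. (Q \<longlongrightarrow> 0) (at_right 0) \<and> (AE t in D 0 T. Q t = (LINT x|D 0 1. w t x * v t x * \<psi> x))"
proof -
  obtain W where W: "trace_rep T w 0 w0 W"
    using time_value_limit[OF tvw] by (elim exE)
  have sW: "\<And>t. t \<in> {0..T} \<Longrightarrow> sqi (D 0 1) (W t)" and aeW: "AE t in D 0 T. AE x in D 0 1. W t x = w t x" and W0: "W 0 = w0"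
    using W by auto
  have limW: "((\<lambda>\<tau>. nrm (\<lambda>x. W \<tau> x - w0 x)) \<longlongrightarrow> 0) (at_right 0)"
    using W T by (auto simp: at_within_Icc_at_right dest: bspec[of _ _ 0])
  obtain V where V: "trace_rep T v 0 (\<lambda>x. 0) V"
    using time_value_limit[OF tvv] by (elim exE)
  have sV: "\<And>t. t \<in> {0..T} \<Longrightarrow> sqi (D 0 1) (V t)" and aeV: "AE t in D 0 T. AE x in D 0 1. V t x = v t x"
    using V by auto
  have limV: "((\<lambda>\<tau>. nrm (V \<tau>)) \<longlongrightarrow> 0) (at_right 0)"
    using V T by (auto simp: at_within_Icc_at_right dest: bspec[of _ _ 0])
  obtain L where L: "\<And>x. \<bar>\<psi> x\<bar> \<le> L" "L \<ge> 0" using test_fun_bounded[OF \<psi>] by blast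
  have m\<psi>: "\<psi> \<in> borel_measurable (D 0 1)" by (rule borel_measurable_D_compose[OF test_fun_measurable[OF \<psi>]])
  have sw0: "sqi (D 0 1) w0" using sW[of 0] W0 T by simp
  have sV\<psi>: "sqi (D 0 1) (\<lambda>x. V t x * \<psi> x)" if "t \<in> {0..T}" for t
    by (rule sqi_bounded[OF sV[OF that] m\<psi>, of L]) (use L in simp)
  let ?Q = "\<lambda>t. \<integral>x. W t x * (V t x * \<psi> x) \<partial>D 0 1"
  let ?nW = "\<lambda>t. nrm (\<lambda>x. W t x - w0 x)" and ?nV = "\<lambda>t. nrm (V t)"
  let ?n0 = "nrm w0"
  have "(?Q \<longlongrightarrow> 0) (at_right 0)"
  proof (rule Lim_null_comparison)
    have "((\<lambda>t. (?nW t + ?n0) * (L * ?nV t)) \<longlongrightarrow> (0 + ?n0) * (L * 0)) (at_right 0)"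
      by (intro tendsto_mult tendsto_add tendsto_const limW limV)
    then show "((\<lambda>t. (?nW t + ?n0) * (L * ?nV t)) \<longlongrightarrow> 0) (at_right 0)" by simp
    have "\<bar>?Q t\<bar> \<le> (?nW t + ?n0) * (L * ?nV t)" if t: "t \<in> {0..T}" for t
    proof -
      have "\<bar>?Q t\<bar> \<le> nrm (W t) * nrm (\<lambda>x. V t x * \<psi> x)"
        by (rule sqi_Cauchy_Schwarz[OF sW[OF t] sV\<psi>[OF t]])
      also have "\<dots> \<le> (?nW t + ?n0) * (L * ?nV t)"
      proof (rule mult_mono)
        show "nrm (W t) \<le> ?nW t + ?n0" by (rule L2_norm_diff_le[OF sW[OF t] sw0])
        have "sqn (\<lambda>x. V t x * \<psi> x) \<le> (LINT x|D 0 1. L\<^sup>2 * (V t x)\<^sup>2)"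
        proof (rule integral_mono)
          show "integrable (D 0 1) (\<lambda>x. (V t x * \<psi> x)\<^sup>2)" using sV\<psi>[OF t] by (simp add: sqi_def)
          show "integrable (D 0 1) (\<lambda>x. L\<^sup>2 * (V t x)\<^sup>2)" using sV[OF t] by (simp add: sqi_def)
          fix x
          have "\<bar>\<psi> x\<bar>\<^sup>2 \<le> L\<^sup>2" by (rule power_mono[OF L(1)]) simp
          then have "(\<psi> x)\<^sup>2 * (V t x)\<^sup>2 \<le> L\<^sup>2 * (V t x)\<^sup>2" by (intro mult_right_mono) simp_all
          then show "(V t x * \<psi> x)\<^sup>2 \<le> L\<^sup>2 * (V t x)\<^sup>2" by (simp add: power_mult_distrib mult.commute)
        qed
        then have "nrm (\<lambda>x. V t x * \<psi> x) \<le> sqrt (L\<^sup>2 * sqn (V t))"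
          by (intro real_sqrt_le_mono) simp
        then show "nrm (\<lambda>x. V t x * \<psi> x) \<le> L * ?nV t" using L(2) by (simp add: real_sqrt_mult)
      qed simp_all
      finally show ?thesis .
    qed
    then show "\<forall>\<^sub>F t in at_right 0. norm (?Q t) \<le> (?nW t + ?n0) * (L * ?nV t)"
      using T by (auto simp: eventually_at_right_field intro!: exI[of _ T])
  qed
  moreover have "AE t in D 0 T. t \<in> {0<..<T}" by (rule AE_D_I)
  with aeW aeV have "AE t in D 0 T. ?Q t = (LINT x|D 0 1. w t x * v t x * \<psi> x)"
  proof eventually_elim
    case (elim t)
    have t: "t \<in> {0..T}" using elim(3) by simp
    show ?case
    proof (rule integral_cong_AE)
      show "AE x in D 0 1. W t x * (V t x * \<psi> x) = w t x * v t x * \<psi> x"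
        using elim(1,2) by eventually_elim simp
      show "(\<lambda>x. W t x * (V t x * \<psi> x)) \<in> borel_measurable (D 0 1)"
        by (intro borel_measurable_times sqi_measurable[OF sW[OF t]] sqi_measurable[OF sV[OF t]] m\<psi>)
      show "(\<lambda>x. w t x * v t x * \<psi> x) \<in> borel_measurable (D 0 1)"
        by (intro borel_measurable_times m(1)[OF elim(3)] m(2)[OF elim(3)] m\<psi>)
    qed
  qed
  ultimately show ?thesis by (intro exI[of _ ?Q] conjI)
qed

text \<open>The bridge from the definition of a solution to the locales. \<open>sw_regular\<close>
  is interpreted first, since its integrability facts allow the balance laws to be split into
  pairings.\<close>

lemma associated_solution_moment:
  assumes mu: "\<mu> > 0" and Fr: "Fr > 0" and r: "r = 1 / (\<mu> * Fr\<^sup>2)" and T: "T > 0"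
    and sol: "associated_solution \<mu> Fr r T (\<lambda>x. 1) (\<lambda>x. 0) v1 v2 h u"
  shows "AE t in D 0 T. sqi (D 0 1) (u t) \<and> 0 < (LINT x|D 0 1. exp (- indef 0 1 (u t) x / \<mu>) * sin (3 * pi * x))"
proof -
  have X: "in_Linf_H2 T h" "in_L2_H2 T u" and sw: "sw_solution \<mu> Fr r T (\<lambda>x. 1) (\<lambda>x. 0) v1 v2 h u"
    and inflow: "no_effective_inflow \<mu> T v1 v2 h u"
    using sol by (auto simp: associated_solution_def in_X_def)
  obtain hx hxx M where h: "cyl_borel T h" "space_deriv T h hx" "space_deriv T hx hxx"
    "AE t in D 0 T. \<forall>f \<in> {h t, hx t, hxx t}. L2_on {0<..<1} f \<and> L2_norm_on {0<..<1} f \<le> M"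
    using X(1) unfolding in_Linf_H2_def AE_D_iff by blast
  obtain ux uxx where u: "in_L2_L2 T u" "space_deriv T u ux" "space_deriv T ux uxx" "in_L2_L2 T ux" "in_L2_L2 T uxx"
    using X(2) unfolding in_L2_H2_def by blast
  have mass: "balance_law T h (\<lambda>t x. h t x * u t x) (\<lambda>t x. 0)"
    and tvh: "time_value T h 0 (\<lambda>x. 1)" and tvu: "time_value T u 0 (\<lambda>x. 0)"
    and tr: "AE t in D 0 T. point_value 0 1 (u t) 0 (v1 t) \<and> point_value 0 1 (u t) 1 (v2 t)"
    using sw unfolding sw_solution_def AE_D_iff by blast+
  obtain ux' where ux': "space_deriv T u ux'"
    "balance_law T (\<lambda>t x. h t x * u t x)
          (\<lambda>t x. h t x * (u t x)\<^sup>2 - \<mu> * h t x * ux' t x + h t x / Fr\<^sup>2)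
          (\<lambda>t x. r * h t x * u t x)"
    using sw unfolding sw_solution_def by blast
  have hm: "case_prod h \<in> borel_measurable (cyl T)"
    using h(1) by (simp add: cyl_borel_def measurable_D_pair_iff)
  have us: "sqi (cyl T) (case_prod u)" "sqi (cyl T) (case_prod ux)" "sqi (cyl T) (case_prod uxx)"
    using u(1,4,5) by (simp_all add: in_L2_L2_def L2_on_pair_iff)
  have slice_h: "h t \<in> borel_measurable (D 0 1)" if "t \<in> {0<..<T}" for t by (rule slice_measurable[OF hm that])
  have slice_u: "u t \<in> borel_measurable (D 0 1)" if "t \<in> {0<..<T}" for t
    by (rule slice_measurable[OF sqi_measurable[OF us(1)] that])
  obtain K where K: "AE t in D 0 T. sqi (D 0 1) (u t) \<and> sqn (u t) \<le> K"
    using time_value_bounded[OF tvu slice_u] by blast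
  have hb: "AE t in D 0 T. sqi (D 0 1) (f t) \<and> sqn (f t) \<le> M\<^sup>2" if "f \<in> {h, hx, hxx}" for f
    using h(4)
  proof eventually_elim
    case (elim t)
    with that show ?case by (intro L2_norm_le_square) auto
  qed
  \<comment> \<open>\<open>M\<close> bounds norms, whereas the locale bounds squared norms; hence
    \<open>M\<^sup>2\<close>.\<close>
  interpret R: sw_regular \<mu> Fr T h hx hxx u ux uxx "M\<^sup>2" K
    by unfold_locales (use mu Fr T hm h(2,3) u(2,3) us K hb in \<open>simp_all add: space_deriv_iff\<close>)
  have huI: "integrable R.Cyl (\<lambda>(t, x). h t x * u t x)"
    using R.c_int(1) by (simp add: R.hu_def[abs_def])
  let ?F = "\<lambda>t x. h t x * (u t x)\<^sup>2 - \<mu> * h t x * ux t x + h t x / Fr\<^sup>2"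
  let ?F' = "\<lambda>t x. h t x * (u t x)\<^sup>2 - \<mu> * h t x * ux' t x + h t x / Fr\<^sup>2"
  have mux': "case_prod ux' \<in> borel_measurable R.Cyl" using ux'(1) by (simp add: space_deriv_iff)
  note zm = R.z_sqi(1)[THEN sqi_measurable] R.z_sqi(4)[THEN sqi_measurable] R.z_sqi(5)[THEN sqi_measurable]
    mux'[unfolded split_beta']
  \<comment> \<open>The weak form of the momentum equation brings its own derivative
    \<open>ux'\<close>, while the solution space provides \<open>ux\<close>; uniqueness of weak
    derivatives identifies them.\<close>
  have uxux': "AE z in R.Cyl. ux (fst z) (snd z) = ux' (fst z) (snd z)"
  proof (rule AE_pairI)
    have "AE t in D 0 T. weak_deriv 0 1 (u t) (ux t)" "AE t in D 0 T. weak_deriv 0 1 (u t) (ux' t)"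
      using u(2) ux'(1) by (simp_all add: space_deriv_iff)
    then show "AE t in D 0 T. AE x in D 0 1. ux t x = ux' t x"
      by eventually_elim (rule weak_deriv_unique)
    note [measurable] = zm(3,4)
    show "Measurable.pred R.Cyl (\<lambda>z. ux (fst z) (snd z) = ux' (fst z) (snd z))" by measurable
  qed
  have FF': "AE z in R.Cyl. case_prod ?F z = case_prod ?F' z"
    using uxux' by eventually_elim (simp add: split_beta')
  have F'm: "case_prod ?F' \<in> borel_measurable R.Cyl"
  proof -
    note [measurable] = zm
    have "(\<lambda>z. h (fst z) (snd z) * (u (fst z) (snd z))\<^sup>2 - \<mu> * h (fst z) (snd z) * ux' (fst z) (snd z) + h (fst z) (snd z) / Fr\<^sup>2)
      \<in> borel_measurable R.Cyl" by measurable
    then show ?thesis by (simp add: split_beta')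
  qed
  have F'I: "integrable R.Cyl (case_prod ?F')"
    using R.momentum_flux_int by (subst integrable_cong_AE[OF F'm, of "case_prod ?F"]) (use FF' in \<open>auto elim: eventually_mono\<close>)
  have S: "pairing T (\<lambda>t x. r * h t x * u t x) \<theta> \<psi> = r * pairing T (\<lambda>t x. h t x * u t x) \<theta> \<psi>"
    "integrable R.Cyl (\<lambda>(t, x). r * h t x * u t x)" for \<theta> \<psi>
  proof -
    show "integrable R.Cyl (\<lambda>(t, x). r * h t x * u t x)"
      using integrable_mult_right[OF huI, of r] by (simp add: split_beta' mult.assoc)
    show "pairing T (\<lambda>t x. r * h t x * u t x) \<theta> \<psi> = r * pairing T (\<lambda>t x. h t x * u t x) \<theta> \<psi>"
      unfolding pairing_def integral_mult_right_zero[symmetric]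
      by (rule LINT_cong) auto
  qed
  interpret sw_flow \<mu> Fr T h hx hxx u ux uxx "M\<^sup>2" K r v1 v2
  proof unfold_locales
    show "r = 1 / (\<mu> * Fr\<^sup>2)" by (rule r)
    show "AE t in D 0 T. point_value 0 1 (u t) 0 (v1 t) \<and> point_value 0 1 (u t) 1 (v2 t)" by (rule tr)
    have "AE t in D 0 T. weak_deriv 0 1 (h t) (hx t)" using h(2) by (simp add: space_deriv_iff)
    moreover have "AE t in D 0 T. let m = (\<lambda>x. h t x * u t x + \<mu> * weak_der 0 1 (h t) x) in
           (v1 t > 0 \<longrightarrow> point_value 0 1 m 0 0) \<and> (v2 t < 0 \<longrightarrow> point_value 0 1 m 1 0)"
      using inflow unfolding no_effective_inflow_def AE_D_iff .
    ultimately show "AE t in D 0 T. (v1 t > 0 \<longrightarrow> point_value 0 1 (\<lambda>x. h t x * u t x + \<mu> * hx t x) 0 0) \<and>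
      (v2 t < 0 \<longrightarrow> point_value 0 1 (\<lambda>x. h t x * u t x + \<mu> * hx t x) 1 0)"
    proof eventually_elim
      case (elim t)
      have ae: "AE x in D 0 1. h t x * u t x + \<mu> * weak_der 0 1 (h t) x = h t x * u t x + \<mu> * hx t x"
        using weak_der_AE[OF elim(1)] by eventually_elim simp
      show ?case using elim(2) point_value_cong[OF _ ae] unfolding Let_def by blast
    qed
  next
    fix \<theta> \<psi> assume t: "test_fun 0 T \<theta>" "test_fun 0 1 \<psi>"
    have "pairing T (\<lambda>t x. 0) \<theta> \<psi> = 0" by (simp add: pairing_def split_beta')
    then show "pairing T h (deriv \<theta>) \<psi> + pairing T (\<lambda>t x. h t x * u t x) \<theta> (deriv \<psi>) = 0"
      using balance_law_pairing[OF mass R.c_int(5) huI _ t] by (simp add: split_beta')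
    have "pairing T ?F \<theta> (deriv \<psi>) = pairing T ?F' \<theta> (deriv \<psi>)"
      by (rule pairing_cong_AE[OF FF' R.momentum_flux_int F'I t(1) test_fun_deriv[OF t(2)]])
    then show "pairing T (\<lambda>t x. h t x * u t x) (deriv \<theta>) \<psi> + pairing T ?F \<theta> (deriv \<psi>)
      - r * pairing T (\<lambda>t x. h t x * u t x) \<theta> \<psi> = 0"
      using balance_law_pairing[OF ux'(2) huI F'I S(2) t] S(1)[of \<theta> \<psi>] by simp
  next
    fix \<psi> assume \<psi>: "test_fun 0 1 \<psi>"
    show "\<exists>Q. (Q \<longlongrightarrow> (LINT x|D 0 1. \<psi> x)) (at_right 0) \<and> (AE t in D 0 T. Q t = (LINT x|D 0 1. h t x * \<psi> x))"
      using initial_trace[OF T tvh \<psi> slice_h] by simp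
    show "\<exists>Q. (Q \<longlongrightarrow> 0) (at_right 0) \<and> (AE t in D 0 T. Q t = (LINT x|D 0 1. h t x * u t x * \<psi> x))"
      by (rule initial_trace_product[OF T tvh tvu \<psi> slice_h slice_u])
  qed
  show ?thesis by (rule profile_moment_pos)
qed

subsection \<open>The unreachable target\<close>

lemma in_H1_prim: assumes "prim 0 1 F g" "sqi (D 0 1) g" shows "in_H1 0 1 F"
  unfolding in_H1_def L2_on_iff
  using prim_weak_deriv[OF assms(1)] assms(2) sqi_continuous[OF prim_continuous[OF assms(1)]] by auto

lemma in_H2_prim: assumes "prim 0 1 F g" "prim 0 1 g k" "sqi (D 0 1) k" shows "in_H2 0 1 F"
  unfolding in_H2_def L2_on_iff
  using prim_weak_deriv[OF assms(1)] sqi_continuous[OF prim_continuous[OF assms(1)]] in_H1_prim[OF assms(2,3)] by auto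

text \<open>The mean 3/2 keeps the height at least 1/2 and is still small enough for the third mode
  to prevail: the third moment is \<open>3/2 * 2/(3 pi) - 1/2 = 1/pi - 1/2\<close>, which is
  negative.\<close>

definition target_height :: "real \<Rightarrow> real" where "target_height x = 3 / 2 - sin (3 * pi * x)"

definition target_velocity :: "real \<Rightarrow> real \<Rightarrow> real" where
  "target_velocity \<mu> x = \<mu> * (3 * pi * cos (3 * pi * x)) / target_height x"

lemma target_height_bounds: "1 / 2 \<le> target_height x" "target_height x \<le> 5 / 2"
  using sin_le_one[of "3 * pi * x"] sin_ge_minus_one[of "3 * pi * x"] unfolding target_height_def by linarith+

lemma target_height_DERIV: "(target_height has_real_derivative - (3 * pi * cos (3 * pi * x))) (at x within A)"
  unfolding target_height_def[abs_def] by (auto intro!: derivative_eq_intros)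

lemma target_height_continuous: "continuous_on A target_height"
  unfolding target_height_def[abs_def] by (intro continuous_intros)

lemma target_height_nonzero: "target_height x \<noteq> 0" "target_height x > 0"
  using target_height_bounds(1)[of x] by linarith+

lemma target_height_H2: "in_H2 0 1 target_height"
proof (rule in_H2_prim)
  show "prim 0 1 target_height (\<lambda>x. - (3 * pi * cos (3 * pi * x)))"
    by (rule prim_of_derivative[OF target_height_DERIV]) (intro continuous_intros)
  show "prim 0 1 (\<lambda>x. - (3 * pi * cos (3 * pi * x))) (\<lambda>x. 9 * pi\<^sup>2 * sin (3 * pi * x))"
    by (rule prim_of_derivative) (auto intro!: derivative_eq_intros continuous_intros simp: power2_eq_square)
  show "sqi (D 0 1) (\<lambda>x. 9 * pi\<^sup>2 * sin (3 * pi * x))" by (intro sqi_continuous continuous_intros)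
qed

lemma target_velocity_continuous: "continuous_on A (target_velocity \<mu>)"
  unfolding target_velocity_def[abs_def]
  by (intro continuous_intros target_height_continuous) (simp add: target_height_nonzero)

lemma target_velocity_H1: "in_H1 0 1 (target_velocity \<mu>)"
proof (rule in_H1_prim)
  let ?d = "\<lambda>x. ((\<mu> * (3 * pi * (- (3 * pi * sin (3 * pi * x))))) * target_height x
     - \<mu> * (3 * pi * cos (3 * pi * x)) * - (3 * pi * cos (3 * pi * x))) / (target_height x * target_height x)"
  have cont: "continuous_on {0..1} ?d"
    by (intro continuous_intros target_height_continuous) (simp add: target_height_nonzero)
  show "prim 0 1 (target_velocity \<mu>) ?d"
  proof (rule prim_of_derivative[OF _ cont])
    fix x :: real
    have "((\<lambda>x. \<mu> * (3 * pi * cos (3 * pi * x))) has_real_derivative \<mu> * (3 * pi * (- (3 * pi * sin (3 * pi * x))))) (at x within {0..1})"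
      by (auto intro!: derivative_eq_intros)
    from DERIV_divide[OF this target_height_DERIV target_height_nonzero(1)]
    show "(target_velocity \<mu> has_real_derivative ?d x) (at x within {0..1})"
      unfolding target_velocity_def[abs_def] .
  qed
  show "sqi (D 0 1) ?d" by (rule sqi_continuous[OF cont])
qed

lemma target_log_prim: "prim 0 1 (\<lambda>x. - \<mu> * ln (target_height x)) (target_velocity \<mu>)"
proof (rule prim_of_derivative[OF _ target_velocity_continuous])
  fix x :: real
  have "((\<lambda>x. ln (target_height x)) has_real_derivative (1 / target_height x) * - (3 * pi * cos (3 * pi * x))) (at x within {0..1})"
    by (rule DERIV_chain'[OF target_height_DERIV DERIV_ln_divide[OF target_height_nonzero(2)]])
  from DERIV_cmult[OF this, of "- \<mu>"]
  show "((\<lambda>x. - \<mu> * ln (target_height x)) has_real_derivative target_velocity \<mu> x) (at x within {0..1})"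
    by (simp add: target_velocity_def)
qed

text \<open>The velocity determines the height up to its value at 0. The factor 2/3 is the
  reciprocal of \<open>target_height 0\<close>.\<close>

lemma target_exp:
  assumes mu: "\<mu> > 0" and x: "x \<in> {0..1}"
  shows "exp (- indef 0 1 (target_velocity \<mu>) x / \<mu>) = 2 / 3 * target_height x"
proof -
  have "- \<mu> * ln (target_height x) = - \<mu> * ln (3 / 2) + indef 0 1 (target_velocity \<mu>) x"
    using prim_eq[OF target_log_prim x, of \<mu>] by (simp add: target_height_def)
  then have "- indef 0 1 (target_velocity \<mu>) x = \<mu> * (ln (target_height x) - ln (3 / 2))" by (simp add: algebra_simps)
  then have "- indef 0 1 (target_velocity \<mu>) x / \<mu> = ln (target_height x) - ln (3 / 2)"
    using mu by simp
  also have "\<dots> = ln (2 / 3 * target_height x)"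
    using target_height_nonzero(2)[of x] ln_div[of "target_height x" "3 / 2"] by (simp add: field_simps)
  finally show ?thesis using target_height_nonzero(2)[of x] by simp
qed

lemma target_moment: "(LINT x|D 0 1. target_height x * sin (3 * pi * x)) = 1 / pi - 1 / 2"
proof -
  have "prim 0 1 (\<lambda>x. x / 2 - sin (3 * pi * x) * cos (3 * pi * x) / (6 * pi)) (\<lambda>x. (sin (3 * pi * x))\<^sup>2)"
  proof (rule prim_of_derivative)
    fix x :: real
    define k l where "k = sin (3 * pi * x)" and "l = cos (3 * pi * x)"
    have kl: "l\<^sup>2 = 1 - k\<^sup>2" unfolding k_def l_def by (rule cos_squared_eq)
    have z: "(3 * pi * l * l + k * (- (3 * pi * k))) / (6 * pi) = (l\<^sup>2 - k\<^sup>2) / 2"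
      by (simp add: field_simps power2_eq_square)
    have eq: "1 / 2 - (3 * pi * l * l + k * (- (3 * pi * k))) / (6 * pi) = k\<^sup>2"
      unfolding z kl by (simp add: field_simps)
    have "((\<lambda>x. x / 2 - sin (3 * pi * x) * cos (3 * pi * x) / (6 * pi)) has_real_derivative
      1 / 2 - (3 * pi * l * l + k * (- (3 * pi * k))) / (6 * pi)) (at x within {0..1})"
      unfolding k_def l_def by (auto intro!: derivative_eq_intros simp: field_simps)
    then show "((\<lambda>x. x / 2 - sin (3 * pi * x) * cos (3 * pi * x) / (6 * pi)) has_real_derivative (sin (3 * pi * x))\<^sup>2) (at x within {0..1})"
      unfolding eq by (simp add: k_def)
  qed (intro continuous_intros)
  from prim_diff_eq[OF this] have s2: "sqn (\<lambda>x. sin (3 * pi * x)) = 1 / 2"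
    using sine_prims(3)[of 3] by simp
  have s1: "(LINT x|D 0 1. sin (3 * pi * x)) = 2 / (3 * pi)" by (rule sine_prims(5)) simp
  have i: "sqi (D 0 1) (\<lambda>x. sin (3 * pi * x))" by (intro sqi_continuous continuous_intros)
  have "(LINT x|D 0 1. target_height x * sin (3 * pi * x)) = (LINT x|D 0 1. 3 / 2 * sin (3 * pi * x) - (sin (3 * pi * x))\<^sup>2)"
    by (rule LINT_cong) (auto simp: target_height_def power2_eq_square algebra_simps)
  also have "\<dots> = 3 / 2 * (2 / (3 * pi)) - 1 / 2"
    using i D.sqi_integrable[OF i] s1 s2 by (simp add: sqi_def)
  finally show ?thesis by simp
qed

text \<open>The distance \<delta> that solves
  \<open>5/3 * (exp (\<delta> / \<mu>) - 1) = 2/3 * (1/2 - 1/pi)\<close>. The right side is the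
  deficit of the third moment of the normalised target profile; the left side bounds the change of
  that moment caused by an L2 perturbation of size \<delta>.\<close>

definition gap :: "real \<Rightarrow> real" where "gap \<mu> = \<mu> * ln (1 + 2 / 5 * (1 / 2 - 1 / pi))"

lemma gap_pos: "\<mu> > 0 \<Longrightarrow> gap \<mu> > 0"
  unfolding gap_def using pi_gt3 by (intro mult_pos_pos ln_gt_zero) (simp_all add: field_simps)

text \<open>On an interval of length 1, velocities at L2 distance \<delta> have primitives that
  differ by at most \<delta>, so the reconstructed profiles differ by a factor between
  \<open>exp (- \<delta> / \<mu>)\<close> and \<open>exp (\<delta> / \<mu>)\<close>. As the
  normalised target profile is at most 5/3, a positive third moment forces \<delta> to be large
  enough to outweigh the negative one of the target.\<close>

lemma target_distance:
  assumes mu: "\<mu> > 0" and f: "sqi (D 0 1) f"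
    and pos: "0 < (LINT x|D 0 1. exp (- indef 0 1 f x / \<mu>) * sin (3 * pi * x))"
  shows "gap \<mu> \<le> nrm (\<lambda>x. f x - target_velocity \<mu> x)"
proof -
  let ?v = "target_velocity \<mu>"
  define \<delta> where "\<delta> = nrm (\<lambda>x. f x - ?v x)"
  have sv: "sqi (D 0 1) ?v" by (rule sqi_continuous[OF target_velocity_continuous])
  have sd: "sqi (D 0 1) (\<lambda>x. f x - ?v x)" by (rule sqi_diff[OF f sv])
  note jf = D.sqi_integrable[OF f] and jd = D.sqi_integrable[OF sd] and jv = D.sqi_integrable[OF sv]
  have split: "indef 0 1 f x = indef 0 1 ?v x + indef 0 1 (\<lambda>x. f x - ?v x) x" for x
    unfolding indef_add[OF jv jd, symmetric] by simp
  have small: "\<bar>indef 0 1 (\<lambda>x. f x - ?v x) x\<bar> \<le> \<delta>" for x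
    unfolding \<delta>_def by (rule order_trans[OF indef_abs_le[OF jd] integral_abs_le_L2[OF sd]])
  define \<eta> where "\<eta> = exp (\<delta> / \<mu>) - 1"
  have pw: "exp (- indef 0 1 f x / \<mu>) * sin (3 * pi * x) \<le> 2 / 3 * (target_height x * sin (3 * pi * x)) + 5 / 3 * \<eta>"
    if x: "x \<in> {0..1}" for x
  proof -
    define y where "y = - indef 0 1 (\<lambda>x. f x - ?v x) x / \<mu>"
    have "\<bar>y\<bar> \<le> \<delta> / \<mu>" using small[of x] mu by (simp add: y_def abs_divide divide_right_mono)
    then have y: "y \<le> \<delta> / \<mu>" "- (\<delta> / \<mu>) \<le> y" by linarith+
    have "\<bar>exp y - 1\<bar> \<le> \<eta>"
    proof -
      have 1: "exp y \<le> exp (\<delta> / \<mu>)" "exp (- (\<delta> / \<mu>)) \<le> exp y" using y by simp_all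
      \<comment> \<open>Added up, the two inequalities give \<open>exp s + exp (- s) \<ge> 2\<close>
        for \<open>s = \<delta> / \<mu>\<close>, so that the lower deviation
        \<open>1 - exp (- s)\<close> is at most the upper one, \<eta>.\<close>
      have "1 + \<delta> / \<mu> \<le> exp (\<delta> / \<mu>)" "1 + - (\<delta> / \<mu>) \<le> exp (- (\<delta> / \<mu>))" by (rule exp_ge_add_one_self)+
      with 1 show ?thesis unfolding \<eta>_def by linarith
    qed
    then have "\<bar>(exp y - 1) * sin (3 * pi * x)\<bar> \<le> \<eta> * 1"
      unfolding abs_mult by (intro mult_mono) auto
    then have 2: "(exp y - 1) * sin (3 * pi * x) \<le> \<eta>" "0 \<le> \<eta>" by linarith+
    have "2 / 3 * target_height x * ((exp y - 1) * sin (3 * pi * x)) \<le> 2 / 3 * target_height x * \<eta>"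
      using 2(1) target_height_nonzero(2)[of x] by (intro mult_left_mono) simp_all
    also have "\<dots> \<le> 5 / 3 * \<eta>" using 2(2) target_height_bounds(2)[of x] by (intro mult_right_mono) simp_all
    finally have 3: "2 / 3 * target_height x * ((exp y - 1) * sin (3 * pi * x)) \<le> 5 / 3 * \<eta>" .
    have "- indef 0 1 f x / \<mu> = - indef 0 1 ?v x / \<mu> + y" unfolding split y_def by (simp add: diff_divide_distrib)
    then have e: "exp (- indef 0 1 f x / \<mu>) = 2 / 3 * target_height x * exp y"
      by (simp only: exp_add target_exp[OF mu x])
    show ?thesis unfolding e using 3 by (simp add: algebra_simps)
  qed
  have iS: "integrable (D 0 1) (\<lambda>x. target_height x * sin (3 * pi * x))"
    by (intro D.sqi_integrable sqi_continuous continuous_intros target_height_continuous)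
  have "(LINT x|D 0 1. exp (- indef 0 1 f x / \<mu>) * sin (3 * pi * x))
    \<le> (LINT x|D 0 1. 2 / 3 * (target_height x * sin (3 * pi * x)) + 5 / 3 * \<eta>)"
  proof (rule integral_mono)
    have "continuous_on {0..1} (\<lambda>x. exp (- indef 0 1 f x / \<mu>) * sin (3 * pi * x))"
      using mu by (intro continuous_intros indef_continuous[OF jf]) simp
    then show "integrable (D 0 1) (\<lambda>x. exp (- indef 0 1 f x / \<mu>) * sin (3 * pi * x))"
      by (rule D.sqi_integrable[OF sqi_continuous])
    show "integrable (D 0 1) (\<lambda>x. 2 / 3 * (target_height x * sin (3 * pi * x)) + 5 / 3 * \<eta>)" using iS by simp
  qed (use pw in simp)
  also have "\<dots> = 2 / 3 * (1 / pi - 1 / 2) + 5 / 3 * \<eta>" using iS target_moment by simp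
  finally have "0 < 2 / 3 * (1 / pi - 1 / 2) + 5 / 3 * \<eta>" using pos by simp
  moreover have "0 < 2 / 3 * (w - 1 / 2) + 5 / 3 * \<eta> \<Longrightarrow> 2 / 5 * (1 / 2 - w) \<le> \<eta>" for w
    by (simp add: field_simps)
  ultimately have "2 / 5 * (1 / 2 - 1 / pi) \<le> \<eta>" by blast
  then have "1 + 2 / 5 * (1 / 2 - 1 / pi) \<le> 1 + \<eta>" by (rule add_left_mono)
  also have "1 + \<eta> = exp (\<delta> / \<mu>)" by (simp add: \<eta>_def)
  finally have "1 + 2 / 5 * (1 / 2 - 1 / pi) \<le> exp (\<delta> / \<mu>)" .
  moreover have "0 < 1 + 2 / 5 * (1 / 2 - 1 / pi)" using pi_gt3 by (simp add: field_simps)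
  ultimately have "ln (1 + 2 / 5 * (1 / 2 - 1 / pi)) \<le> ln (exp (\<delta> / \<mu>))"
    using ln_le_cancel_iff exp_gt_zero by blast
  then have "ln (1 + 2 / 5 * (1 / 2 - 1 / pi)) \<le> \<delta> / \<mu>" by simp
  then have "\<mu> * ln (1 + 2 / 5 * (1 / 2 - 1 / pi)) \<le> \<mu> * (\<delta> / \<mu>)" using mu by (intro mult_left_mono) simp_all
  then show ?thesis using mu by (simp add: gap_def \<delta>_def)
qed

text \<open>A bound at almost every time says nothing directly about the single time
  \<open>T\<close>. If it failed there, convergence in L2 of the continuous representative would
  make it fail on a whole interval before \<open>T\<close>, which is not a null set.\<close>

lemma final_distance:
  assumes T: "T > 0" and tv: "time_value T u T uT" and v: "sqi (D 0 1) v"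
    and m: "\<And>t. t \<in> {0<..<T} \<Longrightarrow> u t \<in> borel_measurable (D 0 1)"
    and lb: "AE t in D 0 T. c \<le> nrm (\<lambda>x. u t x - v x)"
  shows "c \<le> nrm (\<lambda>x. uT x - v x)"
proof (rule ccontr)
  assume less: "\<not> c \<le> nrm (\<lambda>x. uT x - v x)"
  obtain W where W: "trace_rep T u T uT W"
    using time_value_limit[OF tv] by (elim exE)
  have sW: "\<And>t. t \<in> {0..T} \<Longrightarrow> sqi (D 0 1) (W t)" and aeW: "AE t in D 0 T. AE x in D 0 1. W t x = u t x" and WT: "W T = uT"
    using W by auto
  have suT: "sqi (D 0 1) uT" using sW[of T] WT T by simp
  have "((\<lambda>\<tau>. nrm (\<lambda>x. W \<tau> x - uT x)) \<longlongrightarrow> 0) (at_left T)"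
    using W T by (auto simp: at_within_Icc_at_left dest: bspec[of _ _ T])
  then have "eventually (\<lambda>\<tau>. nrm (\<lambda>x. W \<tau> x - uT x) < c - nrm (\<lambda>x. uT x - v x)) (at_left T)"
    by (rule order_tendstoD(2)) (use less in linarith)
  then obtain b where b: "b < T" "\<And>\<tau>. b < \<tau> \<Longrightarrow> \<tau> < T \<Longrightarrow> nrm (\<lambda>x. W \<tau> x - uT x) < c - nrm (\<lambda>x. uT x - v x)"
    unfolding eventually_at_left_field by blast
  have "AE t in D (max 0 b) T. c \<le> nrm (\<lambda>x. u t x - v x) \<and> (AE x in D 0 1. W t x = u t x)"
    using AE_D_subinterval[OF lb, of "max 0 b" T] AE_D_subinterval[OF aeW, of "max 0 b" T] by simp
  then obtain t where t: "t \<in> {max 0 b<..<T}" "c \<le> nrm (\<lambda>x. u t x - v x) \<and> (AE x in D 0 1. W t x = u t x)"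
    by (rule AE_D_obtain) (use T b(1) in simp)
  have t': "t \<in> {0<..<T}" "t \<in> {0..T}" using t(1) by auto
  have "sqn (\<lambda>x. u t x - v x) = sqn (\<lambda>x. W t x - v x)"
  proof (rule integral_cong_AE)
    show "AE x in D 0 1. (u t x - v x)\<^sup>2 = (W t x - v x)\<^sup>2"
      using conjunct2[OF t(2)] by eventually_elim simp
  qed (use m[OF t'(1)] sqi_measurable[OF sW[OF t'(2)]] sqi_measurable[OF v] in measurable)
  moreover have "nrm (\<lambda>x. W t x - v x) \<le> nrm (\<lambda>x. W t x - uT x) + nrm (\<lambda>x. uT x - v x)"
    using sqi_triangle[OF sqi_diff[OF sW[OF t'(2)] suT] sqi_diff[OF suT v]] by simp
  moreover have "nrm (\<lambda>x. W t x - uT x) < c - nrm (\<lambda>x. uT x - v x)" using t(1) by (intro b(2)) simp_all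
  ultimately show False using t(2) by simp
qed

lemma H1_norm_ge_L2: "ennreal (sqrt (LINT x|D a b. (f x)\<^sup>2)) \<le> H1_norm a b f"
  unfolding H1_norm_def L2_norm_on_eq by (auto intro!: ennreal_leI real_le_rsqrt)

theorem theorem2:
  fixes \<mu> Fr r T :: real
  assumes "\<mu> > 0" and "Fr > 0" and "r = 1 / (\<mu> * Fr\<^sup>2)" and "T > 0"
  shows "\<exists>(h0 :: real \<Rightarrow> real) (h1 :: real \<Rightarrow> real) (u0 :: real \<Rightarrow> real) (u1 :: real \<Rightarrow> real)
            (c :: real) (c1 :: real) (C :: real).
     in_H2 0 1 h0 \<and> in_H2 0 1 h1 \<and>
     c > 0 \<and> (\<forall>x\<in>{0<..<1}. h0 x \<ge> c) \<and>
     c1 > 0 \<and> (\<forall>x\<in>{0<..<1}. h1 x \<ge> c1) \<and>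
     in_H1 0 1 u0 \<and> weak_deriv 0 1 (\<lambda>x. - \<mu> * ln (h0 x)) u0 \<and>
     in_H1 0 1 u1 \<and> weak_deriv 0 1 (\<lambda>x. - \<mu> * ln (h1 x)) u1 \<and>
     C > 0 \<and>
     (\<forall>v1 v2. in_Hs (3/4) 0 T v1 \<and> in_Hs (3/4) 0 T v2 \<and>
        (\<exists>y. point_value 0 T v1 0 y \<and> point_value 0 1 u0 0 y) \<and>
        (\<exists>y. point_value 0 T v2 0 y \<and> point_value 0 1 u0 1 y) \<longrightarrow>
        (\<forall>h u uT. associated_solution \<mu> Fr r T h0 u0 v1 v2 h u \<and> time_value T u T uT \<longrightarrow>
           H1_norm 0 1 (\<lambda>x. uT x - u1 x) \<ge> ennreal C))"
proof (intro exI conjI allI impI ballI)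
  have zero: "sqi (D 0 1) (\<lambda>x. 0)" by (rule D.sqi_const)
  show "in_H2 0 1 (\<lambda>x. 1)" by (rule in_H2_prim[OF prim_const prim_const zero])
  show "in_H2 0 1 target_height" by (rule target_height_H2)
  show "(0 :: real) < 1" "(1 :: real) \<le> 1" by simp_all
  show "(0 :: real) < 1 / 2" by simp
  show "1 / 2 \<le> target_height x" for x by (rule target_height_bounds)
  show "in_H1 0 1 (\<lambda>x. 0)" by (rule in_H1_prim[OF prim_const zero])
  show "weak_deriv 0 1 (\<lambda>x. - \<mu> * ln 1) (\<lambda>x. 0)" by (rule prim_weak_deriv[OF prim_const]) simp
  show "in_H1 0 1 (target_velocity \<mu>)" by (rule target_velocity_H1)
  show "weak_deriv 0 1 (\<lambda>x. - \<mu> * ln (target_height x)) (target_velocity \<mu>)"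
    by (rule prim_weak_deriv[OF target_log_prim]) simp
  show "gap \<mu> > 0" by (rule gap_pos[OF assms(1)])
  fix v1 v2 h u uT
  assume *: "associated_solution \<mu> Fr r T (\<lambda>x. 1) (\<lambda>x. 0) v1 v2 h u \<and> time_value T u T uT"
  have su: "sqi (cyl T) (case_prod u)"
    using * by (auto simp: associated_solution_def in_X_def in_L2_H2_def in_L2_L2_def L2_on_pair_iff)
  have m: "u t \<in> borel_measurable (D 0 1)" if "t \<in> {0<..<T}" for t
    by (rule slice_measurable[OF sqi_measurable[OF su] that])
  have lb: "AE t in D 0 T. gap \<mu> \<le> nrm (\<lambda>x. u t x - target_velocity \<mu> x)"
    using associated_solution_moment[OF assms conjunct1[OF *]]
    by eventually_elim (rule target_distance[OF assms(1)]; simp)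
  have "gap \<mu> \<le> nrm (\<lambda>x. uT x - target_velocity \<mu> x)"
    by (rule final_distance[OF assms(4) conjunct2[OF *] sqi_continuous[OF target_velocity_continuous] m lb])
  then show "ennreal (gap \<mu>) \<le> H1_norm 0 1 (\<lambda>x. uT x - target_velocity \<mu> x)"
    by (rule order_trans[OF ennreal_leI H1_norm_ge_L2])
qed

end
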